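(* Let $K$ be a function field of transcendence degree $1$ over an algebraically closed field $k$ of characteristic $0$, let $f\in K[x]$ be a cubic polynomial, and let $\beta\in K$. Suppose there exists $\sigma\in\overline K[x]$ of degree one such that $\sigma\circ f\circ\sigma^{-1}\in k[x]$. Then the following are equivalent: (1) $\sigma(\beta)\notin k$, $f$ is not PCF, $f$ has distinct finite critical points $\gamma_1,\gamma_2$, and $f^n(\gamma_1)\neq f^n(\gamma_2)$ for all $n\ge1$. (2) The group $G_\infty(f,\beta)$ has finite index in $\mathrm{Aut}(T_\infty)$.
   Context: $f^n$ is the $n$-th iterate. $K_n(\beta)$ is $K(\beta)$ with all solutions of $f^n(x)=\beta$ adjoined, $G_n(f,\beta)=\mathrm{Gal}(K_n(\beta)/K(\beta))$, and $G_\infty(f,\beta)$ is the Galois group of $\bigcup_nK_n(\beta)$ over $K(\beta)$. $T_\infty$ is the complete infinite rooted ternary tree; the tree of preimages of $\beta$ (level $i$ = solutions of $f^i(x)=\beta$ with multiplicity, edges $z\mapsto f(z)$) is isomorphic to $T_\infty$ and $G_\infty(f,\beta)$ acts faithfully on it, giving an embedding $G_\infty(f,\beta)\hookrightarrow\mathrm{Aut}(T_\infty)$. $f$ is PCF if only finitely many points lie in forward orbits $\{f^n(\gamma):n\ge1\}$ of critical points $\gamma$ of $f$. *)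

theory Defs
  imports
    "HOL-Algebra.Algebraic_Closure_Type"
    "HOL-Algebra.Bij"
    "HOL-Algebra.Coset"
    "HOL-Algebra.Generated_Fields"
begin

section \<open>Fields inside a fixed algebraic closure\<close>

text \<open>The type \<open>'a\<close> plays the role of the algebraic closure of \<open>K\<close>; the fields \<open>k \<subseteq> K\<close> and all
  extensions of \<open>K\<close> are subsets of it.\<close>

abbreviation Kbar :: "'a::field ring" where
  "Kbar \<equiv> ring_of_type_algebra"

text \<open>Function field: finitely generated as a field extension. Transcendence degree one: some
  singleton \<open>{t}\<close> is a transcendence basis.\<close>

definition function_field_trdeg_1 :: "'a::field set \<Rightarrow> 'a set \<Rightarrow> bool" where
  "function_field_trdeg_1 k K \<longleftrightarrow>
     subfield k Kbar \<and> subfield K Kbar \<and> k \<subseteq> K \<and>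
     (\<exists>S. finite S \<and> K = generate_field Kbar (k \<union> S)) \<and>
     (\<exists>t\<in>K. (ring.transcendental Kbar over k) t \<and>
        (\<forall>x\<in>K. (ring.algebraic Kbar over generate_field Kbar (insert t k)) x))"

definition galois_group :: "'a::field set \<Rightarrow> 'a set \<Rightarrow> ('a \<Rightarrow> 'a) monoid" where
  "galois_group L F = BijGroup L
     \<lparr>carrier := {g \<in> Bij L. g \<in> ring_hom (Kbar\<lparr>carrier := L\<rparr>) (Kbar\<lparr>carrier := L\<rparr>) \<and>
                             (\<forall>x\<in>F. g x = x)}\<rparr>"


section \<open>Polynomials and their iterates\<close>

definition linear_inverse :: "'a::field poly \<Rightarrow> 'a poly" where
  "linear_inverse s = [:- (poly.coeff s 0 / poly.coeff s 1), 1 / poly.coeff s 1:]"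

lemma linear_inverse:
  assumes "Polynomial.degree s = 1"
  shows "pcompose s (linear_inverse s) = [:0, 1:]" "pcompose (linear_inverse s) s = [:0, 1:]"
proof -
  obtain b a where s: "s = [:b, a:]"
    using degree1_coeffs assms by (metis One_nat_def)
  with assms have "a \<noteq> 0"
    by auto
  with s show "pcompose s (linear_inverse s) = [:0, 1:]" "pcompose (linear_inverse s) s = [:0, 1:]"
    by (simp_all add: linear_inverse_def pcompose_pCons)
qed

definition iterate_poly :: "'a::comm_ring_1 poly \<Rightarrow> nat \<Rightarrow> 'a poly" where
  "iterate_poly f n = ((\<lambda>p. pcompose p f) ^^ n) [:0, 1:]"

lemma iterate_poly_0: "iterate_poly f 0 = [:0, 1:]"
  and iterate_poly_Suc: "iterate_poly f (Suc n) = pcompose (iterate_poly f n) f"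
  by (simp_all add: iterate_poly_def)

lemma poly_iterate_poly: "poly (iterate_poly f n) x = (poly f ^^ n) x"
  by (induction n arbitrary: x)
     (simp_all add: iterate_poly_0 iterate_poly_Suc poly_pcompose funpow_swap1)

text \<open>The point at infinity is a fixed critical point of every nonlinear polynomial and does not
  affect finiteness.\<close>

definition PCF :: "'a::field poly \<Rightarrow> bool" where
  "PCF f \<longleftrightarrow> finite {poly (iterate_poly f n) \<gamma> | n \<gamma>. n \<ge> 1 \<and> poly (pderiv f) \<gamma> = 0}"

definition preimage_field :: "'a::field set \<Rightarrow> 'a poly \<Rightarrow> 'a \<Rightarrow> nat \<Rightarrow> 'a set" where
  "preimage_field K f \<beta> n =
     generate_field Kbar (generate_field Kbar (insert \<beta> K) \<union> {x. poly (iterate_poly f n) x = \<beta>})"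

definition G_infinity :: "'a::field set \<Rightarrow> 'a poly \<Rightarrow> 'a \<Rightarrow> ('a \<Rightarrow> 'a) monoid" where
  "G_infinity K f \<beta> = galois_group (\<Union>n. preimage_field K f \<beta> n) (generate_field Kbar (insert \<beta> K))"


section \<open>Trees\<close>

text \<open>Edges are directed towards the root, which is thereby the only vertex without an outgoing
  edge; hence isomorphisms preserve the root and the levels.\<close>

definition tree_iso ::
  "'v set \<Rightarrow> ('v \<times> 'v) set \<Rightarrow> 'w set \<Rightarrow> ('w \<times> 'w) set \<Rightarrow> ('v \<Rightarrow> 'w) \<Rightarrow> bool" where
  "tree_iso V E W F h \<longleftrightarrow>
     bij_betw h V W \<and> (\<forall>u\<in>V. \<forall>v\<in>V. (u, v) \<in> E \<longleftrightarrow> (h u, h v) \<in> F)"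

definition T_vertices :: "nat list set" where
  "T_vertices = lists {..<3}"

definition T_edges :: "(nat list \<times> nat list) set" where
  "T_edges = {(a # w, w) | a w. a # w \<in> T_vertices}"

definition Aut_T :: "(nat list \<Rightarrow> nat list) monoid" where
  "Aut_T = BijGroup T_vertices
     \<lparr>carrier := {h \<in> Bij T_vertices. tree_iso T_vertices T_edges T_vertices T_edges h}\<rparr>"

text \<open>The vertices \<open>(i, z, j)\<close> with \<open>z\<close> a root of \<open>f\<^sup>i - \<beta>\<close> are the copies of \<open>z\<close> on level
  \<open>i\<close>, as many as the multiplicity of \<open>z\<close>. This multiplicity is the product of the multiplicity
  \<open>e\<close> of \<open>z\<close> as a root of \<open>f - f(z)\<close> and the multiplicity of \<open>f(z)\<close> as a root of
  \<open>f\<^bsup>i-1\<^esup> - \<beta>\<close>; so \<open>j \<mapsto> j div e\<close> attaches \<open>e\<close> copies of \<open>z\<close> to each copy of \<open>f(z)\<close>.\<close>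

definition preimage_vertices :: "'a::field poly \<Rightarrow> 'a \<Rightarrow> (nat \<times> 'a \<times> nat) set" where
  "preimage_vertices f \<beta> = {(i, z, j). j < Polynomial.order z (iterate_poly f i - [:\<beta>:])}"

definition preimage_edges ::
  "'a::field poly \<Rightarrow> 'a \<Rightarrow> ((nat \<times> 'a \<times> nat) \<times> (nat \<times> 'a \<times> nat)) set" where
  "preimage_edges f \<beta> =
     {((Suc i, z, j), (i, poly f z, j div Polynomial.order z (f - [:poly f z:]))) | i z j.
        (Suc i, z, j) \<in> preimage_vertices f \<beta>}"

text \<open>The homomorphism from \<open>G_infinity K f \<beta>\<close> to \<open>Aut_T\<close> obtained by transporting the action
  \<open>(i, z, j) \<mapsto> (i, g z, j)\<close> along an isomorphism \<open>h\<close> from the tree of preimages to the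
  ternary tree.\<close>

definition arboreal_rep ::
  "'a::field poly \<Rightarrow> 'a \<Rightarrow> (nat \<times> 'a \<times> nat \<Rightarrow> nat list) \<Rightarrow> ('a \<Rightarrow> 'a) \<Rightarrow> nat list \<Rightarrow> nat list" where
  "arboreal_rep f \<beta> h g =
     (\<lambda>w\<in>T_vertices. case inv_into (preimage_vertices f \<beta>) h w of (i, z, j) \<Rightarrow> h (i, g z, j))"


section \<open>The tree of preimages is a complete ternary tree\<close>

lemma order_pcompose:
  fixes p f :: "'a::field poly"
  assumes "p \<noteq> 0" "Polynomial.degree f > 0"
  shows "Polynomial.order z (pcompose p f)
           = Polynomial.order z (f - [:poly f z:]) * Polynomial.order (poly f z) p"
proof -
  let ?y = "poly f z"
  let ?m = "Polynomial.order ?y p"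
  obtain q where q: "p = [:- ?y, 1:] ^ ?m * q" "\<not> [:- ?y, 1:] dvd q"
    using order_decomp[OF assms(1)] by blast
  have fy: "pcompose [:- ?y, 1:] f = f - [:?y:]"
    by (simp add: pcompose_pCons)
  have nz: "f - [:?y:] \<noteq> 0"
    using assms(2) by (metis degree_pCons_0 eq_iff_diff_eq_0 less_irrefl)
  have q0: "poly (pcompose q f) z \<noteq> 0"
    using q(2) by (simp add: poly_pcompose poly_eq_0_iff_dvd)
  have pc: "pcompose (r ^ n) f = pcompose r f ^ n" for r n
    by (induction n) (simp_all add: pcompose_mult pcompose_1)
  have eq: "pcompose p f = (f - [:?y:]) ^ ?m * pcompose q f"
    by (subst q(1)) (simp add: pcompose_mult pc fy)
  have nz': "(f - [:?y:]) ^ ?m * pcompose q f \<noteq> 0"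
    using nz q0 by auto
  have pw: "Polynomial.order z ((f - [:?y:]) ^ n) = n * Polynomial.order z (f - [:?y:])" for n
    by (induction n) (use nz in \<open>auto simp: order_mult\<close>)
  show ?thesis
    unfolding eq using order_mult[OF nz'] pw q0 by (simp add: order_0I mult.commute)
qed

lemma sum_order_eq_degree:
  fixes p :: "'a::alg_closed_field poly"
  assumes "p \<noteq> 0"
  shows "(\<Sum>z | poly p z = 0. Polynomial.order z p) = Polynomial.degree p"
proof -
  obtain A where A: "size A = Polynomial.degree p"
    "p = smult (Polynomial.lead_coeff p) (\<Prod>x\<in>#A. [:-x, 1:])"
    using alg_closed_imp_factorization[OF assms] by blast
  have "proots p = proots (\<Prod>x\<in>#A. [:-x, 1:])"
    using assms by (subst A(2)) simp
  also have "proots (\<Prod>x\<in>#A. [:-x, 1:]) = A"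
  proof (induction A)
    case (add x A)
    have "(\<Prod>x\<in>#A. [:-x, 1:]) \<noteq> 0"
      by (subst prod_mset_zero_iff) auto
    hence "proots ([:-x, 1:] * (\<Prod>x\<in>#A. [:-x, 1:])) = {#x#} + A"
      by (subst proots_mult) (use add in auto)
    thus ?case
      by (simp del: mult_pCons_left)
  qed auto
  finally have "proots p = A" .
  with A(1) have "size (proots p) = Polynomial.degree p"
    by simp
  thus ?thesis
    using assms by (simp add: size_multiset_overloaded_eq)
qed

lemma iterate_poly_diff_nonzero:
  fixes f :: "'a::field poly"
  assumes "Polynomial.degree f = 3"
  shows "iterate_poly f n - [:\<beta>:] \<noteq> 0"
proof -
  have "Polynomial.degree (iterate_poly f n) = 3 ^ n"
    by (induction n) (simp_all add: iterate_poly_0 iterate_poly_Suc degree_pcompose assms)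
  hence "Polynomial.degree (iterate_poly f n) > 0"
    by simp
  thus ?thesis
    by (metis degree_pCons_0 eq_iff_diff_eq_0 less_irrefl)
qed

lemma order_iterate_poly_Suc:
  fixes f :: "'a::field poly"
  assumes "Polynomial.degree f = 3"
  shows "Polynomial.order z (iterate_poly f (Suc i) - [:\<beta>:]) =
           Polynomial.order z (f - [:poly f z:]) *
           Polynomial.order (poly f z) (iterate_poly f i - [:\<beta>:])"
proof -
  have "iterate_poly f (Suc i) - [:\<beta>:] = pcompose (iterate_poly f i - [:\<beta>:]) f"
    by (simp add: iterate_poly_Suc pcompose_diff)
  thus ?thesis
    using order_pcompose[OF iterate_poly_diff_nonzero[OF assms], of f z i \<beta>] assms by simp
qed

lemma card_preimage_children:
  fixes f :: "'a::alg_closed_field poly"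
  assumes f: "Polynomial.degree f = 3" and v: "v \<in> preimage_vertices f \<beta>"
  shows "card {u. (u, v) \<in> preimage_edges f \<beta>} = 3"
proof -
  obtain i y j where ijy: "v = (i, y, j)"
    by (cases v)
  have j: "j < Polynomial.order y (iterate_poly f i - [:\<beta>:])"
    using v by (simp add: ijy preimage_vertices_def)
  let ?e = "\<lambda>z. Polynomial.order z (f - [:y:])"
  let ?Z = "{z. poly (f - [:y:]) z = 0}"
  have nz: "f - [:y:] \<noteq> 0"
    using f by (metis degree_pCons_0 eq_iff_diff_eq_0 zero_neq_numeral)
  have e0: "?e z > 0" if "poly f z = y" for z
    using that nz by (simp add: order_gt_0_iff)
  have div: "j' div ?e z = j \<longleftrightarrow> j' \<in> {?e z * j ..< ?e z * Suc j}" if "poly f z = y" for z j'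
    using e0[OF that] by (auto simp: div_nat_eqI mult.commute dividend_less_times_div)
  have "{u. (u, v) \<in> preimage_edges f \<beta>} =
          (\<lambda>(z, j'). (Suc i, z, j')) ` (SIGMA z:?Z. {?e z * j ..< ?e z * Suc j})"
    (is "?L = ?R")
  proof (intro equalityI subsetI)
    fix u assume "u \<in> ?L"
    then obtain z j' where "u = (Suc i, z, j')" "poly f z = y" "j' div ?e z = j"
      by (auto simp: preimage_edges_def ijy)
    thus "u \<in> ?R"
      using div by (auto intro!: image_eqI[of _ _ "(z, j')"])
  next
    fix u assume "u \<in> ?R"
    then obtain z j' where u: "u = (Suc i, z, j')" "poly f z = y" "j' \<in> {?e z * j ..< ?e z * Suc j}"
      by auto
    have "j' < ?e z * Suc j"
      using u(3) by simp
    also have "\<dots> \<le> ?e z * Polynomial.order y (iterate_poly f i - [:\<beta>:])"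
      using j by (intro mult_left_mono) auto
    also have "\<dots> = Polynomial.order z (iterate_poly f (Suc i) - [:\<beta>:])"
      using order_iterate_poly_Suc[OF f, of z i \<beta>] u(2) by simp
    finally have "(Suc i, z, j') \<in> preimage_vertices f \<beta>"
      by (simp add: preimage_vertices_def)
    moreover have "j' div ?e z = j"
      using div u by blast
    ultimately show "u \<in> ?L"
      using u by (auto simp: preimage_edges_def ijy)
  qed
  moreover have "inj_on (\<lambda>(z, j'). (Suc i, z, j')) A" for A :: "('a \<times> nat) set"
    by (auto simp: inj_on_def)
  ultimately have "card {u. (u, v) \<in> preimage_edges f \<beta>} =
      card (SIGMA z:?Z. {?e z * j ..< ?e z * Suc j})"
    by (simp only: card_image)
  also have "\<dots> = (\<Sum>z\<in>?Z. ?e z)"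
    using poly_roots_finite[OF nz] by (subst card_SigmaI) auto
  also have "\<dots> = Polynomial.degree (f - [:y:])"
    by (rule sum_order_eq_degree[OF nz])
  also have "\<dots> = 3"
    using f degree_add_eq_left[of "- [:y:]" f] by (subst diff_conv_add_uminus) simp
  finally show ?thesis .
qed

lemma preimage_tree_iso_exists:
  fixes f :: "'a::alg_closed_field poly"
  assumes f: "Polynomial.degree f = 3"
  shows "\<exists>h. tree_iso (preimage_vertices f \<beta>) (preimage_edges f \<beta>) T_vertices T_edges h"
proof -
  define V where "V = preimage_vertices f \<beta>"
  define E where "E = preimage_edges f \<beta>"
  define par where "par = (\<lambda>(i, z, j). (i - 1 :: nat, poly f z, j div Polynomial.order z (f - [:poly f z:])))"
  have par_fst: "fst (par u) = fst u - 1" for u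
    by (cases u) (simp add: par_def)
  have E_iff: "(u, v) \<in> E \<longleftrightarrow> u \<in> V \<and> fst u > 0 \<and> v = par u" for u v
  proof (cases u)
    case (fields i z j)
    thus ?thesis
      by (cases i) (auto simp: E_def V_def preimage_edges_def par_def)
  qed
  have par_V: "par u \<in> V" if "u \<in> V" "fst u > 0" for u
  proof -
    obtain i z j where u: "u = (Suc i, z, j)"
      using \<open>fst u > 0\<close> by (cases u; cases "fst u") auto
    have "j < Polynomial.order z (f - [:poly f z:]) *
           Polynomial.order (poly f z) (iterate_poly f i - [:\<beta>:])"
      using that(1) order_iterate_poly_Suc[OF f, of z i \<beta>] by (simp add: V_def u preimage_vertices_def)
    thus ?thesis
      by (simp add: u par_def V_def preimage_vertices_def less_mult_imp_div_less mult.commute)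
  qed
  have root: "u \<in> V \<and> fst u = 0 \<longleftrightarrow> u = (0, \<beta>, 0)" for u
  proof -
    have "Polynomial.order z (iterate_poly f 0 - [:\<beta>:]) = (if z = \<beta> then 1 else 0)" for z
      using order_power_n_n[of \<beta> 1] by (auto simp: iterate_poly_0 intro: order_0I)
    thus ?thesis
      by (cases u) (auto simp: V_def preimage_vertices_def split: if_splits)
  qed
  have "\<exists>b. bij_betw b {u. (u, v) \<in> E} {..<3::nat}" if "v \<in> V" for v
  proof -
    have c: "card {u. (u, v) \<in> E} = 3"
      using card_preimage_children[OF f] that by (simp add: E_def V_def)
    hence "finite {u. (u, v) \<in> E}"
      by (metis card.infinite zero_neq_numeral)
    with c show ?thesis
      using ex_bij_betw_finite_nat[of "{u. (u, v) \<in> E}"] by (simp add: lessThan_atLeast0)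
  qed
  then obtain b where b: "\<And>v. v \<in> V \<Longrightarrow> bij_betw (b v) {u. (u, v) \<in> E} {..<3::nat}"
    by metis
  define lab where "lab = rec_nat (\<lambda>u. []) (\<lambda>_ r u. b (par u) u # r (par u))"
  have lab_0: "lab 0 u = []" and lab_Suc: "lab (Suc n) u = b (par u) u # lab n (par u)" for n u
    by (simp_all add: lab_def)
  define h where "h = (\<lambda>u. lab (fst u) u)"
  have h_0: "h u = []" if "fst u = 0" for u
    using that by (simp add: h_def lab_0)
  have h_Suc: "h u = b (par u) u # h (par u)" if "fst u > 0" for u
    using that by (cases "fst u") (simp_all add: h_def lab_Suc par_fst)
  have len: "length (h u) = fst u" for u
    by (induction "fst u" arbitrary: u) (simp_all add: h_0 h_Suc par_fst)
  have h_T: "h u \<in> T_vertices" if "u \<in> V" for u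
    using that
  proof (induction "fst u" arbitrary: u)
    case 0
    thus ?case by (simp add: h_0 T_vertices_def)
  next
    case (Suc n)
    hence pos: "fst u > 0" by simp
    have "b (par u) u \<in> {..<3}"
      using b[OF par_V[OF Suc.prems pos]] E_iff Suc.prems pos by (auto simp: bij_betw_def)
    moreover have "n = fst (par u)"
      using Suc.hyps(2) par_fst[of u] by linarith
    hence "h (par u) \<in> T_vertices"
      using Suc.hyps(1) par_V[OF Suc.prems pos] by blast
    ultimately show ?case
      by (simp add: h_Suc[OF pos] T_vertices_def)
  qed
  have inj: "u = v" if "u \<in> V" "v \<in> V" "h u = h v" for u v
    using that
  proof (induction "fst u" arbitrary: u v)
    case 0
    have "fst v = 0"
      using len[of u] len[of v] 0 by simp
    thus ?case
      using root 0 by metis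
  next
    case (Suc n)
    have pos: "fst u > 0" "fst v > 0"
      using len[of u] len[of v] Suc by simp_all
    have eq: "b (par u) u = b (par v) v" "h (par u) = h (par v)"
      using Suc.prems(3) by (simp_all add: h_Suc pos)
    have "n = fst (par u)"
      using Suc.hyps(2) par_fst[of u] by linarith
    hence par_eq: "par u = par v"
      using Suc.hyps(1) eq(2) par_V Suc.prems pos by blast
    have "inj_on (b (par v)) {w. (w, par v) \<in> E}"
      using b[OF par_V[OF Suc.prems(2) pos(2)]] by (simp add: bij_betw_def)
    moreover have "(u, par v) \<in> E" "(v, par v) \<in> E"
      using E_iff Suc.prems pos par_eq by simp_all
    ultimately show ?case
      using eq(1) unfolding par_eq by (blast dest: inj_onD)
  qed
  have surj: "\<exists>u\<in>V. h u = w" if "w \<in> T_vertices" for w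
    using that
  proof (induction w)
    case Nil
    show ?case
      using root[of "(0, \<beta>, 0)"] h_0[of "(0, \<beta>, 0)"] by auto
  next
    case (Cons a w)
    then obtain v where v: "v \<in> V" "h v = w"
      by (auto simp: T_vertices_def)
    have "a \<in> {..<3}"
      using Cons.prems by (simp add: T_vertices_def)
    hence "a \<in> b v ` {u. (u, v) \<in> E}"
      using b[OF v(1)] by (simp only: bij_betw_def)
    then obtain u where "(u, v) \<in> E" "b v u = a"
      by blast
    hence "u \<in> V" "h u = a # w"
      using v(2) h_Suc[of u] unfolding E_iff by simp_all
    thus ?case
      by blast
  qed
  have "bij_betw h V T_vertices"
  proof (rule bij_betw_imageI)
    show "inj_on h V"
      using inj by (rule inj_onI)
    show "h ` V = T_vertices"
      using h_T surj by (metis (no_types, lifting) image_eqI image_subsetI subsetI subset_antisym)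
  qed
  moreover have "(u, v) \<in> E \<longleftrightarrow> (h u, h v) \<in> T_edges" if uv: "u \<in> V" "v \<in> V" for u v
  proof
    assume "(u, v) \<in> E"
    hence "h u = b v u # h v"
      using h_Suc[of u] unfolding E_iff by simp
    thus "(h u, h v) \<in> T_edges"
      using h_T[OF uv(1)] by (auto simp: T_edges_def)
  next
    assume "(h u, h v) \<in> T_edges"
    then obtain a where a: "h u = a # h v"
      by (auto simp: T_edges_def)
    hence pos: "fst u > 0"
      using len[of u] by simp
    have "h (par u) = h v"
      using a h_Suc[OF pos] by simp
    hence "par u = v"
      using inj par_V uv pos by blast
    thus "(u, v) \<in> E"
      using E_iff uv pos by blast
  qed
  ultimately show ?thesis
    unfolding tree_iso_def V_def E_def by blast
qed

end

theory Submission
  imports Defs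
begin

text \<open>
  Write \<open>g = \<sigma> \<circ> f \<circ> \<sigma>\<^sup>-\<^sup>1\<close> and \<open>b = \<sigma>(\<beta>)\<close>. If \<open>b \<in> k\<close>, all iterated preimages of \<open>\<beta>\<close> lie in a fixed
  finite extension of \<open>K\<close>, so the Galois image is finite.

  Let \<open>b \<notin> k\<close>, so that \<open>b\<close> is transcendental over \<open>k\<close>. The discriminants of the polynomials
  \<open>f - v\<close>, multiplied over the roots \<open>v\<close> of \<open>f\<^sup>n - \<beta>\<close>, equal
  \<open>(\<beta> - f\<^bsup>n+1\<^esup>(\<gamma>\<^sub>1)) (\<beta> - f\<^bsup>n+1\<^esup>(\<gamma>\<^sub>2))\<close> up to squares. If \<open>f\<close> is PCF or the critical orbits meet
  simultaneously, the square roots of these numbers generate a finite extension, hence the signs on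
  the levels take finitely many values on the Galois group but infinitely many on the automorphism
  group of the tree, and the index is infinite.

  Otherwise some critical point \<open>\<gamma>\<close> of \<open>g\<close> satisfies \<open>g\<^sup>i(\<gamma>') \<noteq> g\<^sup>n(\<gamma>)\<close> for all critical \<open>\<gamma>'\<close> and
  \<open>1 \<le> i \<le> n\<close> except for \<open>(i, \<gamma>') = (n, \<gamma>)\<close>. Then \<open>g\<^sup>n\<close> has exactly one ramified point, of index two,
  over \<open>g\<^sup>n(\<gamma>)\<close>, so inertia is generated by one transposition of siblings on level \<open>n\<close>. With
  transitivity, all sibling transpositions occur, the Galois group over \<open>k(b)\<close> is the full
  automorphism group, and passing from \<open>k(b)\<close> to \<open>K\<close> costs only finite index.
\<close>

section \<open>Graphs of partial field homomorphisms\<close>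

text \<open>The Galois-theoretic input must cross between fields of different type, because inertia
  at a branch point becomes visible only after embedding the fibre into Laurent series.
  Homomorphisms between subfields are therefore relations: domain and range need no names,
  composition and inverse are relational, and one extension principle serves both the algebraic
  closure and the Laurent series. The last clause of \<open>hgraph\<close> yields single-valuedness,
  and injectivity follows.

  The critical point has to be chosen once for all levels. A critical point of g^n is an iterated
  preimage of a critical point \<delta> of g and has the value g^i(\<delta>) with 1 \<le> i \<le> n,
  so only coincidences with i \<le> n do harm; a longer path from the other critical point is
  harmless. This asymmetry is why one of the two critical points qualifies even if their orbits
  merge at different times.

  Passing from k(b) to K loses only what finitely many elements can record: generators of K over k,
  and the two coefficients of \<sigma>, which may lie outside K.\<close>

definition hgraph :: "('a::field \<times> 'b::field) set \<Rightarrow> bool" where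
  "hgraph \<Gamma> \<longleftrightarrow> (1, 1) \<in> \<Gamma> \<and>
     (\<forall>x x' y y'. (x, x') \<in> \<Gamma> \<longrightarrow> (y, y') \<in> \<Gamma> \<longrightarrow> (x - y, x' - y') \<in> \<Gamma> \<and> (x * y, x' * y') \<in> \<Gamma>) \<and>
     (\<forall>x x'. (x, x') \<in> \<Gamma> \<longrightarrow> (inverse x, inverse x') \<in> \<Gamma>) \<and>
     (\<forall>y. (0, y) \<in> \<Gamma> \<longrightarrow> y = 0)"

lemma hgraphD:
  assumes "hgraph \<Gamma>"
  shows "(1, 1) \<in> \<Gamma>" "(0, 0) \<in> \<Gamma>"
    "\<And>x x' y y'. (x, x') \<in> \<Gamma> \<Longrightarrow> (y, y') \<in> \<Gamma> \<Longrightarrow> (x + y, x' + y') \<in> \<Gamma>"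
    "\<And>x x' y y'. (x, x') \<in> \<Gamma> \<Longrightarrow> (y, y') \<in> \<Gamma> \<Longrightarrow> (x - y, x' - y') \<in> \<Gamma>"
    "\<And>x x' y y'. (x, x') \<in> \<Gamma> \<Longrightarrow> (y, y') \<in> \<Gamma> \<Longrightarrow> (x * y, x' * y') \<in> \<Gamma>"
    "\<And>x x'. (x, x') \<in> \<Gamma> \<Longrightarrow> (- x, - x') \<in> \<Gamma>"
    "\<And>x x'. (x, x') \<in> \<Gamma> \<Longrightarrow> (inverse x, inverse x') \<in> \<Gamma>"
    "\<And>x x' y y'. (x, x') \<in> \<Gamma> \<Longrightarrow> (y, y') \<in> \<Gamma> \<Longrightarrow> (x / y, x' / y') \<in> \<Gamma>"
    "\<And>y. (0, y) \<in> \<Gamma> \<Longrightarrow> y = 0" "\<And>x. (x, 0) \<in> \<Gamma> \<Longrightarrow> x = 0"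
    "\<And>x y y'. (x, y) \<in> \<Gamma> \<Longrightarrow> (x, y') \<in> \<Gamma> \<Longrightarrow> y = y'"
    "\<And>x x' y. (x, y) \<in> \<Gamma> \<Longrightarrow> (x', y) \<in> \<Gamma> \<Longrightarrow> x = x'"
proof -
  show one: "(1, 1) \<in> \<Gamma>"
    and diff: "\<And>x x' y y'. (x, x') \<in> \<Gamma> \<Longrightarrow> (y, y') \<in> \<Gamma> \<Longrightarrow> (x - y, x' - y') \<in> \<Gamma>"
    and mult: "\<And>x x' y y'. (x, x') \<in> \<Gamma> \<Longrightarrow> (y, y') \<in> \<Gamma> \<Longrightarrow> (x * y, x' * y') \<in> \<Gamma>"
    and inv: "\<And>x x'. (x, x') \<in> \<Gamma> \<Longrightarrow> (inverse x, inverse x') \<in> \<Gamma>"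
    and zl: "\<And>y. (0, y) \<in> \<Gamma> \<Longrightarrow> y = 0"
    using assms unfolding hgraph_def by blast+
  show zero: "(0, 0) \<in> \<Gamma>"
    using diff[OF one one] by simp
  show um: "(- x, - x') \<in> \<Gamma>" if "(x, x') \<in> \<Gamma>" for x x'
    using diff[OF zero that] by simp
  show "(x + y, x' + y') \<in> \<Gamma>" if "(x, x') \<in> \<Gamma>" "(y, y') \<in> \<Gamma>" for x x' y y'
    using diff[OF that(1) um[OF that(2)]] by simp
  show "(x / y, x' / y') \<in> \<Gamma>" if "(x, x') \<in> \<Gamma>" "(y, y') \<in> \<Gamma>" for x x' y y'
    using mult[OF that(1) inv[OF that(2)]] by (simp add: divide_inverse)
  show zr: "x = 0" if "(x, 0) \<in> \<Gamma>" for x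
  proof (rule ccontr)
    assume "x \<noteq> 0"
    with mult[OF that inv[OF that]] have "(1, 0) \<in> \<Gamma>"
      by simp
    with diff[OF one] have "(0, 1) \<in> \<Gamma>"
      by force
    with zl show False
      by fastforce
  qed
  show "y = y'" if "(x, y) \<in> \<Gamma>" "(x, y') \<in> \<Gamma>" for x y y'
    using zl[of "y - y'"] diff[OF that] by simp
  show "x = x'" if "(x, y) \<in> \<Gamma>" "(x', y) \<in> \<Gamma>" for x x' y
    using zr[of "x - x'"] diff[OF that] by simp
qed

text \<open>\<open>q\<close> is the image of \<open>p\<close> under the homomorphism, applied to
  coefficients; as a relation it needs no chosen map and survives enlarging the graph.\<close>

definition poly_rel :: "('a::zero \<times> 'b::zero) set \<Rightarrow> 'a poly \<Rightarrow> 'b poly \<Rightarrow> bool" where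
  "poly_rel \<Gamma> p q \<longleftrightarrow> (\<forall>i. (poly.coeff p i, poly.coeff q i) \<in> \<Gamma>)"

lemma sum_in_hgraph:
  assumes "hgraph \<Gamma>" "\<And>i. i \<in> A \<Longrightarrow> (u i, v i) \<in> \<Gamma>"
  shows "(sum u A, sum v A) \<in> \<Gamma>"
  using assms(2)
  by (induction A rule: infinite_finite_induct) (simp_all add: hgraphD(2,3)[OF assms(1)])

lemma poly_rel_0: "hgraph \<Gamma> \<Longrightarrow> poly_rel \<Gamma> 0 0"
  by (simp add: poly_rel_def hgraphD)

lemma poly_rel_pCons_iff:
  "poly_rel \<Gamma> (pCons a p) (pCons b q) \<longleftrightarrow> (a, b) \<in> \<Gamma> \<and> poly_rel \<Gamma> p q"
  unfolding poly_rel_def by (force simp: coeff_pCons split: nat.splits)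

lemma poly_rel_add:
  "hgraph \<Gamma> \<Longrightarrow> poly_rel \<Gamma> p p' \<Longrightarrow> poly_rel \<Gamma> q q' \<Longrightarrow> poly_rel \<Gamma> (p + q) (p' + q')"
  by (simp add: poly_rel_def hgraphD)

lemma poly_rel_diff:
  "hgraph \<Gamma> \<Longrightarrow> poly_rel \<Gamma> p p' \<Longrightarrow> poly_rel \<Gamma> q q' \<Longrightarrow> poly_rel \<Gamma> (p - q) (p' - q')"
  by (simp add: poly_rel_def hgraphD)

lemma poly_rel_mult:
  "hgraph \<Gamma> \<Longrightarrow> poly_rel \<Gamma> p p' \<Longrightarrow> poly_rel \<Gamma> q q' \<Longrightarrow> poly_rel \<Gamma> (p * q) (p' * q')"
  by (simp add: poly_rel_def hgraphD coeff_mult sum_in_hgraph)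

lemma poly_rel_monom:
  "hgraph \<Gamma> \<Longrightarrow> (c, c') \<in> \<Gamma> \<Longrightarrow> poly_rel \<Gamma> (Polynomial.monom c n) (Polynomial.monom c' n)"
  by (simp add: poly_rel_def hgraphD)

lemma poly_rel_eq_0_iff:
  assumes "hgraph \<Gamma>" "poly_rel \<Gamma> p p'"
  shows "p = 0 \<longleftrightarrow> p' = 0"
proof -
  have "poly.coeff p i = 0 \<longleftrightarrow> poly.coeff p' i = 0" for i
    using assms hgraphD(9,10)[OF assms(1)] unfolding poly_rel_def by metis
  thus ?thesis
    by (simp add: poly_eq_iff)
qed

lemma poly_rel_degree:
  assumes "hgraph \<Gamma>" "poly_rel \<Gamma> p p'"
  shows "Polynomial.degree p' = Polynomial.degree p"
proof -
  have "poly.coeff p i = 0 \<longleftrightarrow> poly.coeff p' i = 0" for i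
    using assms hgraphD(9,10)[OF assms(1)] unfolding poly_rel_def by metis
  thus ?thesis
    by (simp add: Polynomial.degree_def)
qed

lemma poly_rel_poly:
  assumes "hgraph \<Gamma>" "poly_rel \<Gamma> p p'" "(x, x') \<in> \<Gamma>"
  shows "(poly p x, poly p' x') \<in> \<Gamma>"
  using assms(2)
proof (induction p arbitrary: p')
  case 0
  hence "p' = 0"
    using poly_rel_eq_0_iff[OF assms(1)] by blast
  thus ?case
    using hgraphD(2)[OF assms(1)] by simp
next
  case (pCons a p)
  obtain b q where q: "p' = pCons b q"
    by (cases p')
  show ?case
    using pCons.IH[of q] pCons.prems assms(3) unfolding q poly_rel_pCons_iff
    by (auto intro!: hgraphD(3,5)[OF assms(1)])
qed

text \<open>Leading coefficients are related, hence so are their quotients: each step of long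
  division over the domain is mirrored over the range, and quotient and remainder stay
  related.\<close>

lemma poly_rel_division:
  assumes \<Gamma>: "hgraph \<Gamma>" and p: "poly_rel \<Gamma> p p'" "p \<noteq> 0" and m: "poly_rel \<Gamma> m m'"
  obtains q q' r r' where "poly_rel \<Gamma> q q'" "poly_rel \<Gamma> r r'" "m = p * q + r" "m' = p' * q' + r'"
    "r = 0 \<or> Polynomial.degree r < Polynomial.degree p"
proof -
  have "\<exists>q q' r r'. poly_rel \<Gamma> q q' \<and> poly_rel \<Gamma> r r' \<and> m = p * q + r \<and> m' = p' * q' + r' \<and>
          (r = 0 \<or> Polynomial.degree r < Polynomial.degree p)"
    using m
  \<comment> \<open>The measure ranks the zero polynomial below the nonzero constants, which have
    the same degree; this lets division by a constant terminate.\<close>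
  proof (induction "if m = 0 then 0 else Suc (Polynomial.degree m)" arbitrary: m m' rule: less_induct)
    case less
    show ?case
    proof (cases "m = 0 \<or> Polynomial.degree m < Polynomial.degree p")
      case True
      have "poly_rel \<Gamma> 0 0 \<and> poly_rel \<Gamma> m m' \<and> m = p * 0 + m \<and> m' = p' * 0 + m' \<and>
          (m = 0 \<or> Polynomial.degree m < Polynomial.degree p)"
        using True less.prems poly_rel_0[OF \<Gamma>] by simp
      thus ?thesis
        by blast
    next
      case False
      define c where "c = Polynomial.lead_coeff m / Polynomial.lead_coeff p"
      define c' where "c' = Polynomial.lead_coeff m' / Polynomial.lead_coeff p'"
      define d where "d = Polynomial.degree m - Polynomial.degree p"
      let ?s = "Polynomial.monom c d" and ?s' = "Polynomial.monom c' d"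
      have deg: "Polynomial.degree p' = Polynomial.degree p" "Polynomial.degree m' = Polynomial.degree m"
        using poly_rel_degree[OF \<Gamma>] p less.prems by auto
      have "(c, c') \<in> \<Gamma>"
        unfolding c_def c'_def deg using p(1) less.prems
        by (intro hgraphD(8)[OF \<Gamma>]) (auto simp: poly_rel_def)
      hence s: "poly_rel \<Gamma> ?s ?s'"
        by (rule poly_rel_monom[OF \<Gamma>])
      let ?n = "m - p * ?s" and ?n' = "m' - p' * ?s'"
      have n: "poly_rel \<Gamma> ?n ?n'"
        by (intro poly_rel_diff poly_rel_mult \<Gamma> less.prems p(1) s)
      have c0: "c \<noteq> 0"
        using False p(2) by (simp add: c_def)
      have degps: "Polynomial.degree (p * ?s) = Polynomial.degree m"
        using False c0 p(2) by (simp add: degree_mult_eq degree_monom_eq d_def)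
      have lc: "Polynomial.lead_coeff (p * ?s) = Polynomial.lead_coeff m"
        using p(2) c0 by (subst Polynomial.lead_coeff_mult) (simp add: degree_monom_eq c_def)
      have small: "?n = 0 \<or> Polynomial.degree ?n < Polynomial.degree m"
      proof (cases "?n = 0")
        case nz: False
        have "Polynomial.degree ?n \<le> Polynomial.degree m"
          using degps by (intro degree_diff_le) auto
        moreover have "poly.coeff ?n (Polynomial.degree m) = 0"
          using lc degps by simp
        ultimately show ?thesis
          using nz by (metis le_neq_implies_less leading_coeff_0_iff)
      qed simp
      have "(if ?n = 0 then 0 else Suc (Polynomial.degree ?n)) < (if m = 0 then 0 else Suc (Polynomial.degree m))"
        using small False by auto
      from less.hyps[OF this n] obtain q q' r r' where
        *: "poly_rel \<Gamma> q q'" "poly_rel \<Gamma> r r'" "?n = p * q + r" "?n' = p' * q' + r'"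
          "r = 0 \<or> Polynomial.degree r < Polynomial.degree p"
        by blast
      have "m = p * (q + ?s) + r" "m' = p' * (q' + ?s') + r'"
        using *(3,4) by (simp_all add: algebra_simps)
      with * poly_rel_add[OF \<Gamma> *(1) s] show ?thesis
        by blast
    qed
  qed
  thus thesis
    using that by blast
qed

text \<open>The graph of the extension sending \<open>x\<close> to \<open>y\<close>. Nonvanishing is
  demanded of \<open>poly q x\<close> only; in \<open>hgraph_hgraph_adjoin\<close> the
  correspondence of zeros carries it over to \<open>poly q' y\<close>.\<close>

definition hgraph_adjoin :: "('a::field \<times> 'b::field) set \<Rightarrow> 'a \<Rightarrow> 'b \<Rightarrow> ('a \<times> 'b) set" where
  "hgraph_adjoin \<Gamma> x y = {(poly p x / poly q x, poly p' y / poly q' y) | p p' q q'.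
     poly_rel \<Gamma> p p' \<and> poly_rel \<Gamma> q q' \<and> poly q x \<noteq> 0}"

lemma hgraph_adjoin_incl:
  assumes "hgraph \<Gamma>"
  shows "\<Gamma> \<subseteq> hgraph_adjoin \<Gamma> x y" "(x, y) \<in> hgraph_adjoin \<Gamma> x y"
proof -
  have one: "poly_rel \<Gamma> [:1:] [:1:]"
    using assms by (simp add: poly_rel_pCons_iff poly_rel_0 hgraphD)
  show "\<Gamma> \<subseteq> hgraph_adjoin \<Gamma> x y"
  proof clarify
    fix u v assume "(u, v) \<in> \<Gamma>"
    hence "poly_rel \<Gamma> [:u:] [:v:]"
      using assms by (simp add: poly_rel_pCons_iff poly_rel_0)
    with one show "(u, v) \<in> hgraph_adjoin \<Gamma> x y"
      unfolding hgraph_adjoin_def mem_Collect_eq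
      by (intro exI[of _ "[:u:]"] exI[of _ "[:v:]"] exI[of _ "[:1:]"]) simp
  qed
  have "poly_rel \<Gamma> [:0, 1:] [:0, 1:]"
    using assms by (simp add: poly_rel_pCons_iff poly_rel_0 hgraphD)
  with one show "(x, y) \<in> hgraph_adjoin \<Gamma> x y"
    unfolding hgraph_adjoin_def mem_Collect_eq
    by (intro exI[of _ "[:0, 1:]"] exI[of _ "[:1:]"]) simp
qed

text \<open>Well-definedness and injectivity of x \<mapsto> y both say that \<open>x\<close> and
  \<open>y\<close> satisfy corresponding polynomial relations. The criterion covers algebraic
  elements (\<open>hgraph_adjoin_algebraic\<close>) and transcendental ones
  (\<open>hgraph_adjoin_transcendental\<close>) alike.\<close>

lemma hgraph_hgraph_adjoin:
  assumes \<Gamma>: "hgraph \<Gamma>"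
    and iff: "\<And>p p'. poly_rel \<Gamma> p p' \<Longrightarrow> poly p x = 0 \<longleftrightarrow> poly p' y = 0"
  shows "hgraph (hgraph_adjoin \<Gamma> x y)"
  unfolding hgraph_def
proof (intro conjI allI impI)
  show "(1, 1) \<in> hgraph_adjoin \<Gamma> x y"
    using hgraph_adjoin_incl(1)[OF \<Gamma>] hgraphD(1)[OF \<Gamma>] by blast
next
  fix z assume "(0, z) \<in> hgraph_adjoin \<Gamma> x y"
  thus "z = 0"
    using iff by (force simp: hgraph_adjoin_def)
next
  fix u v assume "(u, v) \<in> hgraph_adjoin \<Gamma> x y"
  then obtain p p' q q' where *: "poly_rel \<Gamma> p p'" "poly_rel \<Gamma> q q'" "poly q x \<noteq> 0"
    "u = poly p x / poly q x" "v = poly p' y / poly q' y"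
    by (auto simp: hgraph_adjoin_def)
  show "(inverse u, inverse v) \<in> hgraph_adjoin \<Gamma> x y"
  proof (cases "poly p x = 0")
    case True
    hence "u = 0" "v = 0"
      using iff[OF *(1)] *(4,5) by auto
    thus ?thesis
      using hgraph_adjoin_incl(1)[OF \<Gamma>] hgraphD(2)[OF \<Gamma>] by auto
  next
    case False
    have "inverse u = poly q x / poly p x" "inverse v = poly q' y / poly p' y"
      using * by simp_all
    thus ?thesis
      using * False unfolding hgraph_adjoin_def by blast
  qed
next
  fix u v w z assume "(u, v) \<in> hgraph_adjoin \<Gamma> x y" "(w, z) \<in> hgraph_adjoin \<Gamma> x y"
  then obtain p p' q q' r r' s s' where *: "poly_rel \<Gamma> p p'" "poly_rel \<Gamma> q q'" "poly q x \<noteq> 0"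
    "u = poly p x / poly q x" "v = poly p' y / poly q' y"
    "poly_rel \<Gamma> r r'" "poly_rel \<Gamma> s s'" "poly s x \<noteq> 0"
    "w = poly r x / poly s x" "z = poly r' y / poly s' y"
    by (auto simp: hgraph_adjoin_def)
  have nz: "poly q' y \<noteq> 0" "poly s' y \<noteq> 0"
    using * iff by auto
  have qs: "poly_rel \<Gamma> (q * s) (q' * s')" "poly (q * s) x \<noteq> 0"
    using * poly_rel_mult[OF \<Gamma>] by auto
  have "poly_rel \<Gamma> (p * s - r * q) (p' * s' - r' * q')"
    by (intro poly_rel_diff poly_rel_mult \<Gamma> *)
  moreover have "u - w = poly (p * s - r * q) x / poly (q * s) x"
    "v - z = poly (p' * s' - r' * q') y / poly (q' * s') y"
    unfolding *(4,5,9,10) using *(3,8) nz by (simp_all add: diff_frac_eq)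
  ultimately show "(u - w, v - z) \<in> hgraph_adjoin \<Gamma> x y"
    using qs unfolding hgraph_adjoin_def by blast
  have "poly_rel \<Gamma> (p * r) (p' * r')"
    by (intro poly_rel_mult \<Gamma> *)
  moreover have "u * w = poly (p * r) x / poly (q * s) x" "v * z = poly (p' * r') y / poly (q' * s') y"
    using * nz by simp_all
  ultimately show "(u * w, v * z) \<in> hgraph_adjoin \<Gamma> x y"
    using qs unfolding hgraph_adjoin_def by blast
qed

text \<open>A polynomial m of least degree vanishing at \<open>x\<close> plays the minimal
  polynomial; its image m' divides \<open>p'\<close>, so m' has a root \<open>y\<close>. Roots are
  required only for divisors of \<open>p'\<close> because the target may be a field of Laurent
  series, which is not algebraically closed.\<close>

lemma hgraph_adjoin_algebraic:
  assumes \<Gamma>: "hgraph \<Gamma>" and p: "poly_rel \<Gamma> p p'" "p \<noteq> 0" "poly p x = 0"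
    and root: "\<And>q. q dvd p' \<Longrightarrow> Polynomial.degree q > 0 \<Longrightarrow> \<exists>y. poly q y = 0"
  shows "\<exists>y. hgraph (hgraph_adjoin \<Gamma> x y)"
proof -
  let ?P = "\<lambda>d. \<exists>m m'. poly_rel \<Gamma> m m' \<and> m \<noteq> 0 \<and> poly m x = 0 \<and> Polynomial.degree m = d"
  have "?P (LEAST d. ?P d)"
    by (rule LeastI[of ?P "Polynomial.degree p"]) (use p in blast)
  then obtain m m' where m: "poly_rel \<Gamma> m m'" "m \<noteq> 0" "poly m x = 0"
    and degm: "Polynomial.degree m = (LEAST d. ?P d)"
    by blast
  have min: "q = 0" if "poly_rel \<Gamma> q q'" "poly q x = 0" "Polynomial.degree q < Polynomial.degree m" for q q'
    using that not_less_Least[of "Polynomial.degree q" ?P] unfolding degm by blast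
  have "Polynomial.degree m \<noteq> 0"
    using m(2,3) by (metis degree_0_id poly_0_coeff_0 poly_const_conv leading_coeff_0_iff)
  hence deg0: "Polynomial.degree m > 0"
    by simp
  have dvd: "\<exists>q q'. poly_rel \<Gamma> q q' \<and> s = m * q \<and> s' = m' * q'"
    if s: "poly_rel \<Gamma> s s'" "poly s x = 0" for s s'
  proof -
    obtain q q' r r' where *: "poly_rel \<Gamma> q q'" "poly_rel \<Gamma> r r'" "s = m * q + r" "s' = m' * q' + r'"
      "r = 0 \<or> Polynomial.degree r < Polynomial.degree m"
      using poly_rel_division[OF \<Gamma> m(1,2) s(1)] .
    have "poly r x = 0"
      using s(2) m(3) *(3) by simp
    hence "r = 0"
      using min[OF *(2)] *(5) by blast
    hence "r' = 0"
      using poly_rel_eq_0_iff[OF \<Gamma> *(2)] by blast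
    show ?thesis
      using * \<open>r = 0\<close> \<open>r' = 0\<close> by auto
  qed
  have "m' dvd p'"
    using dvd[OF p(1,3)] by auto
  moreover have "Polynomial.degree m' > 0"
    using deg0 poly_rel_degree[OF \<Gamma> m(1)] by simp
  ultimately obtain y where y: "poly m' y = 0"
    using root by blast
  \<comment> \<open>Euclidean descent stands in for irreducibility of m': divide s by m if the
    degree of s is large, otherwise m by s. In the latter case the remainder vanishes at x by
    induction, and minimality of m forbids that the quotient vanishes there.\<close>
  have refl_root: "poly s x = 0" if "poly_rel \<Gamma> s s'" "poly s' y = 0" for s s'
    using that
  proof (induction "Polynomial.degree s" arbitrary: s s' rule: less_induct)
    case less
    consider "Polynomial.degree s = 0" | "s \<noteq> 0" "0 < Polynomial.degree s" "Polynomial.degree s < Polynomial.degree m"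
      | "Polynomial.degree s \<ge> Polynomial.degree m"
      by (cases "s = 0") force+
    thus ?case
    proof cases
      case 1
      then obtain c where c: "s = [:c:]"
        using degree_eq_zeroE by blast
      obtain c' where c': "s' = [:c':]"
        using 1 poly_rel_degree[OF \<Gamma> less.prems(1)] degree_eq_zeroE by metis
      have "s' = 0"
        using less.prems(2) c' by simp
      thus ?thesis
        using poly_rel_eq_0_iff[OF \<Gamma> less.prems(1)] by simp
    next
      case 2
      obtain q q' r r' where *: "poly_rel \<Gamma> q q'" "poly_rel \<Gamma> r r'" "m = s * q + r" "m' = s' * q' + r'"
        "r = 0 \<or> Polynomial.degree r < Polynomial.degree s"
        using poly_rel_division[OF \<Gamma> less.prems(1) 2(1) m(1)] .
      have "poly r' y = 0"
        using *(4) y less.prems(2) by simp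
      hence "poly r x = 0"
        using less.hyps[OF _ *(2)] *(5) by fastforce
      hence "poly s x * poly q x = 0"
        using *(3) m(3) by simp
      moreover have "poly q x \<noteq> 0"
      proof
        assume q0: "poly q x = 0"
        have "q \<noteq> 0"
          using *(3,5) 2 by force
        have "Polynomial.degree (s * q) = Polynomial.degree m"
        proof -
          have "Polynomial.degree r < Polynomial.degree (s * q) \<or> r = 0"
            using *(5) 2 \<open>q \<noteq> 0\<close> by (auto simp: degree_mult_eq)
          thus ?thesis
            unfolding *(3) using degree_add_eq_left[of r "s * q"] by auto
        qed
        hence "Polynomial.degree q < Polynomial.degree m"
          using 2 \<open>q \<noteq> 0\<close> by (simp add: degree_mult_eq)
        with min[OF *(1) q0] \<open>q \<noteq> 0\<close> show False
          by blast
      qed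
      ultimately show ?thesis
        by simp
    next
      case 3
      obtain q q' r r' where *: "poly_rel \<Gamma> q q'" "poly_rel \<Gamma> r r'" "s = m * q + r" "s' = m' * q' + r'"
        "r = 0 \<or> Polynomial.degree r < Polynomial.degree m"
        using poly_rel_division[OF \<Gamma> m(1,2) less.prems(1)] .
      have "poly r' y = 0"
        using *(4) y less.prems(2) by simp
      hence "poly r x = 0"
        using less.hyps[OF _ *(2)] *(5) 3 by fastforce
      thus ?thesis
        using *(3) m(3) by simp
    qed
  qed
  have "hgraph (hgraph_adjoin \<Gamma> x y)"
  proof (rule hgraph_hgraph_adjoin[OF \<Gamma>])
    fix s s' assume s: "poly_rel \<Gamma> s s'"
    show "poly s x = 0 \<longleftrightarrow> poly s' y = 0"
      using refl_root[OF s] dvd[OF s] y by force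
  qed
  thus ?thesis ..
qed

section \<open>Extension of homomorphisms by Zorn's lemma\<close>

lemma poly_rel_mono: "poly_rel \<Gamma> p p' \<Longrightarrow> \<Gamma> \<subseteq> \<Gamma>' \<Longrightarrow> poly_rel \<Gamma>' p p'"
  by (auto simp: poly_rel_def)

lemma hgraph_Union_chain:
  assumes "C \<noteq> {}" "\<And>\<Gamma>. \<Gamma> \<in> C \<Longrightarrow> hgraph \<Gamma>" "\<And>\<Gamma> \<Delta>. \<Gamma> \<in> C \<Longrightarrow> \<Delta> \<in> C \<Longrightarrow> \<Gamma> \<subseteq> \<Delta> \<or> \<Delta> \<subseteq> \<Gamma>"
  shows "hgraph (\<Union>C)"
  unfolding hgraph_def
proof (intro conjI allI impI)
  show "(1, 1) \<in> \<Union>C"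
    using assms(1) hgraphD(1)[OF assms(2)] by auto
  show "y = 0" if "(0, y) \<in> \<Union>C" for y
    using that assms(2) by (auto dest: hgraphD(9))
  show "(inverse x, inverse y) \<in> \<Union>C" if "(x, y) \<in> \<Union>C" for x y
    using that assms(2) by (auto dest: hgraphD(7))
  fix x x' y y' assume "(x, x') \<in> \<Union>C" "(y, y') \<in> \<Union>C"
  then obtain \<Gamma> \<Delta> where \<Gamma>\<Delta>: "\<Gamma> \<in> C" "(x, x') \<in> \<Gamma>" "\<Delta> \<in> C" "(y, y') \<in> \<Delta>"
    by blast
  then obtain \<Theta> where \<Theta>: "\<Theta> \<in> C" "(x, x') \<in> \<Theta>" "(y, y') \<in> \<Theta>"
    using assms(3)[OF \<Gamma>\<Delta>(1,3)] by blast
  show "(x - y, x' - y') \<in> \<Union>C" "(x * y, x' * y') \<in> \<Union>C"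
    using \<Theta>(1) hgraphD(4,5)[OF assms(2)[OF \<Theta>(1)] \<Theta>(2,3)] by blast+
qed

text \<open>In a maximal extension, adjoining an element of \<open>Y\<close> changes nothing, so the
  element was already in the domain. \<open>Y\<close> is kept arbitrary: it will be the whole
  closure for automorphisms and a single fibre for the embedding into Laurent series.\<close>

theorem hgraph_extend:
  assumes \<Gamma>: "hgraph \<Gamma>"
    and Y: "\<And>x. x \<in> Y \<Longrightarrow> \<exists>p p'. poly_rel \<Gamma> p p' \<and> p \<noteq> 0 \<and> poly p x = 0 \<and>
              (\<forall>q. q dvd p' \<longrightarrow> Polynomial.degree q > 0 \<longrightarrow> (\<exists>y. poly q y = 0))"
  obtains \<Delta> where "hgraph \<Delta>" "\<Gamma> \<subseteq> \<Delta>" "Y \<subseteq> Domain \<Delta>"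
proof -
  let ?A = "{\<Delta>. hgraph \<Delta> \<and> \<Gamma> \<subseteq> \<Delta>}"
  have "\<exists>M\<in>?A. \<forall>\<Delta>\<in>?A. M \<subseteq> \<Delta> \<longrightarrow> \<Delta> = M"
  proof (rule Zorn_Lemma2, rule ballI)
    fix C assume C: "C \<in> chains ?A"
    show "\<exists>U\<in>?A. \<forall>\<Delta>\<in>C. \<Delta> \<subseteq> U"
    proof (cases "C = {}")
      case True
      thus ?thesis
        using \<Gamma> by auto
    next
      case False
      have "hgraph (\<Union>C)"
        using C False by (intro hgraph_Union_chain) (auto simp: chains_def chain_subset_def)
      moreover have "\<Gamma> \<subseteq> \<Union>C"
        using C False by (auto simp: chains_def)
      ultimately show ?thesis
        by blast
    qed
  qed
  then obtain M where M: "hgraph M" "\<Gamma> \<subseteq> M"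
    and max: "\<forall>\<Delta>. hgraph \<Delta> \<longrightarrow> \<Gamma> \<subseteq> \<Delta> \<longrightarrow> M \<subseteq> \<Delta> \<longrightarrow> \<Delta> = M"
    by (elim bexE) auto
  have "Y \<subseteq> Domain M"
  proof
    fix x assume "x \<in> Y"
    obtain p p' where p: "poly_rel \<Gamma> p p'" "p \<noteq> 0" "poly p x = 0"
      and r: "\<forall>q. q dvd p' \<longrightarrow> Polynomial.degree q > 0 \<longrightarrow> (\<exists>y. poly q y = 0)"
      using Y[OF \<open>x \<in> Y\<close>] by (elim exE conjE) (rule that)
    have "\<exists>y. hgraph (hgraph_adjoin M x y)"
      by (rule hgraph_adjoin_algebraic[OF M(1) poly_rel_mono[OF p(1) M(2)] p(2,3)]) (use r in simp)
    then obtain y where y: "hgraph (hgraph_adjoin M x y)"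
      by (elim exE)
    have "hgraph_adjoin M x y = M"
      using max y hgraph_adjoin_incl(1)[OF M(1), of x y] M(2) by simp
    thus "x \<in> Domain M"
      using hgraph_adjoin_incl(2)[OF M(1)] by blast
  qed
  with M show thesis
    by (rule that)
qed

lemma hgraph_converse:
  assumes "hgraph \<Gamma>"
  shows "hgraph (converse \<Gamma>)"
  unfolding hgraph_def converse_iff
  by (intro conjI allI impI) (rule hgraphD[OF assms]; assumption)+

lemma hgraph_relcomp:
  assumes "hgraph \<Gamma>" "hgraph \<Delta>"
  shows "hgraph (\<Gamma> O \<Delta>)"
  unfolding hgraph_def
proof (intro conjI allI impI)
  show "(1, 1) \<in> \<Gamma> O \<Delta>"
    by (rule relcompI) (rule hgraphD(1)[OF assms(1)], rule hgraphD(1)[OF assms(2)])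
  show "y = 0" if "(0, y) \<in> \<Gamma> O \<Delta>" for y
    using that by (auto dest: hgraphD(9)[OF assms(1)] hgraphD(9)[OF assms(2)])
  show "(inverse x, inverse x') \<in> \<Gamma> O \<Delta>" if "(x, x') \<in> \<Gamma> O \<Delta>" for x x'
    using that by (auto intro: hgraphD(7)[OF assms(1)] hgraphD(7)[OF assms(2)])
  fix x x' y y' assume "(x, x') \<in> \<Gamma> O \<Delta>" "(y, y') \<in> \<Gamma> O \<Delta>"
  then obtain u v where *: "(x, u) \<in> \<Gamma>" "(u, x') \<in> \<Delta>" "(y, v) \<in> \<Gamma>" "(v, y') \<in> \<Delta>"
    by blast
  show "(x - y, x' - y') \<in> \<Gamma> O \<Delta>"
    using hgraphD(4)[OF assms(1) *(1,3)] hgraphD(4)[OF assms(2) *(2,4)] by (rule relcompI)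
  show "(x * y, x' * y') \<in> \<Gamma> O \<Delta>"
    using hgraphD(5)[OF assms(1) *(1,3)] hgraphD(5)[OF assms(2) *(2,4)] by (rule relcompI)
qed

section \<open>Subfields of the ambient field\<close>

lemma Kbar_simps [simp]:
  "carrier Kbar = UNIV" "monoid.mult Kbar = (*)" "add Kbar = (+)" "one Kbar = 1" "zero Kbar = 0"
  by (simp_all add: ring_of_type_algebra_def fun_eq_iff)

lemma field_Kbar: "field (Kbar :: 'a::field ring)"
  by (rule field_from_type_algebra)

lemma Kbar_a_inv [simp]: "a_inv (Kbar :: 'a::field ring) x = - x"
proof -
  interpret field "Kbar :: 'a ring"
    by (rule field_Kbar)
  show ?thesis
    using minus_equality[of "- x" x] by simp
qed

lemma Kbar_m_inv [simp]: "x \<noteq> 0 \<Longrightarrow> m_inv (Kbar :: 'a::field ring) x = inverse x"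
proof -
  interpret field "Kbar :: 'a ring"
    by (rule field_Kbar)
  show "x \<noteq> 0 \<Longrightarrow> ?thesis"
    using comm_inv_char[of x "inverse x"] by simp
qed

lemma generate_field_incl: "H \<subseteq> generate_field Kbar H"
  by (auto intro: generate_field.incl)

lemma generate_field_subsetI:
  fixes E :: "'a::field set"
  assumes "1 \<in> E" "\<And>x y. x \<in> E \<Longrightarrow> y \<in> E \<Longrightarrow> x - y \<in> E" "\<And>x y. x \<in> E \<Longrightarrow> y \<in> E \<Longrightarrow> x * y \<in> E"
    and "\<And>x. x \<in> E \<Longrightarrow> inverse x \<in> E" "H \<subseteq> E"
  shows "generate_field Kbar H \<subseteq> E"
proof
  have 0: "0 \<in> E"
    using assms(1) assms(2)[of 1 1] by simp
  have m: "- x \<in> E" if "x \<in> E" for x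
    using assms(2)[OF 0 that] by simp
  fix x assume "x \<in> generate_field Kbar H"
  thus "x \<in> E"
  proof induction
    case (eng_add x y)
    thus ?case
      using assms(2)[of x "- y"] m by simp
  qed (use assms m in auto)
qed

lemma subfield_generate_field: "subfield (generate_field Kbar H) (Kbar :: 'a::field ring)"
  by (rule field.generate_field_is_subfield[OF field_Kbar]) simp

lemma hgraph_Id_on:
  assumes "subfield E (Kbar :: 'a::field ring)"
  shows "hgraph (Id_on E)"
proof -
  interpret field "Kbar :: 'a ring"
    by (rule field_Kbar)
  have E: "1 \<in> E" "\<And>x y. x \<in> E \<Longrightarrow> y \<in> E \<Longrightarrow> x + y \<in> E" "\<And>x y. x \<in> E \<Longrightarrow> y \<in> E \<Longrightarrow> x * y \<in> E"
    "\<And>x. x \<in> E \<Longrightarrow> - x \<in> E" "0 \<in> E"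
    using subringE[OF subfieldE(1)[OF assms]] by simp_all
  have "x - y \<in> E" if "x \<in> E" "y \<in> E" for x y
    using E(2)[OF that(1) E(4)[OF that(2)]] by simp
  moreover have "inverse x \<in> E" if "x \<in> E" for x
    using subfield_m_inv(1)[OF assms, of x] that E(5) by (cases "x = 0") simp_all
  ultimately show ?thesis
    using E unfolding hgraph_def by auto
qed

lemma subfield_closed:
  assumes "subfield E (Kbar :: 'a::field ring)"
  shows "0 \<in> E" "1 \<in> E" "\<And>x y. x \<in> E \<Longrightarrow> y \<in> E \<Longrightarrow> x + y \<in> E" "\<And>x y. x \<in> E \<Longrightarrow> y \<in> E \<Longrightarrow> x - y \<in> E"
    "\<And>x y. x \<in> E \<Longrightarrow> y \<in> E \<Longrightarrow> x * y \<in> E" "\<And>x y. x \<in> E \<Longrightarrow> y \<in> E \<Longrightarrow> x / y \<in> E"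
    "\<And>x. x \<in> E \<Longrightarrow> inverse x \<in> E" "\<And>x. x \<in> E \<Longrightarrow> - x \<in> E"
  using hgraphD(1-8)[OF hgraph_Id_on[OF assms]] by (auto simp: Id_on_iff)

lemma generate_field_mono: "H \<subseteq> H' \<Longrightarrow> generate_field Kbar H \<subseteq> generate_field Kbar (H' :: 'a::field set)"
  by (rule field.mono_generate_field[OF field_Kbar]) simp_all

lemma generate_field_subset:
  "subfield E (Kbar :: 'a::field ring) \<Longrightarrow> H \<subseteq> E \<Longrightarrow> generate_field Kbar H \<subseteq> E"
  by (rule generate_field_subsetI) (auto intro: subfield_closed)

lemma poly_rel_Id_on: "poly_rel (Id_on E) p p' \<longleftrightarrow> p = p' \<and> (\<forall>i. poly.coeff p i \<in> E)"
  by (auto simp: poly_rel_def Id_on_iff poly_eq_iff)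

lemma coeffs_subset_iff:
  "(0 :: 'a::zero) \<in> E \<Longrightarrow> set (Polynomial.coeffs p) \<subseteq> E \<longleftrightarrow> (\<forall>i. poly.coeff p i \<in> E)"
  using range_coeff[of p] by (metis insert_subset range_subsetD image_subset_iff)

lemma poly_in_subfield:
  assumes "subfield E (Kbar :: 'a::field ring)" "\<forall>i. poly.coeff p i \<in> E" "x \<in> E"
  shows "poly p x \<in> E"
  using poly_rel_poly[OF hgraph_Id_on[OF assms(1)], of p p x x] assms(2,3)
  by (auto simp: poly_rel_Id_on)

lemma poly_rel_pcompose:
  assumes "hgraph \<Gamma>" "poly_rel \<Gamma> p p'" "poly_rel \<Gamma> q q'"
  shows "poly_rel \<Gamma> (pcompose p q) (pcompose p' q')"
  using assms(2)
proof (induction p arbitrary: p')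
  case 0
  hence "p' = 0"
    using poly_rel_eq_0_iff[OF assms(1)] by blast
  thus ?case
    using poly_rel_0[OF assms(1)] by simp
next
  case (pCons a p)
  obtain b r where r: "p' = pCons b r"
    by (cases p')
  show ?case
    using pCons.IH[of r] pCons.prems assms(3) unfolding r poly_rel_pCons_iff
    by (auto simp: pcompose_pCons poly_rel_pCons_iff poly_rel_0[OF assms(1)]
        intro!: poly_rel_add poly_rel_mult assms(1))
qed

lemma hgraph_adjoin_subset:
  assumes "subfield E (Kbar :: 'a::field ring)" "subfield E' (Kbar :: 'b::field ring)"
    and "\<Gamma> \<subseteq> E \<times> E'" "x \<in> E" "y \<in> E'"
  shows "hgraph_adjoin \<Gamma> x y \<subseteq> E \<times> E'"
proof -
  have "poly p x \<in> E" "poly p' y \<in> E'" if "poly_rel \<Gamma> p p'" for p p'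
    using that assms(3) unfolding poly_rel_def
    by (intro poly_in_subfield assms; blast)+
  thus ?thesis
    unfolding hgraph_adjoin_def using subfield_closed(6)[OF assms(1)] subfield_closed(6)[OF assms(2)]
    by auto
qed

lemma diagonal_generate_field:
  assumes "hgraph \<Gamma>" "\<And>x. x \<in> H \<Longrightarrow> (x, x) \<in> \<Gamma>" "z \<in> generate_field Kbar H"
  shows "(z, z) \<in> \<Gamma>"
proof -
  have "generate_field Kbar H \<subseteq> {z. (z, z) \<in> \<Gamma>}"
    by (rule generate_field_subsetI) (use assms(2) in \<open>auto intro: hgraphD[OF assms(1)]\<close>)
  thus ?thesis
    using assms(3) by auto
qed

section \<open>Algebraic elements\<close>

definition alg_over :: "'a::field set \<Rightarrow> 'a \<Rightarrow> bool" where
  "alg_over F x \<longleftrightarrow> (\<exists>p. p \<noteq> 0 \<and> (\<forall>i. poly.coeff p i \<in> F) \<and> poly p x = 0)"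

lemma alg_over_mono: "alg_over F x \<Longrightarrow> F \<subseteq> E \<Longrightarrow> alg_over E x"
  unfolding alg_over_def by blast

text \<open>Bridge between coefficient lists with the leading coefficient first and the type of
  polynomials. The carrier of \<open>R\<close> is left open so that the lemma applies both to the
  closure and to the ring with carrier \<open>k\<close>.\<close>

lemma eval_eq_poly:
  fixes R :: "'a::field ring"
  assumes "ring R" "monoid.mult R = (*)" "add R = (+)" "one R = 1" "zero R = 0"
  shows "ring.eval R xs x = poly (Poly (rev xs)) x"
proof -
  interpret ring R
    by fact
  have pow: "x [^]\<^bsub>R\<^esub> n = x ^ n" for n :: nat
    by (induction n) (simp_all add: nat_pow_def assms)
  show ?thesis
    by (induction xs) (simp_all add: assms pow Poly_append poly_monom add.commute mult.commute)
qed

lemma algebraic_iff_alg_over: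
  assumes "subfield F (Kbar :: 'a::field ring)"
  shows "(ring.algebraic Kbar over F) x \<longleftrightarrow> alg_over F x"
proof -
  interpret field "Kbar :: 'a ring"
    by (rule field_Kbar)
  have eval: "eval xs x = poly (Poly (rev xs)) x" for xs
    by (rule eval_eq_poly[OF ring_axioms]) simp_all
  show ?thesis
  proof
    assume "(algebraic over F) x"
    then obtain xs where xs: "xs \<in> carrier (F [X]\<^bsub>Kbar\<^esub>)" "xs \<noteq> []" "eval xs x = 0"
      using algebraicE[OF subfieldE(1)[OF assms], of x] by auto
    have "set xs \<subseteq> F" "hd xs \<noteq> 0"
      using xs(1,2) by (auto simp: univ_poly_def polynomial_def)
    have "poly.coeff (Poly (rev xs)) (length xs - 1) = hd xs"
      using xs(2) by (simp add: coeff_Poly_eq nth_default_def rev_nth hd_conv_nth)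
    hence "Poly (rev xs) \<noteq> 0"
      using \<open>hd xs \<noteq> 0\<close> by (metis coeff_0)
    moreover have "poly.coeff (Poly (rev xs)) i \<in> F" for i
      using \<open>set xs \<subseteq> F\<close> subfield_closed(1)[OF assms] nth_mem[of i "rev xs"]
      by (auto simp: coeff_Poly_eq nth_default_def)
    ultimately show "alg_over F x"
      unfolding alg_over_def using xs(3) eval
      by (intro exI[of _ "Poly (rev xs)"]) auto
  next
    assume "alg_over F x"
    then obtain p where p: "p \<noteq> 0" "\<forall>i. poly.coeff p i \<in> F" "poly p x = 0"
      unfolding alg_over_def by blast
    let ?xs = "rev (Polynomial.coeffs p)"
    have "?xs \<in> carrier (F [X]\<^bsub>Kbar\<^esub>)"
      using p coeffs_subset_iff[OF subfield_closed(1)[OF assms], of p]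
      by (auto simp: univ_poly_def polynomial_def hd_rev last_coeffs_eq_coeff_degree)
    thus "(algebraic over F) x"
      using algebraicI[of ?xs F x] p eval[of ?xs] by simp
  qed
qed

text \<open>The coefficients of a polynomial over \<open>E\<close> generate a finite extension of
  \<open>F\<close>, and adjoining \<open>z\<close> keeps the dimension finite, which forces
  \<open>z\<close> to be algebraic. Hence \<open>E\<close> may be any set of algebraic
  elements.\<close>

lemma alg_over_trans:
  assumes F: "subfield F (Kbar :: 'a::field ring)"
    and E: "\<And>x. x \<in> E \<Longrightarrow> alg_over F x" and z: "alg_over E z"
  shows "alg_over F z"
proof -
  interpret field "Kbar :: 'a ring"
    by (rule field_Kbar)
  obtain p where p: "p \<noteq> 0" "\<forall>i. poly.coeff p i \<in> E" "poly p z = 0"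
    using z unfolding alg_over_def by blast
  let ?A = "finite_extension F (Polynomial.coeffs p)"
  have sub: "set (Polynomial.coeffs p) \<subseteq> E"
    using p(2) range_coeff[of p] by (metis image_subset_iff insert_subset)
  have alg: "(algebraic over F) x" if "x \<in> set (Polynomial.coeffs p)" for x
    using that sub E[of x] algebraic_iff_alg_over[OF F, of x] by fastforce
  have A: "subfield ?A Kbar" "finite_dimension F ?A"
    using finite_extension_is_subfield[OF F _ alg] finite_extension_finite_dimension(1)[OF F _ alg]
    by simp_all
  have "set (Polynomial.coeffs p) \<subseteq> ?A"
    using finite_extension_mem[OF subfieldE(1)[OF F]] by simp
  hence "alg_over ?A z"
    unfolding alg_over_def using p coeffs_subset_iff[OF subfield_closed(1)[OF A(1)], of p] by blast
  hence z': "(algebraic over ?A) z"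
    using algebraic_iff_alg_over[OF A(1)] by blast
  let ?B = "simple_extension ?A z"
  have "finite_dimension ?A ?B"
    using finite_dimension_simple_extension[OF A(1), of z] z' by simp
  hence "finite_dimension F ?B"
    by (rule telescopic_base_dim(1)[OF F A])
  moreover have "subring ?B Kbar"
    using simple_extension_is_subring[OF subfieldE(1)[OF A(1)]] by simp
  moreover have "z \<in> ?B"
    using simple_extension_mem[OF subfieldE(1)[OF A(1)]] by simp
  ultimately show ?thesis
    using finite_dimension_imp_algebraic[OF F] algebraic_iff_alg_over[OF F] by blast
qed

lemma alg_over_generate_field:
  assumes F: "subfield F (Kbar :: 'a::field ring)" and H: "\<And>x. x \<in> H \<Longrightarrow> alg_over F x"
    and x: "x \<in> generate_field Kbar H"
  shows "alg_over F x"
proof -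
  have "subfield {x. alg_over F x} (Kbar :: 'a ring)"
    using field.subfield_of_algebraics[OF field_Kbar F] algebraic_iff_alg_over[OF F] by simp
  thus ?thesis
    using generate_field_subset[of "{x. alg_over F x}" H] H x by blast
qed

lemma alg_over_self:
  assumes "subfield F (Kbar :: 'a::field ring)" "x \<in> F"
  shows "alg_over F x"
  unfolding alg_over_def using subfield_closed[OF assms(1)] assms(2)
  by (intro exI[of _ "[:- x, 1:]"]) (simp add: coeff_pCons split: nat.split)

lemma alg_closed_subfield_root:
  assumes k: "subfield k (Kbar :: 'a::field ring)" "algebraically_closed (Kbar\<lparr>carrier := k\<rparr>)"
    and p: "\<forall>i. poly.coeff p i \<in> k" "Polynomial.degree p > 0"
  obtains r where "r \<in> k" "poly p r = 0"
proof -
  interpret algebraically_closed "Kbar\<lparr>carrier := k\<rparr>"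
    by fact
  let ?xs = "rev (Polynomial.coeffs p)"
  have car: "?xs \<in> carrier (poly_ring (Kbar\<lparr>carrier := k\<rparr>))"
    using p coeffs_subset_iff[OF subfield_closed(1)[OF k(1)], of p]
    by (auto simp: univ_poly_def polynomial_def hd_rev last_coeffs_eq_coeff_degree)
  have "splitted ?xs"
    by (rule roots_over_carrier[OF car])
  hence "roots ?xs \<noteq> {#}"
    unfolding splitted_def using p(2) by (auto simp: degree_eq_length_coeffs)
  then obtain r where "r \<in># roots ?xs"
    by blast
  hence "is_root ?xs r"
    using roots_mem_iff_is_root[OF car] by auto
  hence "r \<in> k" "eval ?xs r = 0"
    by (auto simp: is_root_def)
  moreover have "eval ?xs r = poly (Poly (rev ?xs)) r"
    by (rule eval_eq_poly[OF ring_axioms]) simp_all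
  ultimately show thesis
    using that by simp
qed

text \<open>Roots in \<open>k\<close> are split off until \<open>x\<close> is one of them. Dividing
  relative to \<open>Id_on k\<close> keeps the coefficients of the quotient in
  \<open>k\<close>.\<close>

lemma alg_closed_subfield_mem:
  assumes k: "subfield k (Kbar :: 'a::field ring)" "algebraically_closed (Kbar\<lparr>carrier := k\<rparr>)"
    and "alg_over k x"
  shows "x \<in> k"
proof -
  obtain p where p: "p \<noteq> 0" "\<forall>i. poly.coeff p i \<in> k" "poly p x = 0"
    using assms(3) unfolding alg_over_def by blast
  thus ?thesis
  proof (induction "Polynomial.degree p" arbitrary: p rule: less_induct)
    case less
    have "Polynomial.degree p > 0"
      using less.prems by (metis degree_eq_zeroE gr0I pCons_eq_0_iff poly_const_conv)
    then obtain r where r: "r \<in> k" "poly p r = 0"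
      using alg_closed_subfield_root[OF k less.prems(2)] by blast
    have lin: "poly_rel (Id_on k) [:- r, 1:] [:- r, 1:]"
      using subfield_closed[OF k(1)] r(1)
      by (simp add: poly_rel_pCons_iff poly_rel_0[OF hgraph_Id_on[OF k(1)]] Id_on_iff)
    have "poly_rel (Id_on k) p p"
      using less.prems(2) by (simp add: poly_rel_Id_on)
    obtain q q' s s' where *: "poly_rel (Id_on k) q q'" "poly_rel (Id_on k) s s'"
      "p = [:- r, 1:] * q + s" "p = [:- r, 1:] * q' + s'"
      "s = 0 \<or> Polynomial.degree s < Polynomial.degree [:- r, 1:]"
      by (rule poly_rel_division[OF hgraph_Id_on[OF k(1)] lin _ \<open>poly_rel (Id_on k) p p\<close>]) simp
    hence qs: "\<forall>i. poly.coeff q i \<in> k" "p = [:- r, 1:] * q + s" "s = 0 \<or> Polynomial.degree s < 1"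
      by (auto simp: poly_rel_Id_on)
    have "poly s r = 0"
      using arg_cong[OF qs(2), of "\<lambda>p. poly p r"] r(2) by simp
    hence "s = 0"
      using qs(3) by (metis degree_eq_zeroE less_one pCons_0_0 poly_const_conv)
    hence p: "p = [:- r, 1:] * q"
      using qs(2) by simp
    have "q \<noteq> 0"
      using less.prems(1) p by auto
    hence "Polynomial.degree q < Polynomial.degree p"
      unfolding p by (subst degree_mult_eq) auto
    moreover have "x = r \<or> poly q x = 0"
      using less.prems(3) unfolding p by auto
    ultimately show ?case
      using less.hyps[of q] \<open>q \<noteq> 0\<close> qs(1) r(1) by blast
  qed
qed

lemma hgraph_adjoin_transcendental:
  assumes "hgraph \<Gamma>" "\<not> alg_over (Domain \<Gamma>) x" "\<not> alg_over (Range \<Gamma>) y"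
  shows "hgraph (hgraph_adjoin \<Gamma> x y)"
proof (rule hgraph_hgraph_adjoin[OF assms(1)])
  fix p p' assume p: "poly_rel \<Gamma> p p'"
  have "\<forall>i. poly.coeff p i \<in> Domain \<Gamma>" "\<forall>i. poly.coeff p' i \<in> Range \<Gamma>"
    using p by (auto simp: poly_rel_def)
  hence "poly p x = 0 \<longleftrightarrow> p = 0" "poly p' y = 0 \<longleftrightarrow> p' = 0"
    using assms(2,3) by (auto simp: alg_over_def)
  thus "poly p x = 0 \<longleftrightarrow> poly p' y = 0"
    using poly_rel_eq_0_iff[OF assms(1) p] by simp
qed

text \<open>If \<open>t\<close> were transcendental over \<open>k(b)\<close>, then the homomorphisms fixing \<open>k(t)\<close> with
  \<open>b \<mapsto> b + n\<close> would produce infinitely many roots of the minimal polynomial of \<open>b\<close>.\<close>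

lemma alg_over_exchange:
  fixes b t :: "'a::field_char_0"
  assumes k: "subfield k (Kbar :: 'a ring)" and b: "\<not> alg_over k b"
    and bt: "alg_over (generate_field Kbar (insert t k)) b"
  shows "alg_over (generate_field Kbar (insert b k)) t"
proof (rule ccontr)
  assume t: "\<not> alg_over (generate_field Kbar (insert b k)) t"
  let ?E = "generate_field Kbar (insert b k)"
  obtain p where p: "p \<noteq> 0" "\<forall>i. poly.coeff p i \<in> generate_field Kbar (insert t k)" "poly p b = 0"
    using bt unfolding alg_over_def by blast
  have kE: "k \<subseteq> ?E" "b \<in> ?E"
    using generate_field_incl[of "insert b k"] by auto
  note sE = subfield_generate_field[of "insert b k"]
  have nat: "of_nat n \<in> k" for n
    by (induction n) (use subfield_closed[OF k] in auto)
  have root: "poly p (b + of_nat n) = 0" for n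
  proof -
    have "\<not> alg_over k (b + of_nat n)"
    proof
      assume "alg_over k (b + of_nat n)"
      then obtain q where q: "q \<noteq> 0" "\<forall>i. poly.coeff q i \<in> k" "poly q (b + of_nat n) = 0"
        unfolding alg_over_def by blast
      let ?r = "pcompose q [:of_nat n, 1:]"
      have "poly_rel (Id_on k) ?r ?r"
        by (intro poly_rel_pcompose hgraph_Id_on k)
           (use q(2) nat subfield_closed[OF k] in
             \<open>auto simp: poly_rel_Id_on coeff_pCons split: nat.splits\<close>)
      moreover have "?r \<noteq> 0"
        using q(1) by (simp add: pcompose_eq_0_iff)
      moreover have "poly ?r b = 0"
        using q(3) by (simp add: poly_pcompose add.commute)
      ultimately show False
        using b unfolding alg_over_def poly_rel_Id_on by blast
    qed
    hence 1: "hgraph (hgraph_adjoin (Id_on k) b (b + of_nat n))" (is "hgraph ?\<Gamma>")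
      using b by (intro hgraph_adjoin_transcendental hgraph_Id_on k) simp_all
    have "?\<Gamma> \<subseteq> ?E \<times> ?E"
      by (rule hgraph_adjoin_subset[OF sE sE])
         (use kE nat subfield_closed(3)[OF sE kE(2), of "of_nat n"] in auto)
    hence "Domain ?\<Gamma> \<subseteq> ?E" "Range ?\<Gamma> \<subseteq> ?E"
      by auto
    hence 2: "hgraph (hgraph_adjoin ?\<Gamma> t t)" (is "hgraph ?\<Delta>")
      using t alg_over_mono by (intro hgraph_adjoin_transcendental 1) blast+
    have "(x, x) \<in> ?\<Delta>" if "x \<in> insert t k" for x
      using that hgraph_adjoin_incl[OF 1, of t t] hgraph_adjoin_incl(1)[OF hgraph_Id_on[OF k]]
      by (auto simp: Id_on_iff subset_iff)
    hence "poly_rel ?\<Delta> p p"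
      unfolding poly_rel_def using p(2) diagonal_generate_field[OF 2, of "insert t k"] by blast
    moreover have "(b, b + of_nat n) \<in> ?\<Delta>"
      using hgraph_adjoin_incl(1)[OF 1] hgraph_adjoin_incl(2)[OF hgraph_Id_on[OF k]] by blast
    ultimately have "(poly p b, poly p (b + of_nat n)) \<in> ?\<Delta>"
      by (rule poly_rel_poly[OF 2])
    thus ?thesis
      using p(3) hgraphD(9)[OF 2] by simp
  qed
  have "infinite (range (\<lambda>n. b + of_nat n))"
    by (rule range_inj_infinite) (simp add: inj_on_def)
  moreover have "range (\<lambda>n. b + of_nat n) \<subseteq> {x. poly p x = 0}"
    using root by auto
  ultimately show False
    using poly_roots_finite[OF p(1)] finite_subset by blast
qed

section \<open>Automorphisms of the ambient field\<close>

text \<open>Automorphisms of the whole algebraic closure stand in for the Galois groups of all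
  intermediate fields; \<open>F\<close> may be any set, for instance generators of a field.\<close>

definition Aut_over :: "'a::field set \<Rightarrow> ('a \<Rightarrow> 'a) set" where
  "Aut_over F = {\<tau>. bij \<tau> \<and> (\<forall>x y. \<tau> (x + y) = \<tau> x + \<tau> y) \<and> (\<forall>x y. \<tau> (x * y) = \<tau> x * \<tau> y) \<and>
     (\<forall>x\<in>F. \<tau> x = x)}"

lemma Aut_overD:
  assumes "\<tau> \<in> Aut_over F"
  shows "bij \<tau>" "\<tau> (x + y) = \<tau> x + \<tau> y" "\<tau> (x * y) = \<tau> x * \<tau> y" "x \<in> F \<Longrightarrow> \<tau> x = x"
    "\<tau> 0 = 0" "\<tau> 1 = 1" "\<tau> (- x) = - \<tau> x" "\<tau> (x - y) = \<tau> x - \<tau> y" "\<tau> (inverse x) = inverse (\<tau> x)"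
    "\<tau> x = \<tau> y \<longleftrightarrow> x = y"
proof -
  show bij: "bij \<tau>" and add: "\<And>x y. \<tau> (x + y) = \<tau> x + \<tau> y"
    and mult: "\<And>x y. \<tau> (x * y) = \<tau> x * \<tau> y" and "x \<in> F \<Longrightarrow> \<tau> x = x"
    using assms by (auto simp: Aut_over_def)
  show inj: "\<tau> x = \<tau> y \<longleftrightarrow> x = y" for x y
    using bij by (auto simp: bij_def inj_def)
  show zero: "\<tau> 0 = 0"
    using add[of 0 0] by (metis add.right_neutral add_left_imp_eq)
  have "\<tau> 1 * \<tau> 1 = \<tau> 1" "\<tau> 1 \<noteq> 0"
    using mult[of 1 1] inj[of 1 0] zero by simp_all
  thus one: "\<tau> 1 = 1"
    by simp
  show um: "\<tau> (- x) = - \<tau> x" for x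
    using add[of x "- x"] zero by (simp add: eq_neg_iff_add_eq_0 add.commute)
  show "\<tau> (x - y) = \<tau> x - \<tau> y"
    using add[of x "- y"] um by simp
  show "\<tau> (inverse x) = inverse (\<tau> x)"
  proof (cases "x = 0")
    case False
    hence "\<tau> x * \<tau> (inverse x) = 1"
      using mult[of x "inverse x"] one by simp
    thus ?thesis
      by (metis inverse_unique)
  qed (simp add: zero)
qed

lemma Aut_over_poly:
  assumes "\<tau> \<in> Aut_over F" "\<forall>i. poly.coeff p i \<in> F"
  shows "\<tau> (poly p x) = poly p (\<tau> x)"
  using assms(2)
proof (induction p)
  case (pCons a p)
  have "poly.coeff p i \<in> F" for i
    using pCons.prems[rule_format, of "Suc i"] by simp
  moreover have "a \<in> F"
    using pCons.prems[rule_format, of 0] by simp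
  ultimately show ?case
    using pCons.IH by (simp add: Aut_overD[OF assms(1)])
qed (simp add: Aut_overD[OF assms(1)])

lemma Aut_over_prod:
  assumes "\<tau> \<in> Aut_over F"
  shows "\<tau> (prod u A) = (\<Prod>x\<in>A. \<tau> (u x))"
  by (induction A rule: infinite_finite_induct) (simp_all add: Aut_overD[OF assms])

lemma Aut_over_id: "(\<lambda>x. x) \<in> Aut_over F"
  by (auto simp: Aut_over_def bij_def)

lemma Aut_over_comp: "\<tau> \<in> Aut_over F \<Longrightarrow> \<tau>' \<in> Aut_over F \<Longrightarrow> \<tau> \<circ> \<tau>' \<in> Aut_over F"
  by (auto simp: Aut_over_def bij_comp)

lemma Aut_over_inv:
  assumes "\<tau> \<in> Aut_over F"
  shows "inv_into UNIV \<tau> \<in> Aut_over F"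
proof -
  let ?\<rho> = "inv_into UNIV \<tau>"
  note bij = Aut_overD(1)[OF assms]
  have 1: "\<tau> (?\<rho> x) = x" for x
    using bij by (simp add: bij_is_surj surj_f_inv_f)
  have 2: "?\<rho> x = y \<longleftrightarrow> x = \<tau> y" for x y
    using 1 Aut_overD(10)[OF assms] by metis
  show ?thesis
    unfolding Aut_over_def using bij_imp_bij_inv[OF bij]
    by (auto simp: 2 Aut_overD(2,3,4)[OF assms] 1)
qed

lemma Aut_over_agree:
  assumes "\<tau> \<in> Aut_over F" "\<tau>' \<in> Aut_over F'" "\<And>x. x \<in> H \<Longrightarrow> \<tau> x = \<tau>' x" "x \<in> generate_field Kbar H"
  shows "\<tau> x = \<tau>' x"
proof -
  have "generate_field Kbar H \<subseteq> {x. \<tau> x = \<tau>' x}"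
    by (rule generate_field_subsetI) (auto simp: Aut_overD[OF assms(1)] Aut_overD[OF assms(2)] assms(3))
  thus ?thesis
    using assms(4) by auto
qed

lemma Aut_over_generate_field:
  assumes "\<tau> \<in> Aut_over H"
  shows "\<tau> \<in> Aut_over (generate_field Kbar H)"
proof -
  have "\<tau> x = x" if "x \<in> generate_field Kbar H" for x
    by (rule Aut_over_agree[OF assms Aut_over_id _ that]) (rule Aut_overD(4)[OF assms])
  thus ?thesis
    using assms by (simp add: Aut_over_def)
qed

text \<open>Surjectivity by finiteness: a given element belongs to the finite root set of a
  polynomial over \<open>F\<close>, and an injective map that sends this set into itself permutes
  it.\<close>

lemma hom_over_bij:
  fixes \<tau> :: "'a::field \<Rightarrow> 'a"
  assumes inj: "inj \<tau>" and roots: "\<And>p x. \<forall>i. poly.coeff p i \<in> F \<Longrightarrow> poly p x = 0 \<Longrightarrow> poly p (\<tau> x) = 0"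
    and alg: "\<And>x. alg_over F x"
  shows "bij \<tau>"
proof -
  have "y \<in> range \<tau>" for y
  proof -
    obtain p where p: "p \<noteq> 0" "\<forall>i. poly.coeff p i \<in> F" "poly p y = 0"
      using alg[of y] unfolding alg_over_def by blast
    let ?R = "{x. poly p x = 0}"
    have "finite ?R"
      by (rule poly_roots_finite[OF p(1)])
    moreover have "\<tau> ` ?R \<subseteq> ?R"
      using roots[OF p(2)] by blast
    moreover have "inj_on \<tau> ?R"
      using inj by (rule inj_on_subset) simp
    ultimately have "\<tau> ` ?R = ?R"
      by (rule endo_inj_surj)
    thus ?thesis
      using p(3) by blast
  qed
  thus ?thesis
    using inj by (auto simp: bij_def)
qed

text \<open>\<open>hgraph_extend\<close> with the whole field as \<open>Y\<close> gives a total
  homomorphism, and \<open>hom_over_bij\<close> makes it onto. All automorphisms below are built by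
  writing down a graph that fixes \<open>F\<close> and applying this.\<close>

theorem Aut_over_extend:
  fixes \<Gamma> :: "('a::alg_closed_field \<times> 'a) set"
  assumes \<Gamma>: "hgraph \<Gamma>" and F: "\<And>x. x \<in> F \<Longrightarrow> (x, x) \<in> \<Gamma>" and alg: "\<And>x. alg_over F x"
  shows "\<exists>\<tau>\<in>Aut_over F. \<forall>x y. (x, y) \<in> \<Gamma> \<longrightarrow> \<tau> x = y"
proof -
  obtain \<Delta> where \<Delta>: "hgraph \<Delta>" "\<Gamma> \<subseteq> \<Delta>" "UNIV \<subseteq> Domain \<Delta>"
  proof (rule hgraph_extend[OF \<Gamma>, of UNIV])
    fix x :: 'a
    obtain p where p: "p \<noteq> 0" "\<forall>i. poly.coeff p i \<in> F" "poly p x = 0"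
      using alg[of x] unfolding alg_over_def by blast
    have "poly_rel \<Gamma> p p"
      using p(2) F by (simp add: poly_rel_def)
    thus "\<exists>p p'. poly_rel \<Gamma> p p' \<and> p \<noteq> 0 \<and> poly p x = 0 \<and>
            (\<forall>q. q dvd p' \<longrightarrow> 0 < Polynomial.degree q \<longrightarrow> (\<exists>y. poly q y = 0))"
      using p alg_closed_imp_poly_has_root by blast
  qed
  define \<tau> where "\<tau> x = (THE y. (x, y) \<in> \<Delta>)" for x
  have in\<Delta>: "(x, \<tau> x) \<in> \<Delta>" for x
    unfolding \<tau>_def
    by (rule theI') (use \<Delta>(3) hgraphD(11)[OF \<Delta>(1)] in \<open>auto simp: Domain_iff subset_iff\<close>)
  have \<tau>: "\<tau> x = y" if "(x, y) \<in> \<Delta>" for x y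
    using hgraphD(11)[OF \<Delta>(1) in\<Delta> that] .
  have inj: "inj \<tau>"
    using hgraphD(12)[OF \<Delta>(1)] in\<Delta> by (metis injI)
  have roots: "poly p (\<tau> x) = 0" if p: "\<forall>i. poly.coeff p i \<in> F" "poly p x = 0" for p x
  proof -
    have "poly_rel \<Delta> p p"
      using p(1) F \<Delta>(2) by (auto simp: poly_rel_def)
    from poly_rel_poly[OF \<Delta>(1) this in\<Delta>[of x]] show ?thesis
      using p(2) hgraphD(9)[OF \<Delta>(1), of "poly p (\<tau> x)"] by simp
  qed
  have fix_F: "\<tau> x = x" if "x \<in> F" for x
    using \<tau> F[OF that] \<Delta>(2) by blast
  have "\<tau> \<in> Aut_over F"
    unfolding Aut_over_def
    using hom_over_bij[OF inj roots alg] \<tau>[OF hgraphD(3)[OF \<Delta>(1) in\<Delta> in\<Delta>]]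
      \<tau>[OF hgraphD(5)[OF \<Delta>(1) in\<Delta> in\<Delta>]] fix_F by simp
  thus ?thesis
    using \<tau> \<Delta>(2) by blast
qed

lemma finite_orbit:
  assumes "alg_over F x"
  shows "finite ((\<lambda>\<tau>. \<tau> x) ` Aut_over F)"
proof -
  obtain p where p: "p \<noteq> 0" "\<forall>i. poly.coeff p i \<in> F" "poly p x = 0"
    using assms unfolding alg_over_def by blast
  have "poly p (\<tau> x) = 0" if "\<tau> \<in> Aut_over F" for \<tau>
    using Aut_over_poly[OF that p(2), of x] p(3) Aut_overD(5)[OF that] by simp
  hence "(\<lambda>\<tau>. \<tau> x) ` Aut_over F \<subseteq> {y. poly p y = 0}"
    by auto
  thus ?thesis
    using poly_roots_finite[OF p(1)] finite_subset by blast
qed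

text \<open>Each element of \<open>S\<close> has a finite orbit, so the restrictions embed in a
  finite product. Every conclusion about finite or infinite index rests on this count.\<close>

lemma finite_restrict_Aut_over:
  assumes "finite S" "\<And>x. x \<in> S \<Longrightarrow> alg_over F x"
  shows "finite ((\<lambda>\<tau>. restrict \<tau> S) ` Aut_over F)"
proof (rule finite_subset)
  show "(\<lambda>\<tau>. restrict \<tau> S) ` Aut_over F \<subseteq> (\<Pi>\<^sub>E x\<in>S. (\<lambda>\<tau>. \<tau> x) ` Aut_over F)"
    by auto
  show "finite (\<Pi>\<^sub>E x\<in>S. (\<lambda>\<tau>. \<tau> x) ` Aut_over F)"
    using assms finite_orbit by (intro finite_PiE) auto
qed

section \<open>A transposition from a simple branch point\<close>

lemma poly_map_fps_const_add:
  fixes Q :: "'a::comm_ring_1 poly"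
  shows "poly (map_poly fps_const Q) (fps_const r + Y) = poly (map_poly fps_const (pcompose Q [:r, 1:])) Y"
proof (induction Q)
  case (pCons c Q)
  have hom: "map_poly fps_const (p + q) = map_poly fps_const p + map_poly fps_const q"
    "map_poly fps_const (Polynomial.smult c p) = Polynomial.smult (fps_const c) (map_poly fps_const p)"
    for c :: 'a and p q
    by (simp_all add: poly_eq_iff coeff_map_poly)
  show ?case
    using pCons by (simp add: map_poly_pCons pcompose_pCons hom algebra_simps)
qed simp

lemma fps_of_poly_compose:
  fixes P :: "'a::idom poly"
  assumes "fps_nth Y 0 = 0"
  shows "fps_of_poly P oo Y = poly (map_poly fps_const P) Y"
  by (induction P)
     (simp_all add: map_poly_pCons fps_of_poly_pCons fps_compose_add_distrib
        fps_compose_mult_distrib[OF assms] assms algebra_simps)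

lemma fps_compose_minus_X_squared:
  "(fps_X ^ 2 :: 'a::idom fps) oo (- fps_X) = fps_X ^ 2"
  by (simp add: fps_compose_power flip: fps_compose_power)

text \<open>Formal inverse function theorem: after recentring at \<open>r\<close>, Q - a has no
  constant term and a nonzero linear term, so it has a compositional inverse. Substituting s^2 into
  this inverse solves Q = a + s^2 by an even series, which s \<mapsto> - s fixes.\<close>

lemma fps_simple_root_lift:
  fixes Q :: "'a::field_char_0 poly"
  assumes "poly Q r = a" "poly (pderiv Q) r \<noteq> 0"
  obtains R where "fps_nth R 0 = r" "poly (map_poly fps_const Q) R = fps_const a + fps_X ^ 2"
    "R oo (- fps_X) = R"
proof -
  define P where "P = pcompose Q [:r, 1:] - [:a:]"
  define p where "p = fps_of_poly P"
  define Y where "Y = fps_inv p oo fps_X ^ 2"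
  have 0: "fps_nth p 0 = 0"
    using assms(1) by (simp add: p_def P_def poly_pcompose flip: poly_0_coeff_0)
  have "fps_nth p 1 = poly (pderiv P) 0"
    by (simp add: p_def poly_0_coeff_0 coeff_pderiv)
  also have "\<dots> = poly (pderiv Q) r"
    by (simp add: P_def pderiv_diff pderiv_pcompose poly_pcompose pderiv_pCons)
  finally have 1: "fps_nth p 1 \<noteq> 0"
    using assms(2) by simp
  have inv0: "fps_nth (fps_inv p) 0 = 0"
    by (simp add: fps_inv_def)
  have Y0: "fps_nth Y 0 = 0"
    by (simp add: Y_def inv0)
  have "p oo Y = (p oo fps_inv p) oo fps_X ^ 2"
    unfolding Y_def by (rule fps_compose_assoc) (simp_all add: inv0)
  also have "\<dots> = fps_X ^ 2"
    by (subst fps_inv_right[OF 0 1]) simp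
  finally have "fps_of_poly (pcompose Q [:r, 1:]) oo Y = fps_const a + fps_X ^ 2"
    by (simp add: p_def P_def fps_of_poly_diff fps_of_poly_const fps_compose_sub_distrib algebra_simps)
  hence "poly (map_poly fps_const Q) (fps_const r + Y) = fps_const a + fps_X ^ 2"
    by (simp add: poly_map_fps_const_add fps_of_poly_compose[OF Y0])
  moreover have "Y oo (- fps_X) = Y"
    unfolding Y_def using fps_compose_assoc[of "- fps_X" "fps_X ^ 2 :: 'a fps" "fps_inv p"]
    by (simp add: fps_compose_minus_X_squared)
  ultimately show thesis
    using that[of "fps_const r + Y"] Y0 by (simp add: fps_compose_add_distrib)
qed

text \<open>At a double point the recentred Q - a is W^2, where W is s times a square root of a
  unit. Inverting W solves W = s, and the image of the solution under s \<mapsto> - s solves W = -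
  s: two different roots of Q = a + s^2, which the substitution exchanges.\<close>

lemma fps_double_root_lift:
  fixes Q :: "'a::{alg_closed_field, field_char_0} poly"
  assumes "Q - [:a:] \<noteq> 0" "Polynomial.order \<gamma> (Q - [:a:]) = 2"
  obtains R where "fps_nth R 0 = \<gamma>" "poly (map_poly fps_const Q) R = fps_const a + fps_X ^ 2"
    "poly (map_poly fps_const Q) (R oo (- fps_X)) = fps_const a + fps_X ^ 2" "R oo (- fps_X) \<noteq> R"
    "R oo (- fps_X) oo (- fps_X) = R"
proof -
  obtain q where q: "Q - [:a:] = [:- \<gamma>, 1:] ^ 2 * q" "\<not> [:- \<gamma>, 1:] dvd q"
    using order_decomp[OF assms(1), of \<gamma>] assms(2) by auto
  define u where "u = fps_of_poly (pcompose q [:\<gamma>, 1:])"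
  have u0: "fps_nth u 0 \<noteq> 0"
    using q(2) by (simp add: u_def poly_pcompose poly_eq_0_iff_dvd flip: poly_0_coeff_0)
  \<comment> \<open>\<open>fps_radical\<close> takes a chosen root of the constant term; the
    algebraically closed field supplies it as \<open>c\<close>.\<close>
  obtain c where c: "c ^ 2 = fps_nth u 0"
    using alg_closed_imp_poly_has_root[of "[:- fps_nth u 0, 0, 1:]"] by (auto simp: power2_eq_square)
  define s where "s = fps_radical (\<lambda>_ _. c) 2 u"
  have s: "s ^ 2 = u"
    using power_radical[OF u0, of "\<lambda>_ _. c" 1] c by (simp add: s_def numeral_2_eq_2)
  define W where "W = fps_X * s"
  have s0: "fps_nth s 0 \<noteq> 0"
    using c u0 by (auto simp: s_def)
  have W: "fps_nth W 0 = 0" "fps_nth W 1 \<noteq> 0"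
    using s0 by (simp_all add: W_def)
  define p where "p = fps_of_poly (pcompose (Q - [:a:]) [:\<gamma>, 1:])"
  have pW: "p = W ^ 2"
  proof -
    have "pcompose ([:- \<gamma>, 1:] ^ 2 * q) [:\<gamma>, 1:] = [:0, 1:] ^ 2 * pcompose q [:\<gamma>, 1:]"
      by (simp only: power2_eq_square pcompose_mult) (simp add: pcompose_pCons)
    hence "p = fps_X ^ 2 * u"
      unfolding p_def q(1) u_def by (simp only: fps_of_poly_mult fps_of_poly_power fps_of_poly_fps_X)
    thus ?thesis
      by (simp add: W_def power_mult_distrib s)
  qed
  define Y where "Y = fps_inv W"
  have Y0: "fps_nth Y 0 = 0"
    by (simp add: Y_def fps_inv_def)
  have WY: "W oo Y = fps_X"
    unfolding Y_def by (rule fps_inv_right[OF W])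
  have pY: "p oo Y = fps_X ^ 2"
    unfolding pW using fps_compose_power[OF Y0, of W 2] WY by simp
  define Y' where "Y' = Y oo (- fps_X)"
  have Y'0: "fps_nth Y' 0 = 0"
    by (simp add: Y'_def Y0)
  have assoc: "A oo Y' = A oo Y oo (- fps_X)" for A
    unfolding Y'_def by (rule fps_compose_assoc) (simp_all add: Y0)
  have pY': "p oo Y' = fps_X ^ 2"
    unfolding assoc pY by (rule fps_compose_minus_X_squared)
  have neq: "Y' \<noteq> Y"
  proof
    assume "Y' = Y"
    hence "fps_X = W oo Y'"
      using WY by simp
    also have "\<dots> = - fps_X"
      unfolding assoc WY by simp
    finally have "fps_nth (fps_X :: 'a fps) 1 = fps_nth (- fps_X) 1"
      by simp
    thus False
      by simp
  qed
  have root: "poly (map_poly fps_const Q) (fps_const \<gamma> + Z) = fps_const a + fps_X ^ 2"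
    if "p oo Z = fps_X ^ 2" "fps_nth Z 0 = 0" for Z
  proof -
    have "fps_of_poly (pcompose Q [:\<gamma>, 1:]) oo Z = fps_const a + fps_X ^ 2"
      using that(1) by (simp add: p_def pcompose_diff fps_of_poly_diff fps_of_poly_const
          fps_compose_sub_distrib algebra_simps)
    thus ?thesis
      by (simp add: poly_map_fps_const_add fps_of_poly_compose[OF that(2)])
  qed
  have "Y' oo (- fps_X) = Y"
    unfolding Y'_def using fps_compose_assoc[of "- fps_X" "- fps_X :: 'a fps" Y]
    by (simp add: fps_compose_uminus)
  thus thesis
    using that[of "fps_const \<gamma> + Y"] root[OF pY Y0] root[OF pY' Y'0] Y0 neq
    by (simp add: fps_compose_add_distrib flip: Y'_def)
qed

section \<open>The branched fibre inside the Laurent series\<close>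

lemma poly_map_fls_const:
  "poly (map_poly fls_const P) (fps_to_fls Y) = fps_to_fls (poly (map_poly fps_const P) Y)"
  by (induction P) (simp_all add: map_poly_pCons fls_times_fps_to_fls)

text \<open>If \<open>q\<close> had no root, all roots of \<open>p\<close> would be roots of the
  cofactor, whose degree is too small. This verifies the hypothesis of \<open>hgraph_extend\<close>
  in the Laurent series.\<close>

lemma dvd_has_root_of_card_roots:
  fixes p :: "'a::field poly"
  assumes "p \<noteq> 0" "card {x. poly p x = 0} = Polynomial.degree p" "q dvd p" "Polynomial.degree q > 0"
  shows "\<exists>x. poly q x = 0"
proof (rule ccontr)
  assume no: "\<nexists>x. poly q x = 0"
  obtain r where r: "p = q * r"
    using assms(3) by auto
  have nz: "q \<noteq> 0" "r \<noteq> 0"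
    using assms(1) r by auto
  have "{x. poly p x = 0} = {x. poly r x = 0}"
    using no by (auto simp: r)
  hence "Polynomial.degree p \<le> Polynomial.degree r"
    using assms(2) card_poly_roots_bound[OF nz(2)] by simp
  thus False
    using assms(4) nz by (simp add: r degree_mult_eq)
qed

text \<open>Over \<open>a\<close> lie \<gamma>, of multiplicity 2, and deg Q - 2 simple points. Each
  simple point lifts to one series and \<gamma> to two; constant terms separate the lifts of
  different points, so deg Q roots are found and these are all of \<open>W\<close>.\<close>

lemma branched_fibre_in_fls:
  fixes Q :: "'a::{alg_closed_field, field_char_0} poly"
  assumes deg: "Polynomial.degree Q > 0" and \<gamma>: "Polynomial.order \<gamma> (Q - [:a:]) = 2"
    and simple: "\<And>r. poly Q r = a \<Longrightarrow> r \<noteq> \<gamma> \<Longrightarrow> poly (pderiv Q) r \<noteq> 0"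
  defines "W \<equiv> {Z. poly (map_poly fls_const Q) Z = fls_const a + fls_X ^ 2}"
    and "\<theta> \<equiv> \<lambda>Z. fls_compose_fps Z (- fps_X)"
  obtains R1 R2 where "card W = Polynomial.degree Q" "R1 \<in> W" "R2 \<in> W" "R1 \<noteq> R2" "\<theta> R1 = R2" "\<theta> R2 = R1"
    "\<And>Z. Z \<in> W \<Longrightarrow> Z \<noteq> R1 \<Longrightarrow> Z \<noteq> R2 \<Longrightarrow> \<theta> Z = Z"
proof -
  have \<theta>_fps: "\<theta> (fps_to_fls Y) = fps_to_fls (Y oo (- fps_X))" for Y :: "'a fps"
    unfolding \<theta>_def by (rule fls_compose_fps_to_fls) simp_all
  have W_fps: "fps_to_fls Y \<in> W" if "poly (map_poly fps_const Q) Y = fps_const a + fps_X ^ 2" for Y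
    unfolding W_def by (simp add: poly_map_fls_const that fls_times_fps_to_fls power2_eq_square)
  have nzQ: "Q - [:a:] \<noteq> 0"
    using deg by (metis degree_pCons_0 eq_iff_diff_eq_0 less_irrefl)
  obtain R where R: "fps_nth R 0 = \<gamma>" "poly (map_poly fps_const Q) R = fps_const a + fps_X ^ 2"
    "poly (map_poly fps_const Q) (R oo (- fps_X)) = fps_const a + fps_X ^ 2" "R oo (- fps_X) \<noteq> R"
    "R oo (- fps_X) oo (- fps_X) = R"
    using fps_double_root_lift[OF nzQ \<gamma>] by blast
  define L where "L = {r. poly Q r = a} - {\<gamma>}"
  have "\<exists>Y. fps_nth Y 0 = r \<and> poly (map_poly fps_const Q) Y = fps_const a + fps_X ^ 2 \<and> Y oo (- fps_X) = Y"
    if "r \<in> L" for r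
    using fps_simple_root_lift[of Q r a] simple[of r] that unfolding L_def by blast
  then obtain Y where Y: "\<And>r. r \<in> L \<Longrightarrow> fps_nth (Y r) 0 = r"
    "\<And>r. r \<in> L \<Longrightarrow> poly (map_poly fps_const Q) (Y r) = fps_const a + fps_X ^ 2"
    "\<And>r. r \<in> L \<Longrightarrow> Y r oo (- fps_X) = Y r"
    by metis
  define V where "V = (\<lambda>r. fps_to_fls (Y r)) ` L"
  define R1 where "R1 = fps_to_fls R"
  define R2 where "R2 = fps_to_fls (R oo (- fps_X))"
  have degQ: "Polynomial.degree (Q - [:a:]) = Polynomial.degree Q"
    using deg degree_add_eq_left[of "- [:a:]" Q] by (subst diff_conv_add_uminus) simp
  have fin: "finite {r. poly Q r = a}"
    using poly_roots_finite[OF nzQ] by simp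
  have \<gamma>a: "poly Q \<gamma> = a"
    using \<gamma> order_root[of "Q - [:a:]" \<gamma>] by simp
  have ord1: "Polynomial.order r (Q - [:a:]) = 1" if "r \<in> L" for r
  proof -
    have "Polynomial.order r (Q - [:a:]) \<noteq> 0"
      using that nzQ order_gt_0_iff[OF nzQ, of r] by (simp add: L_def)
    hence "Polynomial.order r (Q - [:a:]) = Suc (Polynomial.order r (pderiv (Q - [:a:])))"
      using nzQ that by (intro order_pderiv) (auto simp: L_def)
    moreover have "Polynomial.order r (pderiv (Q - [:a:])) = 0"
      using simple[of r] that by (intro order_0I) (simp add: L_def pderiv_diff pderiv_pCons)
    ultimately show ?thesis
      by simp
  qed
  have "Polynomial.degree Q = (\<Sum>z | poly (Q - [:a:]) z = 0. Polynomial.order z (Q - [:a:]))"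
    using sum_order_eq_degree[OF nzQ] degQ by simp
  also have "{z. poly (Q - [:a:]) z = 0} = insert \<gamma> L"
    using \<gamma>a by (auto simp: L_def)
  also have "(\<Sum>z\<in>insert \<gamma> L. Polynomial.order z (Q - [:a:])) = 2 + card L"
    using fin ord1 by (subst sum.insert) (auto simp: L_def \<gamma>)
  finally have cardL: "Polynomial.degree Q = card L + 2"
    by simp
  have injV: "inj_on (\<lambda>r. fps_to_fls (Y r)) L"
  proof (rule inj_onI)
    fix r s assume rs: "r \<in> L" "s \<in> L" "fps_to_fls (Y r) = fps_to_fls (Y s)"
    hence "fps_nth (Y r) 0 = fps_nth (Y s) 0"
      by simp
    thus "r = s"
      using Y(1) rs(1,2) by metis
  qed
  have RV: "R1 \<notin> V" "R2 \<notin> V"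
  proof -
    have "fps_nth (Y r) 0 \<noteq> fps_nth R 0" "fps_nth (Y r) 0 \<noteq> fps_nth (R oo (- fps_X)) 0" if "r \<in> L" for r
      using Y(1)[OF that] that R(1) by (auto simp: L_def)
    hence "fps_to_fls R \<noteq> fps_to_fls (Y r)" "fps_to_fls (R oo (- fps_X)) \<noteq> fps_to_fls (Y r)" if "r \<in> L" for r
      using that by (metis fps_to_fls_eq_iff)+
    thus "R1 \<notin> V" "R2 \<notin> V"
      unfolding V_def R1_def R2_def by blast+
  qed
  have R12: "R1 \<noteq> R2"
    using R(4) by (simp add: R1_def R2_def eq_commute)
  define W' where "W' = insert R1 (insert R2 V)"
  have finV: "finite V"
    using fin by (simp add: V_def L_def)
  have cardW': "card W' = Polynomial.degree Q"
    unfolding W'_def using finV RV R12 cardL card_image[OF injV] by (simp add: V_def)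
  have sub: "W' \<subseteq> W"
    unfolding W'_def V_def R1_def R2_def using W_fps R(2,3) Y(2) by auto
  define p where "p = map_poly fls_const Q - [:fls_const a + fls_X ^ 2 :: 'a fls:]"
  have degm: "Polynomial.degree (map_poly fls_const Q) = Polynomial.degree Q"
    by (rule degree_map_poly) simp
  have degp: "Polynomial.degree p = Polynomial.degree Q"
    unfolding p_def using deg degm
    by (metis degree_add_eq_left degree_minus degree_pCons_0 diff_conv_add_uminus)
  have "p \<noteq> 0"
    using deg degp by auto
  have W_p: "W = {Z. poly p Z = 0}"
    by (simp add: W_def p_def)
  have finW: "finite W"
    unfolding W_p by (rule poly_roots_finite[OF \<open>p \<noteq> 0\<close>])
  have "card W \<le> Polynomial.degree Q"
    unfolding W_p using card_poly_roots_bound[OF \<open>p \<noteq> 0\<close>] degp by simp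
  hence WW': "W' = W"
    using card_seteq[OF finW sub] cardW' by simp
  show thesis
  proof (rule that[of R1 R2])
    show "card W = Polynomial.degree Q" "R1 \<in> W" "R2 \<in> W" "R1 \<noteq> R2"
      using cardW' R12 by (auto simp: WW'[symmetric] W'_def)
    show "\<theta> R1 = R2" "\<theta> R2 = R1"
      unfolding R1_def R2_def by (simp_all add: \<theta>_fps R(5))
    show "\<theta> Z = Z" if "Z \<in> W" "Z \<noteq> R1" "Z \<noteq> R2" for Z
      using that Y(3) by (auto simp: WW'[symmetric] W'_def V_def \<theta>_fps)
  qed
qed

text \<open>Over the branch point \<open>a\<close> the fibre of \<open>Q\<close> splits over the Laurent series in \<open>s\<close> once
  \<open>b = a + s\<^sup>2\<close>; the substitution \<open>s \<mapsto> - s\<close> generates the inertia group.\<close>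

theorem transposition_of_branch_point:
  fixes Q :: "'a::{alg_closed_field, field_char_0} poly"
  assumes k: "subfield k (Kbar :: 'a ring)" and b: "\<not> alg_over k b" and Qk: "\<forall>i. poly.coeff Q i \<in> k"
  defines "F \<equiv> generate_field Kbar (insert b k)"
  assumes alg: "\<And>x. alg_over F x" and card: "card {x. poly Q x = b} = Polynomial.degree Q"
    and deg: "Polynomial.degree Q > 0" and \<gamma>: "Polynomial.order \<gamma> (Q - [:a:]) = 2"
    and simple: "\<And>r. poly Q r = a \<Longrightarrow> r \<noteq> \<gamma> \<Longrightarrow> poly (pderiv Q) r \<noteq> 0"
  shows "\<exists>\<tau>\<in>Aut_over F. \<exists>p q. p \<noteq> q \<and> poly Q p = b \<and> poly Q q = b \<and> \<tau> p = q \<and> \<tau> q = p \<and>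
    (\<forall>x. poly Q x = b \<longrightarrow> x \<noteq> p \<longrightarrow> x \<noteq> q \<longrightarrow> \<tau> x = x)"
proof -
  define \<theta> where "\<theta> = (\<lambda>Z :: 'a fls. fls_compose_fps Z (- fps_X))"
  define W where "W = {Z. poly (map_poly fls_const Q) Z = fls_const a + fls_X ^ 2}"
  obtain R1 R2 where R: "card W = Polynomial.degree Q" "R1 \<in> W" "R2 \<in> W" "R1 \<noteq> R2" "\<theta> R1 = R2" "\<theta> R2 = R1"
    "\<And>Z. Z \<in> W \<Longrightarrow> Z \<noteq> R1 \<Longrightarrow> Z \<noteq> R2 \<Longrightarrow> \<theta> Z = Z"
    unfolding W_def \<theta>_def by (rule branched_fibre_in_fls[OF deg \<gamma> simple]) blast+
  let ?y = "fls_const a + fls_X ^ 2 :: 'a fls"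
  have y: "?y = fps_to_fls (fps_of_poly [:a, 0, 1:])"
    by (simp add: fps_of_poly_pCons fls_times_fps_to_fls power2_eq_square algebra_simps)
  define \<Gamma> where "\<Gamma> = {(c, fls_const c) | c. c \<in> k}"
  have \<Gamma>: "hgraph \<Gamma>"
    unfolding hgraph_def \<Gamma>_def using subfield_closed[OF k]
    by (auto simp: fls_inverse_const fls_minus_const)
  \<comment> \<open>A relation with constant coefficients would give a nonzero polynomial S whose
    composite with a + s^2 vanishes, which is impossible.\<close>
  have "\<not> alg_over (Range \<Gamma>) ?y"
  proof
    assume "alg_over (Range \<Gamma>) ?y"
    then obtain P where P: "P \<noteq> 0" "\<forall>i. poly.coeff P i \<in> Range \<Gamma>" "poly P ?y = 0"
      unfolding alg_over_def by blast
    define S where "S = map_poly (\<lambda>Z :: 'a fls. fls_nth Z 0) P"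
    have PS: "P = map_poly fls_const S"
    proof (rule poly_eqI)
      fix i
      obtain c where "poly.coeff P i = fls_const c"
        using P(2) unfolding \<Gamma>_def by blast
      thus "poly.coeff P i = poly.coeff (map_poly fls_const S) i"
        by (simp add: S_def coeff_map_poly)
    qed
    have "poly (map_poly fps_const S) (fps_of_poly T) = fps_of_poly (pcompose S T)" for T
      by (induction S)
         (simp_all add: map_poly_pCons pcompose_pCons fps_of_poly_add fps_of_poly_mult fps_of_poly_const)
    hence "fps_of_poly (pcompose S [:a, 0, 1:]) = 0"
      using P(3) unfolding PS y poly_map_fls_const by simp
    hence "pcompose S [:a, 0, 1:] = 0"
      by (metis fps_of_poly_0 fps_of_poly_eq_iff)
    hence "S = 0"
      by (simp add: pcompose_eq_0_iff)
    thus False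
      using P(1) PS by simp
  qed
  moreover have "Domain \<Gamma> = k"
    by (auto simp: \<Gamma>_def)
  ultimately have \<Delta>: "hgraph (hgraph_adjoin \<Gamma> b ?y)" (is "hgraph ?\<Delta>")
    using b by (intro hgraph_adjoin_transcendental \<Gamma>) simp_all
  have in\<Delta>: "(c, fls_const c) \<in> ?\<Delta>" if "c \<in> k" for c
    using that hgraph_adjoin_incl(1)[OF \<Gamma>, of b ?y] by (auto simp: \<Gamma>_def)
  have b\<Delta>: "(b, ?y) \<in> ?\<Delta>"
    by (rule hgraph_adjoin_incl(2)[OF \<Gamma>])
  have Q\<Delta>: "poly_rel ?\<Delta> Q (map_poly fls_const Q)"
    using Qk in\<Delta> by (simp add: poly_rel_def coeff_map_poly)
  define Xb where "Xb = {x. poly Q x = b}"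
  define p' where "p' = map_poly fls_const Q - [:?y:]"
  have degm: "Polynomial.degree (map_poly fls_const Q) = Polynomial.degree Q"
    by (rule degree_map_poly) simp
  have degp': "Polynomial.degree p' = Polynomial.degree Q"
    unfolding p'_def using deg degm
    by (metis degree_add_eq_left degree_minus degree_pCons_0 diff_conv_add_uminus)
  have nzp': "p' \<noteq> 0"
    using deg degp' by auto
  have W_p': "W = {Z. poly p' Z = 0}"
    by (simp add: W_def p'_def)
  have nzQ: "Q - [:b:] \<noteq> 0"
    using deg by (metis degree_pCons_0 eq_iff_diff_eq_0 less_irrefl)
  \<comment> \<open>Sending b to a + s^2 embeds k(b) in the Laurent series; the embedding extends to
    the fibre \<open>Xb\<close> because Q = a + s^2 has its full number of roots there.\<close>
  obtain \<Theta> where \<Theta>: "hgraph \<Theta>" "?\<Delta> \<subseteq> \<Theta>" "Xb \<subseteq> Domain \<Theta>"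
  proof (rule hgraph_extend[OF \<Delta>, of Xb])
    fix x assume "x \<in> Xb"
    have "poly_rel ?\<Delta> (Q - [:b:]) p'"
      unfolding p'_def
      by (rule poly_rel_diff[OF \<Delta> Q\<Delta>]) (simp add: poly_rel_pCons_iff poly_rel_0[OF \<Delta>] b\<Delta>)
    moreover have "poly (Q - [:b:]) x = 0"
      using \<open>x \<in> Xb\<close> by (simp add: Xb_def)
    moreover have "\<forall>q. q dvd p' \<longrightarrow> 0 < Polynomial.degree q \<longrightarrow> (\<exists>y. poly q y = 0)"
      using dvd_has_root_of_card_roots[OF nzp'] R(1) degp' W_p' by simp
    ultimately show "\<exists>p p'. poly_rel ?\<Delta> p p' \<and> p \<noteq> 0 \<and> poly p x = 0 \<and>
            (\<forall>q. q dvd p' \<longrightarrow> 0 < Polynomial.degree q \<longrightarrow> (\<exists>y. poly q y = 0))"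
      using nzQ by blast
  qed
  define \<iota> where "\<iota> x = (THE Z. (x, Z) \<in> \<Theta>)" for x
  have \<iota>: "(x, \<iota> x) \<in> \<Theta>" if "x \<in> Xb" for x
    unfolding \<iota>_def
    by (rule theI') (use \<Theta>(3) that hgraphD(11)[OF \<Theta>(1)] in \<open>auto simp: Domain_iff subset_iff\<close>)
  have \<iota>W: "\<iota> ` Xb \<subseteq> W"
  proof (rule image_subsetI)
    fix x assume x: "x \<in> Xb"
    have "(poly Q x, poly (map_poly fls_const Q) (\<iota> x)) \<in> \<Theta>"
      by (rule poly_rel_poly[OF \<Theta>(1) poly_rel_mono[OF Q\<Delta> \<Theta>(2)] \<iota>[OF x]])
    moreover have "(b, ?y) \<in> \<Theta>"
      using b\<Delta> \<Theta>(2) by blast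
    ultimately show "\<iota> x \<in> W"
      using hgraphD(11)[OF \<Theta>(1)] x by (auto simp: Xb_def W_def)
  qed
  have "inj_on \<iota> Xb"
    by (rule inj_onI) (metis \<iota> hgraphD(12)[OF \<Theta>(1)])
  moreover have "finite W"
    unfolding W_p' by (rule poly_roots_finite[OF nzp'])
  moreover have "card Xb = card W"
    using card R(1) by (simp add: Xb_def)
  ultimately have surj: "\<iota> ` Xb = W"
    using \<iota>W by (metis card_image card_subset_eq)
  define \<Phi> where "\<Phi> = {(Z, \<theta> Z) | Z. True}"
  have "\<theta> (x - y) = \<theta> x - \<theta> y" "\<theta> (x * y) = \<theta> x * \<theta> y" "\<theta> (inverse x) = inverse (\<theta> x)" "\<theta> 1 = 1" "\<theta> 0 = 0" for x y
    unfolding \<theta>_def by (simp_all add: fls_compose_fps_diff fls_compose_fps_mult fls_compose_fps_inverse)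
  hence \<Phi>: "hgraph \<Phi>"
    unfolding hgraph_def \<Phi>_def by auto
  \<comment> \<open>The substitution is pulled back along the embedding. Since \<open>Xb\<close> is
    carried onto \<open>W\<close> and \<theta> permutes \<open>W\<close>, the domain of
    \<open>\<Psi>\<close> contains \<open>Xb\<close>, although no field is singled out.\<close>
  define \<Psi> where "\<Psi> = (\<Theta> O \<Phi>) O converse \<Theta>"
  have \<Psi>: "hgraph \<Psi>"
    unfolding \<Psi>_def by (intro hgraph_relcomp hgraph_converse \<Theta>(1) \<Phi>)
  have in\<Psi>: "(x, x') \<in> \<Psi>" if "(x, Z) \<in> \<Theta>" "(x', \<theta> Z) \<in> \<Theta>" for x x' Z
    using that unfolding \<Psi>_def \<Phi>_def by blast
  have base: "(c, c) \<in> \<Psi>" if "c \<in> insert b k" for c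
  proof (cases "c = b")
    case True
    have "\<theta> ?y = ?y"
      unfolding \<theta>_def by (simp add: fls_compose_fps_add fls_compose_fps_power)
    moreover have "(b, ?y) \<in> \<Theta>"
      using b\<Delta> \<Theta>(2) by blast
    ultimately show ?thesis
      using in\<Psi>[of b ?y b] True by simp
  next
    case False
    hence "(c, fls_const c) \<in> \<Theta>"
      using that in\<Delta> \<Theta>(2) by blast
    moreover have "\<theta> (fls_const c) = fls_const c"
      by (simp add: \<theta>_def)
    ultimately show ?thesis
      using in\<Psi>[of c "fls_const c" c] by simp
  qed
  have diag: "(x, x) \<in> \<Psi>" if "x \<in> F" for x
    using diagonal_generate_field[OF \<Psi> base] that unfolding F_def by blast
  obtain \<tau> where \<tau>: "\<tau> \<in> Aut_over F" "\<And>x y. (x, y) \<in> \<Psi> \<Longrightarrow> \<tau> x = y"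
    using Aut_over_extend[OF \<Psi> diag alg] by blast
  have \<tau>\<iota>: "\<tau> x = x'" if "x \<in> Xb" "x' \<in> Xb" "\<theta> (\<iota> x) = \<iota> x'" for x x'
    using \<tau>(2)[OF in\<Psi>[OF \<iota>[OF that(1)]]] \<iota>[OF that(2)] that(3) by simp
  obtain p q where pq: "p \<in> Xb" "\<iota> p = R1" "q \<in> Xb" "\<iota> q = R2"
    using surj R(2,3) by (metis imageE)
  show ?thesis
  proof (intro bexI[OF _ \<tau>(1)] exI conjI allI impI)
    show "p \<noteq> q" "poly Q p = b" "poly Q q = b" "\<tau> p = q" "\<tau> q = p"
      using pq R(4-6) \<tau>\<iota> by (auto simp: Xb_def)
    fix x assume x: "poly Q x = b" "x \<noteq> p" "x \<noteq> q"
    have xX: "x \<in> Xb"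
      using x(1) by (simp add: Xb_def)
    have "\<iota> x \<noteq> R1" "\<iota> x \<noteq> R2"
      using \<open>inj_on \<iota> Xb\<close> pq x xX by (metis inj_onD)+
    hence "\<theta> (\<iota> x) = \<iota> x"
      using R(7) \<iota>W xX by blast
    thus "\<tau> x = x"
      by (rule \<tau>\<iota>[OF xX xX])
  qed
qed

section \<open>Iteration of cubic polynomials\<close>

lemma degree_iterate_poly:
  fixes f :: "'a::field poly"
  assumes "Polynomial.degree f = 3"
  shows "Polynomial.degree (iterate_poly f n) = 3 ^ n"
  by (induction n) (simp_all add: iterate_poly_0 iterate_poly_Suc degree_pcompose assms)

lemma coeff_iterate_poly:
  fixes f :: "'a::field poly"
  assumes "subfield k (Kbar :: 'a ring)" "\<forall>i. poly.coeff f i \<in> k"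
  shows "\<forall>i. poly.coeff (iterate_poly f n) i \<in> k"
proof -
  have "poly_rel (Id_on k) (iterate_poly f n) (iterate_poly f n)"
  proof (induction n)
    case 0
    show ?case
      using subfield_closed(1,2)[OF assms(1)]
      by (simp add: iterate_poly_0 poly_rel_pCons_iff poly_rel_0[OF hgraph_Id_on[OF assms(1)]] Id_on_iff)
  next
    case (Suc n)
    have "poly_rel (Id_on k) f f"
      using assms(2) by (simp add: poly_rel_Id_on)
    thus ?case
      unfolding iterate_poly_Suc by (rule poly_rel_pcompose[OF hgraph_Id_on[OF assms(1)] Suc])
  qed
  thus ?thesis
    by (simp add: poly_rel_Id_on)
qed

text \<open>Chain rule: the derivative of the iterate is the product of the derivatives of
  \<open>f\<close> along the orbit of \<open>x\<close>.\<close>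

lemma critical_point_of_iterate:
  fixes f :: "'a::field_char_0 poly"
  assumes "poly (pderiv (iterate_poly f n)) x = 0"
  obtains i where "i < n" "poly (pderiv f) ((poly f ^^ i) x) = 0"
proof -
  have "\<exists>i<n. poly (pderiv f) ((poly f ^^ i) x) = 0"
    using assms
  proof (induction n arbitrary: x)
    case 0
    thus ?case
      by (simp add: iterate_poly_0 pderiv_pCons)
  next
    case (Suc n)
    hence "poly (pderiv (iterate_poly f n)) (poly f x) = 0 \<or> poly (pderiv f) x = 0"
      by (simp add: iterate_poly_Suc pderiv_pcompose poly_pcompose)
    thus ?case
    proof
      assume "poly (pderiv (iterate_poly f n)) (poly f x) = 0"
      with Suc.IH obtain i where "i < n" "poly (pderiv f) ((poly f ^^ i) (poly f x)) = 0"
        by blast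
      thus ?thesis
        by (intro exI[of _ "Suc i"]) (simp add: funpow_swap1)
    next
      assume "poly (pderiv f) x = 0"
      thus ?thesis
        by (intro exI[of _ 0]) simp
    qed
  qed
  thus thesis
    using that by blast
qed

lemma order_simple_root:
  fixes Q :: "'a::field_char_0 poly"
  assumes "Q - [:b:] \<noteq> 0" "poly Q x = b" "poly (pderiv Q) x \<noteq> 0"
  shows "Polynomial.order x (Q - [:b:]) = 1"
proof -
  have "Polynomial.order x (Q - [:b:]) = Suc (Polynomial.order x (pderiv (Q - [:b:])))"
    using assms(1,2) by (intro order_pderiv) auto
  moreover have "Polynomial.order x (pderiv (Q - [:b:])) = 0"
    using assms(3) by (intro order_0I) (simp add: pderiv_diff pderiv_pCons)
  ultimately show ?thesis
    by simp
qed

lemma card_simple_fibre: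
  fixes Q :: "'a::{alg_closed_field, field_char_0} poly"
  assumes "Polynomial.degree Q > 0" "\<And>x. poly Q x = b \<Longrightarrow> poly (pderiv Q) x \<noteq> 0"
  shows "card {x. poly Q x = b} = Polynomial.degree Q"
proof -
  have nz: "Q - [:b:] \<noteq> 0"
    using assms(1) by (metis degree_pCons_0 eq_iff_diff_eq_0 less_irrefl)
  have "Polynomial.degree (Q - [:b:]) = Polynomial.degree Q"
    using assms(1) degree_add_eq_left[of "- [:b:]" Q] by (subst diff_conv_add_uminus) simp
  hence "Polynomial.degree Q = (\<Sum>x | poly Q x = b. Polynomial.order x (Q - [:b:]))"
    using sum_order_eq_degree[OF nz] by simp
  also have "\<dots> = (\<Sum>x | poly Q x = b. 1)"
    using order_simple_root[OF nz] assms(2) by (intro sum.cong) auto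
  finally show ?thesis
    by simp
qed

lemma quadratic_factorization:
  fixes p :: "'a::alg_closed_field poly"
  assumes "Polynomial.degree p = 2"
  obtains c \<gamma>1 \<gamma>2 where "c \<noteq> 0" "p = Polynomial.smult c ([:- \<gamma>1, 1:] * [:- \<gamma>2, 1:])"
proof -
  obtain \<gamma>1 where "poly p \<gamma>1 = 0"
    using alg_closed_imp_poly_has_root[of p] assms by auto
  then obtain q where q: "p = [:- \<gamma>1, 1:] * q"
    by (auto simp: poly_eq_0_iff_dvd)
  have "q \<noteq> 0"
    using assms q by auto
  hence "Polynomial.degree q = 1"
    using assms by (simp add: q degree_mult_eq del: mult_pCons_left)
  then obtain d c where dc: "q = [:d, c:]"
    using degree1_coeffs by (metis One_nat_def)
  with \<open>Polynomial.degree q = 1\<close> have "c \<noteq> 0"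
    by auto
  hence "p = Polynomial.smult c ([:- \<gamma>1, 1:] * [:- (- d / c), 1:])"
    by (simp add: q dc field_simps)
  with \<open>c \<noteq> 0\<close> show thesis
    by (rule that)
qed

lemma finite_orbit_if_not_inj:
  fixes h :: "'a \<Rightarrow> 'a"
  assumes "\<not> inj (\<lambda>n. (h ^^ n) x)"
  shows "finite (range (\<lambda>n. (h ^^ n) x))"
proof -
  obtain i j where ij: "i < j" "(h ^^ i) x = (h ^^ j) x"
    using assms by (metis (mono_tags, lifting) injI linorder_neqE_nat)
  have "(h ^^ n) x \<in> (\<lambda>n. (h ^^ n) x) ` {..<j}" for n
  proof (induction n rule: less_induct)
    case (less n)
    show ?case
    proof (cases "n < j")
      case False
      have "(h ^^ n) x = (h ^^ (n - j)) ((h ^^ j) x)"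
        using False by (simp flip: comp_apply[of "h ^^ (n - j)"] funpow_add)
      also have "\<dots> = (h ^^ (n - j + i)) x"
        by (simp add: ij(2)[symmetric] funpow_add)
      finally show ?thesis
        using less[of "n - j + i"] ij(1) False by simp
    qed auto
  qed
  hence "range (\<lambda>n. (h ^^ n) x) \<subseteq> (\<lambda>n. (h ^^ n) x) ` {..<j}"
    by blast
  thus ?thesis
    by (rule finite_subset) simp
qed

text \<open>Failure of PCF makes one critical orbit infinite. If the other critical point reaches
  this orbit in fewer steps, that one is chosen instead; being ahead in this sense cannot hold both
  ways.\<close>

lemma wandering_critical_point:
  fixes g :: "'a::field_char_0 poly"
  assumes crit: "{x. poly (pderiv g) x = 0} = {\<gamma>1, \<gamma>2}" and "\<not> PCF g"
    and ne: "\<And>n. n \<ge> 1 \<Longrightarrow> (poly g ^^ n) \<gamma>1 \<noteq> (poly g ^^ n) \<gamma>2"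
  obtains \<gamma> where "poly (pderiv g) \<gamma> = 0"
    "\<And>n i \<gamma>'. 1 \<le> i \<Longrightarrow> i \<le> n \<Longrightarrow> poly (pderiv g) \<gamma>' = 0 \<Longrightarrow>
        (poly g ^^ i) \<gamma>' = (poly g ^^ n) \<gamma> \<Longrightarrow> i = n \<and> \<gamma>' = \<gamma>"
proof -
  note intro = that
  let ?h = "poly g"
  define good where "good \<gamma> \<gamma>' \<longleftrightarrow> inj (\<lambda>n. (?h ^^ n) \<gamma>) \<and>
    (\<forall>i n. 1 \<le> i \<longrightarrow> i \<le> n \<longrightarrow> (?h ^^ i) \<gamma>' \<noteq> (?h ^^ n) \<gamma>)" for \<gamma> \<gamma>'
  have add: "(?h ^^ i) ((?h ^^ j) x) = (?h ^^ (i + j)) x" for i j x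
    by (simp add: funpow_add)
  have core: "good \<gamma> \<gamma>' \<or> good \<gamma>' \<gamma>"
    if inj: "inj (\<lambda>n. (?h ^^ n) \<gamma>)" and ne: "\<And>n. n \<ge> 1 \<Longrightarrow> (?h ^^ n) \<gamma> \<noteq> (?h ^^ n) \<gamma>'" for \<gamma> \<gamma>'
  proof (cases "good \<gamma> \<gamma>'")
    case False
    then obtain i n where i: "1 \<le> i" "i \<le> n" "(?h ^^ i) \<gamma>' = (?h ^^ n) \<gamma>"
      using inj unfolding good_def by blast
    hence "i < n"
      using ne[of n] by (metis le_neq_implies_less)
    \<comment> \<open>After i steps the orbit of \<gamma>' runs inside the injective orbit of
      \<gamma>, so a repetition would show up there.\<close>
    have inj': "inj (\<lambda>n. (?h ^^ n) \<gamma>')"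
    proof (rule injI)
      fix r s assume eq: "(?h ^^ r) \<gamma>' = (?h ^^ s) \<gamma>'"
      have "(?h ^^ (r + n)) \<gamma> = (?h ^^ r) ((?h ^^ i) \<gamma>')"
        by (simp add: i(3) add)
      also have "\<dots> = (?h ^^ i) ((?h ^^ r) \<gamma>')"
        by (simp add: add add.commute)
      also have "\<dots> = (?h ^^ s) ((?h ^^ i) \<gamma>')"
        by (simp add: eq add add.commute)
      also have "\<dots> = (?h ^^ (s + n)) \<gamma>"
        by (simp add: i(3) add)
      finally show "r = s"
        using injD[OF inj, of "r + n" "s + n"] by simp
    qed
    \<comment> \<open>A meeting with j \<le> m would identify the times m + n and i + j on the
      injective orbit of \<gamma>, but i < n makes m + n larger.\<close>
    have "(?h ^^ j) \<gamma> \<noteq> (?h ^^ m) \<gamma>'" if "j \<le> m" for j m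
    proof
      assume eq: "(?h ^^ j) \<gamma> = (?h ^^ m) \<gamma>'"
      have "(?h ^^ (m + n)) \<gamma> = (?h ^^ m) ((?h ^^ i) \<gamma>')"
        by (simp add: i(3) add)
      also have "\<dots> = (?h ^^ i) ((?h ^^ m) \<gamma>')"
        by (simp add: add add.commute)
      also have "\<dots> = (?h ^^ (i + j)) \<gamma>"
        by (simp add: eq[symmetric] add)
      finally have "m + n = i + j"
        using injD[OF inj, of "m + n" "i + j"] by simp
      thus False
        using that \<open>i < n\<close> by simp
    qed
    thus ?thesis
      using inj' unfolding good_def by blast
  qed simp
  have "{poly (iterate_poly g n) \<gamma> | n \<gamma>. n \<ge> 1 \<and> poly (pderiv g) \<gamma> = 0} \<subseteq>
      range (\<lambda>n. (?h ^^ n) \<gamma>1) \<union> range (\<lambda>n. (?h ^^ n) \<gamma>2)"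
  proof clarify
    fix n \<gamma> assume "poly (pderiv g) \<gamma> = 0" "poly (iterate_poly g n) \<gamma> \<notin> range (\<lambda>n. (?h ^^ n) \<gamma>2)"
    moreover from this have "\<gamma> = \<gamma>1 \<or> \<gamma> = \<gamma>2"
      using crit by blast
    ultimately show "poly (iterate_poly g n) \<gamma> \<in> range (\<lambda>n. (?h ^^ n) \<gamma>1)"
      by (auto simp: poly_iterate_poly)
  qed
  hence "infinite (range (\<lambda>n. (?h ^^ n) \<gamma>1) \<union> range (\<lambda>n. (?h ^^ n) \<gamma>2))"
    using assms(2) unfolding PCF_def using finite_subset by blast
  hence "inj (\<lambda>n. (?h ^^ n) \<gamma>1) \<or> inj (\<lambda>n. (?h ^^ n) \<gamma>2)"
    using finite_orbit_if_not_inj by (metis finite_UnI)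
  hence "good \<gamma>1 \<gamma>2 \<or> good \<gamma>2 \<gamma>1"
    using core[of \<gamma>1 \<gamma>2] core[of \<gamma>2 \<gamma>1] ne by metis
  moreover have thesis if g: "good \<gamma> \<gamma>'" and c: "{\<gamma>, \<gamma>'} = {\<gamma>1, \<gamma>2}" for \<gamma> \<gamma>'
  proof (rule intro)
    show "poly (pderiv g) \<gamma> = 0"
      using c crit by blast
    fix n i \<delta> assume *: "1 \<le> i" "i \<le> n" "poly (pderiv g) \<delta> = 0" "(?h ^^ i) \<delta> = (?h ^^ n) \<gamma>"
    have "\<delta> = \<gamma>"
      using *  g c crit unfolding good_def by blast
    moreover have "i = n"
      using * g unfolding good_def \<open>\<delta> = \<gamma>\<close> inj_def by blast
    ultimately show "i = n \<and> \<delta> = \<gamma>"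
      by simp
  qed
  ultimately show thesis
    by blast
qed

section \<open>The generic fibre of a cubic polynomial with constant coefficients\<close>

text \<open>The last assumption says that the ambient field is algebraic over k(b); this is where
  transcendence degree one enters.\<close>

locale constant_cubic =
  fixes k :: "'a::{alg_closed_field, field_char_0} set" and g :: "'a poly" and b :: 'a
  assumes subfield_k: "subfield k (Kbar :: 'a ring)"
    and k_closed: "algebraically_closed ((Kbar :: 'a ring)\<lparr>carrier := k\<rparr>)"
    and coeff_g: "\<forall>i. poly.coeff g i \<in> k" and degree_g: "Polynomial.degree g = 3"
    and b_notin: "b \<notin> k"
    and alg: "\<And>x. alg_over (generate_field Kbar (insert b k)) x"
begin

abbreviation F :: "'a set" where
  "F \<equiv> generate_field Kbar (insert b k)"

abbreviation R :: "nat \<Rightarrow> 'a set" where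
  "R n \<equiv> {x. poly (iterate_poly g n) x = b}"

text \<open>A fibre point in \<open>k\<close> would be mapped into \<open>k\<close>, away from
  \<open>b\<close>. Consequently fibres avoid critical points, which are algebraic over
  \<open>k\<close>, and any two fibre points generate isomorphic fields over
  \<open>k\<close>.\<close>

lemma not_alg_over_k: "\<not> alg_over k x" if "x \<in> R n"
proof
  assume "alg_over k x"
  hence "x \<in> k"
    by (rule alg_closed_subfield_mem[OF subfield_k k_closed])
  hence "poly (iterate_poly g n) x \<in> k"
    by (rule poly_in_subfield[OF subfield_k coeff_iterate_poly[OF subfield_k coeff_g]])
  thus False
    using that b_notin by simp
qed

lemma b_transcendental: "\<not> alg_over k b"
  by (rule not_alg_over_k[of b 0]) (simp add: iterate_poly_0)

lemma pderiv_g_nonzero: "pderiv g \<noteq> 0"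
  using degree_g by (simp add: pderiv_eq_0_iff)

lemma critical_algebraic: "poly (pderiv g) x = 0 \<Longrightarrow> alg_over k x"
proof -
  assume "poly (pderiv g) x = 0"
  moreover have "of_nat n \<in> k" for n
    by (induction n) (use subfield_closed[OF subfield_k] in auto)
  hence "\<forall>i. poly.coeff (pderiv g) i \<in> k"
    using coeff_g subfield_closed(5)[OF subfield_k] by (simp add: coeff_pderiv del: of_nat_Suc)
  ultimately show ?thesis
    unfolding alg_over_def using pderiv_g_nonzero by blast
qed

text \<open>A critical point met on the way from \<open>x\<close> to \<open>b\<close> would itself
  lie in a fibre, contradicting that it is algebraic over \<open>k\<close>.\<close>

lemma fibre_simple: "poly (pderiv (iterate_poly g n)) x \<noteq> 0" if "x \<in> R n"
proof
  assume "poly (pderiv (iterate_poly g n)) x = 0"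
  then obtain i where i: "i < n" "poly (pderiv g) ((poly g ^^ i) x) = 0"
    by (rule critical_point_of_iterate)
  have "(poly g ^^ (n - i)) ((poly g ^^ i) x) = (poly g ^^ n) x"
    using i(1) by (simp flip: comp_apply[of "poly g ^^ (n - i)"] funpow_add)
  hence "(poly g ^^ i) x \<in> R (n - i)"
    using that by (simp add: poly_iterate_poly)
  thus False
    using not_alg_over_k critical_algebraic[OF i(2)] by blast
qed

lemma card_R: "card (R n) = 3 ^ n"
  using card_simple_fibre[of "iterate_poly g n" b] fibre_simple degree_iterate_poly[OF degree_g, of n] by simp

lemma finite_R: "finite (R n)"
  by (rule card_ge_0_finite) (simp add: card_R)

lemma Aut_R:
  assumes "\<tau> \<in> Aut_over F"
  shows "\<tau> (poly g x) = poly g (\<tau> x)" "x \<in> R n \<Longrightarrow> \<tau> x \<in> R n"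
proof -
  have kF: "insert b k \<subseteq> F"
    by (rule generate_field_incl)
  have "\<tau> (poly p x) = poly p (\<tau> x)" if "\<forall>i. poly.coeff p i \<in> k" for p
    using Aut_over_poly[OF assms, of p] that kF by blast
  note * = this[OF coeff_g] this[OF coeff_iterate_poly[OF subfield_k coeff_g]]
  show "\<tau> (poly g x) = poly g (\<tau> x)"
    by (rule *(1))
  show "x \<in> R n \<Longrightarrow> \<tau> x \<in> R n"
    using *(2)[of n] Aut_overD(4)[OF assms, of b] kF by simp
qed

text \<open>Irreducibility of g^n - b comes for free: \<open>x\<close> and \<open>y\<close> are both
  transcendental over \<open>k\<close>, so x \<mapsto> y is an isomorphism of k(x) with k(y), and it
  fixes b = g^n(x) = g^n(y).\<close>

lemma transitive_on_R:
  assumes "x \<in> R n" "y \<in> R n"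
  obtains \<tau> where "\<tau> \<in> Aut_over F" "\<tau> x = y"
proof -
  let ?I = "Id_on k"
  have I: "hgraph ?I"
    by (rule hgraph_Id_on[OF subfield_k])
  have \<Gamma>: "hgraph (hgraph_adjoin ?I x y)" (is "hgraph ?\<Gamma>")
    by (rule hgraph_adjoin_transcendental[OF I]) (use not_alg_over_k assms in simp_all)
  have k\<Gamma>: "(c, c) \<in> ?\<Gamma>" if "c \<in> k" for c
    using that hgraph_adjoin_incl(1)[OF I, of x y] by auto
  have xy: "(x, y) \<in> ?\<Gamma>"
    by (rule hgraph_adjoin_incl(2)[OF I])
  have "poly_rel ?\<Gamma> (iterate_poly g n) (iterate_poly g n)"
    using coeff_iterate_poly[OF subfield_k coeff_g] k\<Gamma> by (simp add: poly_rel_def)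
  from poly_rel_poly[OF \<Gamma> this xy] have "(b, b) \<in> ?\<Gamma>"
    using assms by simp
  hence diag: "(z, z) \<in> ?\<Gamma>" if "z \<in> F" for z
    using diagonal_generate_field[OF \<Gamma> _ that] k\<Gamma> by blast
  show thesis
    using Aut_over_extend[OF \<Gamma> diag alg] xy that by blast
qed

end

text \<open>Distinct critical points make the local degree of \<open>g\<close> at \<gamma> equal to
  2; a double critical point would give 3, and a three-cycle in place of a transposition. The orbit
  condition preserves this picture on every level.\<close>

locale wandering_cubic = constant_cubic k g b
  for k :: "'a::{alg_closed_field, field_char_0} set" and g b +
  fixes \<gamma> \<gamma>' c :: 'a
  assumes c: "c \<noteq> 0" "pderiv g = Polynomial.smult c ([:- \<gamma>, 1:] * [:- \<gamma>', 1:])" "\<gamma> \<noteq> \<gamma>'"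
    and wandering: "\<And>n i \<delta>. 1 \<le> i \<Longrightarrow> i \<le> n \<Longrightarrow> poly (pderiv g) \<delta> = 0 \<Longrightarrow>
        (poly g ^^ i) \<delta> = (poly g ^^ n) \<gamma> \<Longrightarrow> i = n \<and> \<delta> = \<gamma>"
begin

text \<open>Local degrees multiply along the orbit: 2 at \<gamma> and 1 at every later point, since
  a critical point met later would reach the same value in fewer steps.\<close>

lemma order_gamma: "Polynomial.order \<gamma> (iterate_poly g (Suc n) - [:(poly g ^^ Suc n) \<gamma>:]) = 2"
proof -
  let ?a = "(poly g ^^ Suc n) \<gamma>"
  have nz: "g - [:poly g \<gamma>:] \<noteq> 0"
    using degree_g by (metis degree_pCons_0 eq_iff_diff_eq_0 zero_neq_numeral)
  have "Polynomial.order \<gamma> (pderiv g) = Polynomial.order \<gamma> [:- \<gamma>, 1:] + Polynomial.order \<gamma> [:- \<gamma>', 1:]"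
    unfolding c(2) using c(1) by (subst order_smult, simp, subst order_mult) simp_all
  also have "\<dots> = 1"
    using c(3) order_power_n_n[of \<gamma> 1] by (simp add: order_0I)
  finally have "Polynomial.order \<gamma> (pderiv (g - [:poly g \<gamma>:])) = 1"
    by (simp add: pderiv_diff pderiv_pCons)
  hence 2: "Polynomial.order \<gamma> (g - [:poly g \<gamma>:]) = 2"
    using order_pderiv[OF nz, of \<gamma>] by simp
  have "poly (pderiv (iterate_poly g n)) (poly g \<gamma>) \<noteq> 0"
  proof
    assume "poly (pderiv (iterate_poly g n)) (poly g \<gamma>) = 0"
    then obtain i where i: "i < n" "poly (pderiv g) ((poly g ^^ i) (poly g \<gamma>)) = 0"
      by (rule critical_point_of_iterate)
    have "(poly g ^^ (n - i)) ((poly g ^^ i) (poly g \<gamma>)) = (poly g ^^ n) (poly g \<gamma>)"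
      using i(1) by (simp flip: comp_apply[of "poly g ^^ (n - i)"] funpow_add)
    hence "(poly g ^^ (n - i)) ((poly g ^^ i) (poly g \<gamma>)) = ?a"
      by (simp add: funpow_swap1)
    moreover have "1 \<le> n - i" "n - i \<le> Suc n"
      using i(1) by simp_all
    ultimately have "n - i = Suc n"
      using wandering[OF _ _ i(2)] by blast
    thus False
      by simp
  qed
  moreover have "poly (iterate_poly g n) (poly g \<gamma>) = ?a"
    by (simp add: poly_iterate_poly funpow_swap1)
  ultimately have "Polynomial.order (poly g \<gamma>) (iterate_poly g n - [:?a:]) = 1"
    by (intro order_simple_root iterate_poly_diff_nonzero[OF degree_g])
  thus ?thesis
    using order_iterate_poly_Suc[OF degree_g, of \<gamma> n ?a] 2 by simp
qed

text \<open>If the orbit of another point over g^(n+1)(\<gamma>) met a critical point after i steps,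
  only n + 1 - i steps would remain. Then \<open>wandering\<close> forces i = 0, and the point is
  \<gamma> itself; so all other points over this value are unramified.\<close>

lemma transposition_on_R:
  "\<exists>\<tau>\<in>Aut_over F. \<exists>p q. p \<noteq> q \<and> p \<in> R (Suc n) \<and> q \<in> R (Suc n) \<and> \<tau> p = q \<and> \<tau> q = p \<and>
    (\<forall>x\<in>R (Suc n). x \<noteq> p \<longrightarrow> x \<noteq> q \<longrightarrow> \<tau> x = x)"
proof -
  let ?Q = "iterate_poly g (Suc n)" and ?a = "(poly g ^^ Suc n) \<gamma>"
  have simple: "poly (pderiv ?Q) r \<noteq> 0" if r: "poly ?Q r = ?a" "r \<noteq> \<gamma>" for r
  proof
    assume "poly (pderiv ?Q) r = 0"
    then obtain i where i: "i < Suc n" "poly (pderiv g) ((poly g ^^ i) r) = 0"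
      by (rule critical_point_of_iterate)
    have "(poly g ^^ (Suc n - i)) ((poly g ^^ i) r) = (poly g ^^ Suc n) r"
      using i(1) by (simp flip: comp_apply[of "poly g ^^ (Suc n - i)"] funpow_add del: funpow.simps)
    hence "(poly g ^^ (Suc n - i)) ((poly g ^^ i) r) = ?a"
      using r(1) by (simp add: poly_iterate_poly)
    moreover have "1 \<le> Suc n - i" "Suc n - i \<le> Suc n"
      using i(1) by simp_all
    ultimately have "Suc n - i = Suc n" "(poly g ^^ i) r = \<gamma>"
      using wandering[OF _ _ i(2)] by blast+
    thus False
      using r(2) i(1) by (cases i) simp_all
  qed
  have "card {x. poly ?Q x = b} = Polynomial.degree ?Q" "Polynomial.degree ?Q > 0"
    using card_R[of "Suc n"] degree_iterate_poly[OF degree_g, of "Suc n"] by simp_all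
  thus ?thesis
    using transposition_of_branch_point[OF subfield_k b_transcendental
          coeff_iterate_poly[OF subfield_k coeff_g] alg _ _ order_gamma simple]
    by simp
qed

text \<open>The pairs exchanged by some transposition form a relation that is symmetric, stable
  under conjugation and transitive on distinct points. Since the group acts transitively, conjugates
  of one such pair give every vertex a partner among its two siblings, and on a set of three this
  connects all pairs.\<close>

lemma sibling_transposition:
  assumes x: "x \<in> R (Suc n)" "y \<in> R (Suc n)" "poly g x = poly g y" "x \<noteq> y"
  obtains \<tau> where "\<tau> \<in> Aut_over F" "\<tau> x = y" "\<tau> y = x"
    "\<And>z. z \<in> R (Suc n) \<Longrightarrow> z \<noteq> x \<Longrightarrow> z \<noteq> y \<Longrightarrow> \<tau> z = z"
proof -
  define T where "T x y \<longleftrightarrow> (\<exists>\<tau>\<in>Aut_over F. \<tau> x = y \<and> \<tau> y = x \<and>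
    (\<forall>z\<in>R (Suc n). z \<noteq> x \<longrightarrow> z \<noteq> y \<longrightarrow> \<tau> z = z))" for x y
  have sym: "T y x" if "T x y" for x y
    using that unfolding T_def by blast
  have conj: "T (\<rho> x) (\<rho> y)" if T: "T x y" and \<rho>: "\<rho> \<in> Aut_over F" for x y \<rho>
  proof -
    obtain \<tau> where \<tau>: "\<tau> \<in> Aut_over F" "\<tau> x = y" "\<tau> y = x"
      "\<And>z. z \<in> R (Suc n) \<Longrightarrow> z \<noteq> x \<Longrightarrow> z \<noteq> y \<Longrightarrow> \<tau> z = z"
      using T unfolding T_def by blast
    let ?\<rho>' = "inv_into UNIV \<rho>"
    have \<rho>': "?\<rho>' \<in> Aut_over F" "\<And>z. ?\<rho>' (\<rho> z) = z" "\<And>z. \<rho> (?\<rho>' z) = z"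
      using Aut_over_inv[OF \<rho>] Aut_overD(1)[OF \<rho>] by (simp_all add: bij_def surj_f_inv_f)
    have "\<rho> \<circ> \<tau> \<circ> ?\<rho>' \<in> Aut_over F"
      by (intro Aut_over_comp \<rho> \<tau>(1) \<rho>'(1))
    moreover have "\<rho> (\<tau> (?\<rho>' z)) = z" if "z \<in> R (Suc n)" "z \<noteq> \<rho> x" "z \<noteq> \<rho> y" for z
    proof -
      have "?\<rho>' z \<in> R (Suc n)"
        using Aut_R(2)[OF \<rho>'(1) that(1)] .
      hence "\<tau> (?\<rho>' z) = ?\<rho>' z"
        using \<tau>(4) that(2,3) \<rho>'(3) by metis
      thus ?thesis
        by (simp add: \<rho>'(3))
    qed
    ultimately show ?thesis
      unfolding T_def using \<tau>(2,3) \<rho>'(2) by (intro bexI[of _ "\<rho> \<circ> \<tau> \<circ> ?\<rho>'"]) auto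
  qed
  \<comment> \<open>Conjugating the transposition of y and z by that of x and y gives the one of x
    and z.\<close>
  have trans: "T x z" if *: "T x y" "T y z" "z \<in> R (Suc n)" "z \<noteq> x" "z \<noteq> y" for x y z
  proof -
    obtain \<tau> where \<tau>: "\<tau> \<in> Aut_over F" "\<tau> y = x" "\<tau> z = z"
      using *(1,3-5) unfolding T_def by blast
    show ?thesis
      using conj[OF *(2) \<tau>(1)] \<tau>(2,3) by simp
  qed
  have fibre: "card {z. poly g z = poly g w} = 3" if "w \<in> R (Suc n)" for w
  proof -
    have "poly g w \<in> R n"
      using that by (simp add: iterate_poly_Suc poly_pcompose)
    have "poly (pderiv g) z \<noteq> 0" if "poly g z = poly g w" for z
    proof -
      have "z \<in> R (Suc n)"
        using that \<open>poly g w \<in> R n\<close> by (simp add: iterate_poly_Suc poly_pcompose)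
      thus ?thesis
        using fibre_simple[of z "Suc n"] by (simp add: iterate_poly_Suc pderiv_pcompose)
    qed
    thus ?thesis
      using card_simple_fibre[of g "poly g w"] degree_g by simp
  qed
  obtain \<tau>0 p q where 0: "\<tau>0 \<in> Aut_over F" "p \<noteq> q" "p \<in> R (Suc n)" "q \<in> R (Suc n)" "\<tau>0 p = q" "\<tau>0 q = p"
    "\<And>x. x \<in> R (Suc n) \<Longrightarrow> x \<noteq> p \<Longrightarrow> x \<noteq> q \<Longrightarrow> \<tau>0 x = x"
    using transposition_on_R[of n] by blast
  have Tpq: "T p q"
    unfolding T_def using 0 by blast
  \<comment> \<open>The parent of p has a child other than p and q. As \<tau>0 fixes this child, it
    fixes the parent, so q = \<tau>0(p) has the same parent as p.\<close>
  have gpq: "poly g p = poly g q"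
  proof -
    have "\<not> {z. poly g z = poly g p} \<subseteq> {p, q}"
      using fibre[OF 0(3)] card_mono[of "{p, q}" "{z. poly g z = poly g p}"] 0(2) by auto
    then obtain z where z: "poly g z = poly g p" "z \<noteq> p" "z \<noteq> q"
      by blast
    have "z \<in> R (Suc n)"
      using z(1) 0(3) by (simp add: iterate_poly_Suc poly_pcompose)
    hence "\<tau>0 (poly g p) = poly g p"
      using 0(7)[OF _ z(2,3)] Aut_R(1)[OF 0(1), of z] z(1) by simp
    thus ?thesis
      using Aut_R(1)[OF 0(1), of p] 0(5) by simp
  qed
  have partner: "\<exists>w'. w' \<noteq> w \<and> poly g w' = poly g w \<and> T w w'" if w: "w \<in> R (Suc n)" for w
  proof -
    obtain \<rho> where \<rho>: "\<rho> \<in> Aut_over F" "\<rho> p = w"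
      using transitive_on_R[OF 0(3) w] .
    have "\<rho> q \<noteq> w"
      using 0(2) \<rho> Aut_overD(10)[OF \<rho>(1), of q p] by simp
    moreover have "poly g (\<rho> q) = poly g w"
      using Aut_R(1)[OF \<rho>(1), of p] Aut_R(1)[OF \<rho>(1), of q] gpq \<rho>(2) by simp
    ultimately show ?thesis
      using conj[OF Tpq \<rho>(1)] \<rho>(2) by auto
  qed
  obtain x' where x': "x' \<noteq> x" "poly g x' = poly g x" "T x x'"
    using partner[OF x(1)] by blast
  have "T x y"
  proof (cases "y = x'")
    case False
    obtain y' where y': "y' \<noteq> y" "poly g y' = poly g y" "T y y'"
      using partner[OF x(2)] by blast
    have fin: "finite {z. poly g z = poly g x}"
      using fibre[OF x(1)] by (metis card.infinite zero_neq_numeral)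
    have eq: "{x, x', y} = {z. poly g z = poly g x}"
      by (rule card_subset_eq[OF fin]) (use fibre[OF x(1)] x x' False in auto)
    have "y' \<in> {x, x', y}"
      unfolding eq using y'(2) x(3) by simp
    hence "y' = x \<or> y' = x'"
      using y'(1) by simp
    thus ?thesis
      using sym[OF y'(3)] trans[OF x'(3) _ x(2)] x(4) False by auto
  qed (use x' in simp)
  thus thesis
    unfolding T_def using that by blast
qed

text \<open>Composing with the transposition of x and \<pi>(x) makes x fixed and moves no point that
  \<pi> fixes, so induction on the number of moved points applies.\<close>

lemma sibling_permutation:
  assumes "inj_on \<pi> (R (Suc n))" "\<And>x. x \<in> R (Suc n) \<Longrightarrow> poly g (\<pi> x) = poly g x"
  shows "\<exists>\<tau>\<in>Aut_over F. \<forall>x\<in>R (Suc n). \<tau> x = \<pi> x"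
  using assms
proof (induction "card {x \<in> R (Suc n). \<pi> x \<noteq> x}" arbitrary: \<pi> rule: less_induct)
  case less
  let ?S = "R (Suc n)"
  have \<pi>S: "\<pi> x \<in> ?S" if "x \<in> ?S" for x
    using less.prems(2)[OF that] that by (simp add: iterate_poly_Suc poly_pcompose)
  show ?case
  proof (cases "\<forall>x\<in>?S. \<pi> x = x")
    case True
    thus ?thesis
      using Aut_over_id by (intro bexI[of _ "\<lambda>x. x"]) auto
  next
    case False
    then obtain x where x: "x \<in> ?S" "\<pi> x \<noteq> x"
      by blast
    obtain \<tau> where \<tau>: "\<tau> \<in> Aut_over F" "\<tau> x = \<pi> x" "\<tau> (\<pi> x) = x"
      "\<And>z. z \<in> ?S \<Longrightarrow> z \<noteq> x \<Longrightarrow> z \<noteq> \<pi> x \<Longrightarrow> \<tau> z = z"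
      using sibling_transposition[OF x(1) \<pi>S[OF x(1)] less.prems(2)[OF x(1), symmetric] x(2)[symmetric]] by blast
    have \<tau>S: "\<tau> z \<in> ?S \<and> poly g (\<tau> z) = poly g z \<and> \<tau> (\<tau> z) = z" if "z \<in> ?S" for z
      using that \<tau> x \<pi>S less.prems(2)[OF x(1)] by (cases "z = x"; cases "z = \<pi> x") auto
    let ?\<pi>' = "\<tau> \<circ> \<pi>"
    have "{z \<in> ?S. ?\<pi>' z \<noteq> z} \<subset> {z \<in> ?S. \<pi> z \<noteq> z}"
    proof
      show "{z \<in> ?S. ?\<pi>' z \<noteq> z} \<subseteq> {z \<in> ?S. \<pi> z \<noteq> z}"
      proof
        fix z assume z: "z \<in> {z \<in> ?S. ?\<pi>' z \<noteq> z}"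
        have "\<pi> z \<noteq> z"
        proof
          assume eq: "\<pi> z = z"
          have "z \<noteq> x" "z \<noteq> \<pi> x"
            using z eq x inj_onD[OF less.prems(1), of z x] by auto
          thus False
            using z eq \<tau>(4)[of z] by simp
        qed
        thus "z \<in> {z \<in> ?S. \<pi> z \<noteq> z}"
          using z by simp
      qed
      show "{z \<in> ?S. ?\<pi>' z \<noteq> z} \<noteq> {z \<in> ?S. \<pi> z \<noteq> z}"
        using x \<tau>(3) by auto
    qed
    hence "card {z \<in> ?S. ?\<pi>' z \<noteq> z} < card {z \<in> ?S. \<pi> z \<noteq> z}"
      by (intro psubset_card_mono) (simp_all add: finite_R)
    moreover have "inj_on ?\<pi>' ?S"
      using less.prems(1) Aut_overD(10)[OF \<tau>(1)] by (simp add: inj_on_def)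
    moreover have "poly g (?\<pi>' z) = poly g z" if "z \<in> ?S" for z
      using \<tau>S[OF \<pi>S[OF that]] less.prems(2)[OF that] by simp
    ultimately obtain \<rho> where \<rho>: "\<rho> \<in> Aut_over F" "\<And>z. z \<in> ?S \<Longrightarrow> \<rho> z = ?\<pi>' z"
      using less.hyps[of ?\<pi>'] by blast
    have "\<tau> \<circ> \<rho> \<in> Aut_over F"
      by (rule Aut_over_comp[OF \<tau>(1) \<rho>(1)])
    moreover have "(\<tau> \<circ> \<rho>) z = \<pi> z" if "z \<in> ?S" for z
      using \<rho>(2)[OF that] \<tau>S[OF \<pi>S[OF that]] by simp
    ultimately show ?thesis
      by blast
  qed
qed

end

section \<open>Automorphisms of the ternary tree\<close>

definition T_level :: "nat \<Rightarrow> nat list set" where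
  "T_level n = {w \<in> T_vertices. length w = n}"

lemma T_level_0: "T_level 0 = {[]}"
  by (auto simp: T_level_def T_vertices_def)

lemma Cons_in_T_level: "a # w \<in> T_level (Suc n) \<longleftrightarrow> a < 3 \<and> w \<in> T_level n"
  by (auto simp: T_level_def T_vertices_def)

lemma T_level_SucE:
  assumes "v \<in> T_level (Suc n)"
  obtains a w where "v = a # w" "a < 3" "w \<in> T_level n"
  using assms by (cases v) (auto simp: T_level_def T_vertices_def)

lemma T_level_eq: "T_level n = {w. set w \<subseteq> {..<3} \<and> length w = n}"
  by (auto simp: T_level_def T_vertices_def)

lemma finite_T_level: "finite (T_level n)"
  unfolding T_level_eq by (rule finite_lists_length_eq) simp

lemma card_T_level: "card (T_level n) = 3 ^ n"
  unfolding T_level_eq by (subst card_lists_length_eq) simp_all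

lemma T_edges_iff: "(v, w) \<in> T_edges \<longleftrightarrow> v \<in> T_vertices \<and> (\<exists>a. v = a # w)"
  by (auto simp: T_edges_def)

lemma carrier_Aut_T:
  "u \<in> carrier Aut_T \<longleftrightarrow> u \<in> Bij T_vertices \<and> tree_iso T_vertices T_edges T_vertices T_edges u"
  by (simp add: Aut_T_def)

lemma mult_Aut_T:
  "u \<in> Bij T_vertices \<Longrightarrow> v \<in> Bij T_vertices \<Longrightarrow> u \<otimes>\<^bsub>Aut_T\<^esub> v = compose T_vertices u v"
  by (simp add: Aut_T_def BijGroup_def)

lemma Aut_T_vertices: "u \<in> carrier Aut_T \<Longrightarrow> w \<in> T_vertices \<Longrightarrow> u w \<in> T_vertices"
  by (auto simp: carrier_Aut_T Bij_def bij_betw_def)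

lemma Aut_T_Cons:
  assumes u: "u \<in> carrier Aut_T" and w: "a # w \<in> T_vertices"
  obtains a' where "u (a # w) = a' # u w"
proof -
  have wT: "w \<in> T_vertices"
    using w by (simp add: T_vertices_def)
  have "(a # w, w) \<in> T_edges"
    using w by (simp add: T_edges_iff)
  hence "(u (a # w), u w) \<in> T_edges"
    using u w wT by (simp add: carrier_Aut_T tree_iso_def)
  thus thesis
    using that by (auto simp: T_edges_iff)
qed

lemma Aut_T_Nil:
  assumes u: "u \<in> carrier Aut_T"
  shows "u [] = []"
proof (cases "u []")
  case (Cons a w)
  have nil: "[] \<in> T_vertices"
    by (simp add: T_vertices_def)
  have aw: "a # w \<in> T_vertices"
    using Aut_T_vertices[OF u nil] Cons by simp
  hence "w \<in> u ` T_vertices"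
    using u by (simp add: carrier_Aut_T Bij_def bij_betw_def T_vertices_def)
  then obtain v where v: "v \<in> T_vertices" "u v = w"
    by blast
  have "(u [], u v) \<in> T_edges"
    using aw Cons v(2) by (simp add: T_edges_iff)
  hence "([], v) \<in> T_edges"
    using u nil v(1) by (simp add: carrier_Aut_T tree_iso_def)
  thus ?thesis
    by (simp add: T_edges_iff)
qed

lemma Aut_T_level: "u \<in> carrier Aut_T \<Longrightarrow> w \<in> T_level n \<Longrightarrow> u w \<in> T_level n"
proof (induction n arbitrary: w)
  case 0
  thus ?case
    by (simp add: T_level_0 Aut_T_Nil)
next
  case (Suc n)
  from Suc.prems(2) obtain a v where w: "w = a # v" "a < 3" "v \<in> T_level n"
    by (rule T_level_SucE)
  have wT: "a # v \<in> T_vertices"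
    using Suc.prems(2) w(1) by (simp add: T_level_def)
  obtain a' where a': "u (a # v) = a' # u v"
    by (rule Aut_T_Cons[OF Suc.prems(1) wT])
  show ?case
    using Suc.IH[OF Suc.prems(1) w(3)] Aut_T_vertices[OF Suc.prems(1) wT] a' w(1)
    by (simp add: T_level_def)
qed

lemma bij_betw_Aut_T_level:
  assumes u: "u \<in> carrier Aut_T"
  shows "bij_betw u (T_level n) (T_level n)"
proof -
  have inj: "inj_on u (T_level n)"
    using u by (auto simp: carrier_Aut_T Bij_def bij_betw_def T_level_def inj_on_def)
  moreover have "u ` T_level n \<subseteq> T_level n"
    using Aut_T_level[OF u] by blast
  ultimately show ?thesis
    using endo_inj_surj[OF finite_T_level] by (auto simp: bij_betw_def)
qed

text \<open>Lengths are preserved, so bijectivity on each level gives bijectivity on the tree. Edges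
  need checking in one direction only: an edge between images comes from an edge because injectivity
  identifies the parent.\<close>

lemma Aut_TI:
  assumes "u \<in> extensional T_vertices" "\<And>n. bij_betw u (T_level n) (T_level n)"
    and "\<And>a w. a # w \<in> T_vertices \<Longrightarrow> \<exists>a'. u (a # w) = a' # u w"
  shows "u \<in> carrier Aut_T"
proof -
  have level: "u w \<in> T_level n" if "w \<in> T_level n" for w n
    using assms(2) that by (auto simp: bij_betw_def)
  have inT: "u w \<in> T_vertices" and len: "length (u w) = length w" if "w \<in> T_vertices" for w
    using level[of w "length w"] that by (simp_all add: T_level_def)
  have inj: "v = w" if "v \<in> T_vertices" "w \<in> T_vertices" "u v = u w" for v w
  proof -
    have "length v = length w"
      using len that by metis
    thus ?thesis
      using that assms(2)[of "length w"] by (auto simp: bij_betw_def inj_on_def T_level_def)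
  qed
  have surj: "\<exists>v\<in>T_vertices. u v = w" if "w \<in> T_vertices" for w
  proof -
    have "w \<in> u ` T_level (length w)"
      using assms(2)[of "length w"] that by (simp add: bij_betw_def T_level_def)
    thus ?thesis
      by (auto simp: T_level_def)
  qed
  have bij: "bij_betw u T_vertices T_vertices"
    using inj surj inT by (intro bij_betw_imageI inj_onI) (auto simp: image_iff, metis)
  have edge: "(v, w) \<in> T_edges \<longleftrightarrow> (u v, u w) \<in> T_edges" if vw: "v \<in> T_vertices" "w \<in> T_vertices" for v w
  proof
    assume "(v, w) \<in> T_edges"
    then obtain a where "v = a # w"
      by (auto simp: T_edges_iff)
    thus "(u v, u w) \<in> T_edges"
      using assms(3)[of a w] vw(1) inT[OF vw(1)] by (auto simp: T_edges_iff)
  next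
    assume "(u v, u w) \<in> T_edges"
    then obtain a' where a': "u v = a' # u w"
      by (auto simp: T_edges_iff)
    hence "v \<noteq> []"
      using len[OF vw(1)] by auto
    then obtain a v' where v: "v = a # v'"
      by (cases v) simp
    then obtain a'' where "u v = a'' # u v'"
      using assms(3)[of a v'] vw(1) by auto
    hence "v' = w"
      using a' inj[of v' w] vw v by (simp add: T_vertices_def)
    thus "(v, w) \<in> T_edges"
      using v vw by (simp add: T_edges_iff)
  qed
  show ?thesis
    unfolding carrier_Aut_T tree_iso_def Bij_def using bij edge assms(1) by simp
qed

section \<open>The generic fibre realises every tree automorphism\<close>

text \<open>The preimage tree without multiplicities: the letter prepended to a word selects a
  child. Injectivity is imposed on each level separately, matching the fibres.\<close>

definition tree_labelling :: "'a::field poly \<Rightarrow> 'a \<Rightarrow> (nat list \<Rightarrow> 'a) \<Rightarrow> bool" where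
  "tree_labelling g b x \<longleftrightarrow>
     (\<forall>n. bij_betw x (T_level n) {z. poly (iterate_poly g n) z = b}) \<and>
     (\<forall>a w. a # w \<in> T_vertices \<longrightarrow> poly g (x (a # w)) = x w)"

lemma tree_labelling_inj:
  assumes "tree_labelling g b x" "v \<in> T_level n" "w \<in> T_level n" "x v = x w"
  shows "v = w"
  using assms unfolding tree_labelling_def bij_betw_def inj_on_def by blast

lemma tree_labelling_mem:
  assumes "tree_labelling g b x" "w \<in> T_level n"
  shows "poly (iterate_poly g n) (x w) = b"
  using assms unfolding tree_labelling_def bij_betw_def by blast

lemma hgraph_Aut_over:
  assumes "\<tau> \<in> Aut_over F" "subfield E Kbar"
  shows "hgraph {(z, \<tau> z) | z. z \<in> E}"
  unfolding hgraph_def using subfield_closed[OF assms(2)] Aut_overD[OF assms(1)] by auto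

context wandering_cubic
begin

text \<open>If \<tau> realises \<open>u\<close> on level n, then on level n + 1 the inverse of
  \<tau> applied after \<open>u\<close> only permutes siblings. \<open>sibling_permutation\<close>
  realises this defect, and composing with it corrects \<tau>.\<close>

lemma tree_automorphism_on_level:
  assumes x: "tree_labelling g b x" and u: "u \<in> carrier Aut_T"
  shows "\<exists>\<tau>\<in>Aut_over F. \<forall>w\<in>T_level n. \<tau> (x w) = x (u w)"
proof (induction n)
  case 0
  show ?case
    using Aut_T_Nil[OF u] by (intro bexI[OF _ Aut_over_id]) (simp add: T_level_0)
next
  case (Suc n)
  then obtain \<tau> where \<tau>: "\<tau> \<in> Aut_over F" "\<And>w. w \<in> T_level n \<Longrightarrow> \<tau> (x w) = x (u w)"
    by blast
  let ?\<tau>' = "inv_into UNIV \<tau>"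
  have \<tau>': "?\<tau>' \<in> Aut_over F" "\<And>z. ?\<tau>' (\<tau> z) = z" "\<And>z. \<tau> (?\<tau>' z) = z"
    using Aut_over_inv[OF \<tau>(1)] Aut_overD(1)[OF \<tau>(1)] by (simp_all add: bij_def surj_f_inv_f)
  define y where "y = inv_into (T_level (Suc n)) x"
  have y: "y z \<in> T_level (Suc n)" "x (y z) = z" if "z \<in> R (Suc n)" for z
    using that x unfolding y_def tree_labelling_def bij_betw_def
    by (metis inv_into_into) (metis f_inv_into_f that tree_labelling_def x bij_betw_def)
  define \<pi> where "\<pi> z = ?\<tau>' (x (u (y z)))" for z
  have "inj_on \<pi> (R (Suc n))"
  proof (rule inj_onI)
    fix z z' assume z: "z \<in> R (Suc n)" "z' \<in> R (Suc n)" "\<pi> z = \<pi> z'"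
    hence "x (u (y z)) = x (u (y z'))"
      unfolding \<pi>_def using \<tau>'(3) by metis
    hence "u (y z) = u (y z')"
      using tree_labelling_inj[OF x Aut_T_level[OF u] Aut_T_level[OF u]] y(1) z(1,2) by blast
    hence "y z = y z'"
      using bij_betw_Aut_T_level[OF u, of "Suc n"] y(1) z(1,2) by (meson bij_betw_def inj_onD)
    thus "z = z'"
      using y(2) z(1,2) by metis
  qed
  moreover have "poly g (\<pi> z) = poly g z" if z: "z \<in> R (Suc n)" for z
  proof -
    obtain a w where w: "y z = a # w" "a < 3" "w \<in> T_level n"
      by (rule T_level_SucE[OF y(1)[OF z]])
    have wT: "a # w \<in> T_vertices"
      using y(1)[OF z] w(1) by (simp add: T_level_def)
    obtain a' where a': "u (a # w) = a' # u w"
      by (rule Aut_T_Cons[OF u wT])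
    have "poly g (\<pi> z) = ?\<tau>' (poly g (x (a' # u w)))"
      unfolding \<pi>_def w(1) a' by (rule Aut_R(1)[OF \<tau>'(1), symmetric])
    also have "poly g (x (a' # u w)) = x (u w)"
      using x Aut_T_vertices[OF u wT] a' unfolding tree_labelling_def by simp
    also have "x (u w) = \<tau> (x w)"
      using \<tau>(2)[OF w(3)] by simp
    also have "?\<tau>' (\<tau> (x w)) = poly g (x (a # w))"
      using x wT \<tau>'(2) unfolding tree_labelling_def by simp
    finally show ?thesis
      using y(2)[OF z] w(1) by simp
  qed
  ultimately obtain \<rho> where \<rho>: "\<rho> \<in> Aut_over F" "\<And>z. z \<in> R (Suc n) \<Longrightarrow> \<rho> z = \<pi> z"
    using sibling_permutation[of \<pi> n] by blast
  have "(\<tau> \<circ> \<rho>) (x w) = x (u w)" if w: "w \<in> T_level (Suc n)" for w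
  proof -
    have xw: "x w \<in> R (Suc n)"
      using tree_labelling_mem[OF x w] by simp
    have "y (x w) = w"
      using tree_labelling_inj[OF x y(1)[OF xw] w y(2)[OF xw]] .
    thus ?thesis
      using \<rho>(2)[OF xw] \<tau>'(3) by (simp add: \<pi>_def)
  qed
  thus ?case
    using Aut_over_comp[OF \<tau>(1) \<rho>(1)] by blast
qed

text \<open>A compactness argument: an automorphism realising \<open>u\<close> up to level n is
  determined on the field generated by these levels, so the restrictions form a chain of graphs,
  whose union extends to the closure.\<close>

theorem tree_automorphism_realised:
  assumes x: "tree_labelling g b x" and u: "u \<in> carrier Aut_T"
  shows "\<exists>\<tau>\<in>Aut_over F. \<forall>w\<in>T_vertices. \<tau> (x w) = x (u w)"
proof -
  obtain \<tau> where \<tau>: "\<And>n. \<tau> n \<in> Aut_over F" "\<And>n w. w \<in> T_level n \<Longrightarrow> \<tau> n (x w) = x (u w)"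
    using tree_automorphism_on_level[OF x u] by metis
  \<comment> \<open>Agreement on level n descends towards the root, because the automorphisms
    commute with \<open>g\<close> and every vertex has a child, for instance the one with letter
    0.\<close>
  have lower: "\<tau> n (x w) = x (u w)" if "w \<in> T_level m" "m \<le> n" for m n w
    using that
  proof (induction "n - m" arbitrary: m w)
    case 0
    thus ?case
      using \<tau>(2) by simp
  next
    case (Suc d)
    have w: "0 # w \<in> T_level (Suc m)"
      using Suc.prems(1) by (simp add: Cons_in_T_level)
    hence wT: "0 # w \<in> T_vertices"
      by (simp add: T_level_def)
    obtain a' where a': "u (0 # w) = a' # u w"
      by (rule Aut_T_Cons[OF u wT])
    have "\<tau> n (x (0 # w)) = x (u (0 # w))"
      using Suc.hyps(1)[OF _ w] Suc.hyps(2) Suc.prems(2) by simp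
    hence "poly g (\<tau> n (x (0 # w))) = x (u w)"
      using x a' Aut_T_vertices[OF u wT] unfolding tree_labelling_def by simp
    moreover have "poly g (x (0 # w)) = x w"
      using x wT unfolding tree_labelling_def by simp
    ultimately show ?case
      using Aut_R(1)[OF \<tau>(1), of n "x (0 # w)"] by simp
  qed
  define H where "H n = F \<union> x ` (\<Union>m\<le>n. T_level m)" for n
  define \<Gamma> where "\<Gamma> n = {(z, \<tau> n z) | z. z \<in> generate_field Kbar (H n)}" for n
  have \<Gamma>: "hgraph (\<Gamma> n)" for n
    unfolding \<Gamma>_def by (rule hgraph_Aut_over[OF \<tau>(1) subfield_generate_field])
  have mono: "\<Gamma> m \<subseteq> \<Gamma> n" if mn: "m \<le> n" for m n
  proof -
    have HH: "H m \<subseteq> H n"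
      unfolding H_def using mn by (intro Un_mono image_mono UN_mono) auto
    have "\<tau> m z = \<tau> n z" if z: "z \<in> generate_field Kbar (H m)" for z
    proof (rule Aut_over_agree[OF \<tau>(1) \<tau>(1) _ z])
      fix t assume "t \<in> H m"
      thus "\<tau> m t = \<tau> n t"
        using Aut_overD(4)[OF \<tau>(1)] lower mn by (fastforce simp: H_def)
    qed
    thus ?thesis
      unfolding \<Gamma>_def using generate_field_mono[OF HH] by blast
  qed
  have "hgraph (\<Union>(range \<Gamma>))"
  proof (rule hgraph_Union_chain)
    fix \<Delta> \<Delta>' assume "\<Delta> \<in> range \<Gamma>" "\<Delta>' \<in> range \<Gamma>"
    thus "\<Delta> \<subseteq> \<Delta>' \<or> \<Delta>' \<subseteq> \<Delta>"
      using mono by (metis imageE nat_le_linear)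
  qed (use \<Gamma> in auto)
  moreover have "(z, z) \<in> \<Union>(range \<Gamma>)" if "z \<in> F" for z
  proof -
    have "z \<in> generate_field Kbar (H 0)"
      using that generate_field_incl[of "H 0"] by (auto simp: H_def)
    hence "(z, \<tau> 0 z) \<in> \<Gamma> 0"
      by (auto simp: \<Gamma>_def)
    thus ?thesis
      using Aut_overD(4)[OF \<tau>(1) that] by auto
  qed
  ultimately obtain \<rho> where \<rho>: "\<rho> \<in> Aut_over F" "\<And>z y. (z, y) \<in> \<Union>(range \<Gamma>) \<Longrightarrow> \<rho> z = y"
    using Aut_over_extend[OF _ _ alg, of "\<Union>(range \<Gamma>)"] by blast
  have "\<rho> (x w) = x (u w)" if "w \<in> T_vertices" for w
  proof -
    let ?n = "length w"
    have w: "w \<in> T_level ?n"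
      using that by (simp add: T_level_def)
    hence "x w \<in> H ?n"
      by (auto simp: H_def)
    hence "x w \<in> generate_field Kbar (H ?n)"
      using generate_field_incl[of "H ?n"] by blast
    hence "(x w, \<tau> ?n (x w)) \<in> \<Gamma> ?n"
      by (auto simp: \<Gamma>_def)
    thus ?thesis
      using \<rho>(2) \<tau>(2)[OF w] by auto
  qed
  thus ?thesis
    using \<rho>(1) by blast
qed

end

section \<open>The arboreal representation\<close>

lemma generate_field_self:
  assumes "subfield K (Kbar :: 'a::field ring)" "\<beta> \<in> K"
  shows "generate_field Kbar (insert \<beta> K) = K"
  using generate_field_subset[OF assms(1), of "insert \<beta> K"] generate_field_incl[of "insert \<beta> K"] assms(2)
  by blast

lemma arboreal_rep_cong:
  assumes "bij_betw h (preimage_vertices f \<beta>) T_vertices"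
    and "\<And>i z. poly (iterate_poly f i) z = \<beta> \<Longrightarrow> g z = g' z"
  shows "arboreal_rep f \<beta> h g = arboreal_rep f \<beta> h g'"
  unfolding arboreal_rep_def
proof (rule restrict_ext)
  fix w assume "w \<in> T_vertices"
  hence "inv_into (preimage_vertices f \<beta>) h w \<in> preimage_vertices f \<beta>"
    using assms(1) by (auto simp: bij_betw_def intro: inv_into_into)
  moreover obtain i z j where v: "inv_into (preimage_vertices f \<beta>) h w = (i, z, j)"
    by (metis surj_pair)
  ultimately have "Polynomial.order z (iterate_poly f i - [:\<beta>:]) \<noteq> 0"
    by (auto simp: preimage_vertices_def)
  hence "poly (iterate_poly f i - [:\<beta>:]) z = 0"
    using order_root by blast
  hence "g z = g' z"
    using assms(2)[of i z] by simp
  thus "(case inv_into (preimage_vertices f \<beta>) h w of (i, z, j) \<Rightarrow> h (i, g z, j)) =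
        (case inv_into (preimage_vertices f \<beta>) h w of (i, z, j) \<Rightarrow> h (i, g' z, j))"
    by (simp add: v)
qed

text \<open>Restriction from automorphisms of the closure to the Galois group of the union of the
  preimage fields is onto, and the action on the tree sees only that union. From here on
  \<open>Aut_over K\<close> replaces the Galois group.\<close>

lemma image_arboreal_rep:
  fixes f :: "'a::alg_closed_field poly"
  assumes K: "subfield K (Kbar :: 'a ring)" and f: "\<forall>i. poly.coeff f i \<in> K" "Polynomial.degree f = 3"
    and \<beta>: "\<beta> \<in> K" and alg: "\<And>x. alg_over K x"
    and bij: "bij_betw h (preimage_vertices f \<beta>) T_vertices"
  shows "arboreal_rep f \<beta> h ` carrier (G_infinity K f \<beta>) = arboreal_rep f \<beta> h ` Aut_over K"
proof -
  define R where "R n = {x. poly (iterate_poly f n) x = \<beta>}" for n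
  define L where "L n = generate_field Kbar (K \<union> R n)" for n
  define LL where "LL = (\<Union>n. L n)"
  have pre: "preimage_field K f \<beta> n = L n" for n
    unfolding preimage_field_def L_def R_def generate_field_self[OF K \<beta>] ..
  have carrier: "carrier (G_infinity K f \<beta>) =
      {g \<in> Bij LL. g \<in> ring_hom (Kbar\<lparr>carrier := LL\<rparr>) (Kbar\<lparr>carrier := LL\<rparr>) \<and> (\<forall>x\<in>K. g x = x)}"
    unfolding G_infinity_def galois_group_def pre generate_field_self[OF K \<beta>] LL_def by simp
  have sub: "subfield (L n) Kbar" for n
    unfolding L_def by (rule subfield_generate_field)
  have incl: "K \<subseteq> L n" "R n \<subseteq> L n" for n
    using generate_field_incl[of "K \<union> R n"] by (auto simp: L_def)
  \<comment> \<open>Each z in \<open>R n\<close> is f(y) with y in \<open>R (Suc n)\<close>, so the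
    preimage fields increase and their union is closed under the field operations.\<close>
  have "L n \<subseteq> L (Suc n)" for n
    unfolding L_def[of n]
  proof (rule generate_field_subset[OF sub], rule Un_least[OF incl(1)], rule subsetI)
    fix z assume z: "z \<in> R n"
    have "Polynomial.degree (f - [:z:]) = 3"
      using f(2) degree_add_eq_left[of "- [:z:]" f] by (subst diff_conv_add_uminus) simp
    then obtain y where y: "poly (f - [:z:]) y = 0"
      using alg_closed_imp_poly_has_root[of "f - [:z:]"] by auto
    hence "y \<in> R (Suc n)"
      using z by (simp add: R_def iterate_poly_Suc poly_pcompose)
    hence "y \<in> L (Suc n)"
      using incl(2) by blast
    hence "poly f y \<in> L (Suc n)"
      using poly_in_subfield[OF sub, of f "Suc n" y] f(1) incl(1) by blast
    thus "z \<in> L (Suc n)"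
      using y by simp
  qed
  hence mono: "L m \<subseteq> L n" if "m \<le> n" for m n
    using that by (rule lift_Suc_mono_le)
  have both: "\<exists>n. x \<in> L n \<and> y \<in> L n" if xy: "x \<in> LL" "y \<in> LL" for x y
  proof -
    obtain m n where "x \<in> L m" "y \<in> L n"
      using xy by (auto simp: LL_def)
    thus ?thesis
      using mono[of m "max m n"] mono[of n "max m n"] by (intro exI[of _ "max m n"]) auto
  qed
  have memLL: "z \<in> LL" if "z \<in> L n" for z n
    using that by (auto simp: LL_def)
  have closed2: "x - y \<in> LL \<and> x + y \<in> LL \<and> x * y \<in> LL" if xy: "x \<in> LL" "y \<in> LL" for x y
  proof -
    obtain n where n: "x \<in> L n" "y \<in> L n"
      using both[OF xy] by (elim exE conjE)
    show ?thesis
      by (intro conjI memLL[of _ n] subfield_closed[OF sub] n)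
  qed
  have closed: "1 \<in> LL" "0 \<in> LL" "\<And>x. x \<in> LL \<Longrightarrow> inverse x \<in> LL"
    using subfield_closed(1,2,7)[OF sub] unfolding LL_def by fast+
  have KLL: "K \<subseteq> LL" and RLL: "R n \<subseteq> LL" for n
    using incl(1)[of 0] incl(2)[of n] memLL by blast+
  have restr: "arboreal_rep f \<beta> h g = arboreal_rep f \<beta> h g'" if "\<And>z. z \<in> LL \<Longrightarrow> g z = g' z" for g g'
    by (rule arboreal_rep_cong[OF bij]) (use that RLL in \<open>auto simp: R_def\<close>)
  have stable: "\<tau> z \<in> LL" if \<tau>: "\<tau> \<in> Aut_over K" and z: "z \<in> LL" for \<tau> z
  proof -
    obtain n where n: "z \<in> L n"
      using z by (auto simp: LL_def)
    have "\<tau> x \<in> R n" if "x \<in> R n" for x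
      using that Aut_over_poly[OF \<tau> coeff_iterate_poly[OF K f(1), of n], of x] Aut_overD(4)[OF \<tau> \<beta>]
      by (simp add: R_def)
    hence "L n \<subseteq> {x. \<tau> x \<in> L n}"
      unfolding L_def[of n]
      by (intro generate_field_subsetI)
         (use subfield_closed[OF sub] incl Aut_overD[OF \<tau>] in \<open>auto simp: L_def[symmetric] subset_iff\<close>)
    thus ?thesis
      using n by (auto simp: LL_def)
  qed
  show ?thesis
  proof (intro equalityI image_subsetI)
    fix \<tau> assume \<tau>: "\<tau> \<in> Aut_over K"
    let ?g = "restrict \<tau> LL"
    have inv: "inv_into UNIV \<tau> \<in> Aut_over K" "\<And>z. \<tau> (inv_into UNIV \<tau> z) = z"
      using Aut_over_inv[OF \<tau>] Aut_overD(1)[OF \<tau>] by (simp_all add: bij_def surj_f_inv_f)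
    have "bij_betw ?g LL LL"
    proof (rule bij_betw_imageI)
      show "inj_on ?g LL"
        by (simp add: inj_on_def Aut_overD(10)[OF \<tau>])
      have "z \<in> \<tau> ` LL" if "z \<in> LL" for z
        using stable[OF inv(1) that] inv(2)[of z] by (metis image_eqI)
      thus "?g ` LL = LL"
        using stable[OF \<tau>] by auto
    qed
    moreover have "?g \<in> ring_hom (Kbar\<lparr>carrier := LL\<rparr>) (Kbar\<lparr>carrier := LL\<rparr>)"
      using closed closed2 stable[OF \<tau>] Aut_overD[OF \<tau>] by (simp add: ring_hom_def)
    moreover have "\<forall>x\<in>K. ?g x = x"
      using KLL Aut_overD(4)[OF \<tau>] by auto
    ultimately have "?g \<in> carrier (G_infinity K f \<beta>)"
      unfolding carrier by (simp add: Bij_def)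
    moreover have "arboreal_rep f \<beta> h \<tau> = arboreal_rep f \<beta> h ?g"
      by (rule restr) simp
    ultimately show "arboreal_rep f \<beta> h \<tau> \<in> arboreal_rep f \<beta> h ` carrier (G_infinity K f \<beta>)"
      by blast
  next
    fix g assume "g \<in> carrier (G_infinity K f \<beta>)"
    hence g: "bij_betw g LL LL" "g 1 = 1" "\<And>x y. x \<in> LL \<Longrightarrow> y \<in> LL \<Longrightarrow> g (x + y) = g x + g y"
      "\<And>x y. x \<in> LL \<Longrightarrow> y \<in> LL \<Longrightarrow> g (x * y) = g x * g y" "\<And>x. x \<in> K \<Longrightarrow> g x = x"
      unfolding carrier by (auto simp: Bij_def ring_hom_def)
    have g0: "g 0 = 0"
      using g(5) subfield_closed(1)[OF K] by blast
    have gd: "g (x - y) = g x - g y" if "x \<in> LL" "y \<in> LL" for x y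
      using g(3)[of "x - y" y] closed2[OF that] that(2) by simp
    have gi: "g (inverse x) = inverse (g x)" if x: "x \<in> LL" for x
    proof (cases "x = 0")
      case False
      hence "g x * g (inverse x) = 1"
        using g(4)[OF x closed(3)[OF x]] g(2) by simp
      thus ?thesis
        by (metis inverse_unique)
    qed (simp add: g0)
    define \<Gamma> where "\<Gamma> = {(z, g z) | z. z \<in> LL}"
    have "hgraph \<Gamma>"
      unfolding hgraph_def \<Gamma>_def using closed closed2 g(2,4) gd gi g0 by auto
    moreover have "(x, x) \<in> \<Gamma>" if "x \<in> K" for x
      using KLL that g(5)[OF that] by (auto simp: \<Gamma>_def)
    ultimately obtain \<tau> where \<tau>: "\<tau> \<in> Aut_over K" "\<And>x y. (x, y) \<in> \<Gamma> \<Longrightarrow> \<tau> x = y"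
      using Aut_over_extend[OF _ _ alg, of \<Gamma>] by blast
    have "arboreal_rep f \<beta> h g = arboreal_rep f \<beta> h \<tau>"
      by (rule restr) (use \<tau>(2) in \<open>auto simp: \<Gamma>_def\<close>)
    thus "arboreal_rep f \<beta> h g \<in> arboreal_rep f \<beta> h ` Aut_over K"
      using \<tau>(1) by blast
  qed
qed

text \<open>With unramified iterates all multiplicities are 1, so the third component of every
  vertex is 0 and the vertices on a level are just the points of the fibre. The isomorphism
  \<open>h\<close> stays arbitrary.\<close>

locale simple_tree =
  fixes K :: "'a::{alg_closed_field, field_char_0} set" and f :: "'a poly" and \<beta> :: 'a
    and h :: "nat \<times> 'a \<times> nat \<Rightarrow> nat list"
  assumes subfield_K: "subfield K (Kbar :: 'a ring)"
    and coeff_f: "\<forall>i. poly.coeff f i \<in> K" and degree_f: "Polynomial.degree f = 3"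
    and \<beta>: "\<beta> \<in> K" and alg: "\<And>z. alg_over K z"
    and iso: "tree_iso (preimage_vertices f \<beta>) (preimage_edges f \<beta>) T_vertices T_edges h"
    and simple: "\<And>n z. poly (iterate_poly f n) z = \<beta> \<Longrightarrow> poly (pderiv (iterate_poly f n)) z \<noteq> 0"
begin

abbreviation V :: "(nat \<times> 'a \<times> nat) set" where
  "V \<equiv> preimage_vertices f \<beta>"

definition label :: "nat list \<Rightarrow> 'a" where
  "label w = fst (snd (inv_into V h w))"

lemma in_V_iff: "(i, z, j) \<in> V \<longleftrightarrow> poly (iterate_poly f i) z = \<beta> \<and> j = 0"
proof -
  have nz: "iterate_poly f i - [:\<beta>:] \<noteq> 0"
    by (rule iterate_poly_diff_nonzero[OF degree_f])
  show ?thesis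
  proof (cases "poly (iterate_poly f i) z = \<beta>")
    case True
    thus ?thesis
      using order_simple_root[OF nz True simple[OF True]] by (simp add: preimage_vertices_def)
  next
    case False
    hence "Polynomial.order z (iterate_poly f i - [:\<beta>:]) = 0"
      by (intro order_0I) simp
    thus ?thesis
      using False by (simp add: preimage_vertices_def)
  qed
qed

lemma bij_h: "bij_betw h V T_vertices"
  using iso by (simp add: tree_iso_def)

lemma h_edge: "(u, v) \<in> preimage_edges f \<beta> \<longleftrightarrow> (h u, h v) \<in> T_edges" if "u \<in> V" "v \<in> V"
  using iso that by (simp add: tree_iso_def)

lemma h_Suc:
  assumes "(Suc i, z, 0) \<in> V"
  obtains a where "h (Suc i, z, 0) = a # h (i, poly f z, 0)" "(i, poly f z, 0) \<in> V"
proof -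
  have v: "(i, poly f z, 0) \<in> V"
    using assms by (simp add: in_V_iff iterate_poly_Suc poly_pcompose)
  have "((Suc i, z, 0), (i, poly f z, 0)) \<in> preimage_edges f \<beta>"
    using assms by (force simp: preimage_edges_def)
  hence "(h (Suc i, z, 0), h (i, poly f z, 0)) \<in> T_edges"
    using h_edge[OF assms v] by blast
  thus thesis
    using that v by (auto simp: T_edges_iff)
qed

lemma h_level: "(i, z, 0) \<in> V \<Longrightarrow> h (i, z, 0) \<in> T_level i"
proof (induction i arbitrary: z)
  case 0
  have hT: "h (0, z, 0) \<in> T_vertices"
    using bij_h 0 by (auto simp: bij_betw_def)
  have "h (0, z, 0) = []"
  proof (rule ccontr)
    assume "h (0, z, 0) \<noteq> []"
    then obtain a w where aw: "h (0, z, 0) = a # w"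
      by (cases "h (0, z, 0)") auto
    hence "w \<in> h ` V"
      using hT bij_h by (simp add: bij_betw_def T_vertices_def)
    then obtain v where v: "v \<in> V" "h v = w"
      by blast
    hence "(h (0, z, 0), h v) \<in> T_edges"
      using hT aw by (simp add: T_edges_iff)
    hence "((0, z, 0), v) \<in> preimage_edges f \<beta>"
      using h_edge[OF 0 v(1)] by blast
    thus False
      by (auto simp: preimage_edges_def)
  qed
  thus ?case
    by (simp add: T_level_0)
next
  case (Suc i)
  obtain a where a: "h (Suc i, z, 0) = a # h (i, poly f z, 0)" "(i, poly f z, 0) \<in> V"
    by (rule h_Suc[OF Suc.prems])
  have "h (Suc i, z, 0) \<in> T_vertices"
    using bij_h Suc.prems by (auto simp: bij_betw_def)
  thus ?case
    using a(1) Suc.IH[OF a(2)] by (simp add: T_level_def)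
qed

lemma label_h: "(i, z, 0) \<in> V \<Longrightarrow> label (h (i, z, 0)) = z"
  using bij_h by (simp add: label_def bij_betw_def)

lemma inv_h:
  assumes "w \<in> T_level n"
  shows "inv_into V h w = (n, label w, 0)" "(n, label w, 0) \<in> V" "h (n, label w, 0) = w"
proof -
  have w: "w \<in> h ` V"
    using assms bij_h by (simp add: bij_betw_def T_level_def)
  obtain i z j where v: "inv_into V h w = (i, z, j)"
    by (metis surj_pair)
  have "(i, z, j) \<in> V" "h (i, z, j) = w"
    using inv_into_into[OF w] f_inv_into_f[OF w] v by simp_all
  moreover from this(1) have j: "j = 0"
    by (simp add: in_V_iff)
  ultimately have "i = n"
    using h_level[of i z] assms by (simp add: T_level_def)
  moreover have "label w = z"
    by (simp add: label_def v)
  ultimately show "inv_into V h w = (n, label w, 0)" "(n, label w, 0) \<in> V" "h (n, label w, 0) = w"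
    using v j \<open>(i, z, j) \<in> V\<close> \<open>h (i, z, j) = w\<close> by simp_all
qed

lemma labelling: "tree_labelling f \<beta> label"
  unfolding tree_labelling_def
proof (intro conjI allI impI)
  fix n
  show "bij_betw label (T_level n) {z. poly (iterate_poly f n) z = \<beta>}"
  proof (rule bij_betw_imageI)
    show "inj_on label (T_level n)"
      by (rule inj_onI) (metis inv_h(3))
    show "label ` T_level n = {z. poly (iterate_poly f n) z = \<beta>}"
    proof (intro equalityI subsetI)
      fix z assume "z \<in> label ` T_level n"
      thus "z \<in> {z. poly (iterate_poly f n) z = \<beta>}"
        using inv_h(2) by (auto simp: in_V_iff)
    next
      fix z assume "z \<in> {z. poly (iterate_poly f n) z = \<beta>}"
      hence "(n, z, 0) \<in> V"
        by (simp add: in_V_iff)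
      thus "z \<in> label ` T_level n"
        using label_h[of n z] h_level[of n z] by (metis image_eqI)
    qed
  qed
next
  fix a w assume aw: "a # w \<in> T_vertices"
  hence w: "a # w \<in> T_level (Suc (length w))"
    by (simp add: T_level_def)
  note v = inv_h[OF w]
  obtain a' where a': "h (Suc (length w), label (a # w), 0) = a' # h (length w, poly f (label (a # w)), 0)"
    "(length w, poly f (label (a # w)), 0) \<in> V"
    by (rule h_Suc[OF v(2)])
  hence "h (length w, poly f (label (a # w)), 0) = w"
    using v(3) by (metis list.inject)
  thus "poly f (label (a # w)) = label w"
    using label_h[OF a'(2)] by simp
qed

lemma Aut_R_f:
  assumes "\<tau> \<in> Aut_over K" "poly (iterate_poly f n) z = \<beta>"
  shows "poly (iterate_poly f n) (\<tau> z) = \<beta>"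
  using Aut_over_poly[OF assms(1) coeff_iterate_poly[OF subfield_K coeff_f, of n], of z]
    Aut_overD(4)[OF assms(1) \<beta>] assms(2) by simp

lemma rep_level:
  assumes "\<tau> \<in> Aut_over K" "w \<in> T_level n"
  shows "arboreal_rep f \<beta> h \<tau> w \<in> T_level n" "label (arboreal_rep f \<beta> h \<tau> w) = \<tau> (label w)"
proof -
  have w: "w \<in> T_vertices"
    using assms(2) by (simp add: T_level_def)
  have v: "(n, \<tau> (label w), 0) \<in> V"
    using inv_h(2)[OF assms(2)] Aut_R_f[OF assms(1)] by (simp add: in_V_iff)
  have "arboreal_rep f \<beta> h \<tau> w = h (n, \<tau> (label w), 0)"
    using w by (simp add: arboreal_rep_def inv_h(1)[OF assms(2)])
  thus "arboreal_rep f \<beta> h \<tau> w \<in> T_level n" "label (arboreal_rep f \<beta> h \<tau> w) = \<tau> (label w)"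
    using h_level[OF v] label_h[OF v] by simp_all
qed

lemma rep_in_Aut_T:
  assumes \<tau>: "\<tau> \<in> Aut_over K"
  shows "arboreal_rep f \<beta> h \<tau> \<in> carrier Aut_T"
proof (rule Aut_TI)
  let ?r = "arboreal_rep f \<beta> h \<tau>"
  show "?r \<in> extensional T_vertices"
    by (simp add: arboreal_rep_def)
  show "bij_betw ?r (T_level n) (T_level n)" for n
  proof -
    have "inj_on ?r (T_level n)"
    proof (rule inj_onI)
      fix v w assume vw: "v \<in> T_level n" "w \<in> T_level n" "?r v = ?r w"
      hence "\<tau> (label v) = \<tau> (label w)"
        using rep_level(2)[OF \<tau>] by metis
      thus "v = w"
        using tree_labelling_inj[OF labelling vw(1,2)] Aut_overD(10)[OF \<tau>] by simp
    qed
    moreover have "?r ` T_level n \<subseteq> T_level n"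
      using rep_level(1)[OF \<tau>] by blast
    ultimately show ?thesis
      using endo_inj_surj[OF finite_T_level] by (auto simp: bij_betw_def)
  qed
  fix a w assume "a # w \<in> T_vertices"
  define n where "n = length w"
  have aw: "a # w \<in> T_level (Suc n)" "w \<in> T_level n"
    using \<open>a # w \<in> T_vertices\<close> by (simp_all add: T_level_def T_vertices_def n_def)
  obtain a' v where v: "?r (a # w) = a' # v" "v \<in> T_level n"
    using T_level_SucE[OF rep_level(1)[OF \<tau> aw(1)]] by metis
  have "label v = poly f (label (a' # v))"
    using labelling rep_level(1)[OF \<tau> aw(1)] v(1) by (simp add: tree_labelling_def T_level_def)
  also have "\<dots> = poly f (\<tau> (label (a # w)))"
    using rep_level(2)[OF \<tau> aw(1)] v(1) by simp
  also have "\<dots> = \<tau> (poly f (label (a # w)))"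
    by (rule Aut_over_poly[OF \<tau> coeff_f, symmetric])
  also have "\<dots> = label (?r w)"
    using labelling \<open>a # w \<in> T_vertices\<close> rep_level(2)[OF \<tau> aw(2)] by (simp add: tree_labelling_def)
  finally have "v = ?r w"
    by (rule tree_labelling_inj[OF labelling v(2) rep_level(1)[OF \<tau> aw(2)]])
  thus "\<exists>a'. ?r (a # w) = a' # ?r w"
    using v(1) by blast
qed

text \<open>Translating to labels turns multiplication by the image of an automorphism into applying
  that automorphism. Cosets can then be compared by exhibiting a field automorphism, without
  subgroup arguments.\<close>

lemma r_coset_rep:
  assumes a: "a \<in> carrier Aut_T"
  shows "(arboreal_rep f \<beta> h ` Aut_over K) #>\<^bsub>Aut_T\<^esub> a =
    {v \<in> extensional T_vertices. (\<forall>n. \<forall>w\<in>T_level n. v w \<in> T_level n) \<and>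
       (\<exists>\<tau>\<in>Aut_over K. \<forall>w\<in>T_vertices. label (v w) = \<tau> (label (a w)))}" (is "?L = ?R")
proof -
  let ?rep = "arboreal_rep f \<beta> h"
  have mult: "?rep \<tau> \<otimes>\<^bsub>Aut_T\<^esub> a = compose T_vertices (?rep \<tau>) a" if "\<tau> \<in> Aut_over K" for \<tau>
    using rep_in_Aut_T[OF that] a by (intro mult_Aut_T) (simp_all add: carrier_Aut_T)
  have L: "v \<in> ?L \<longleftrightarrow> (\<exists>\<tau>\<in>Aut_over K. v = compose T_vertices (?rep \<tau>) a)" for v
    unfolding r_coset_def using mult by auto
  show ?thesis
  proof (intro equalityI subsetI)
    fix v assume "v \<in> ?L"
    then obtain \<tau> where \<tau>: "\<tau> \<in> Aut_over K" "v = compose T_vertices (?rep \<tau>) a"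
      using L by blast
    have val: "v w \<in> T_level n \<and> label (v w) = \<tau> (label (a w))" if w: "w \<in> T_level n" for w n
      using rep_level[OF \<tau>(1) Aut_T_level[OF a w]] w by (simp add: \<tau>(2) compose_def T_level_def)
    have "v \<in> extensional T_vertices"
      by (simp add: \<tau>(2) compose_def)
    moreover have "\<forall>w\<in>T_vertices. label (v w) = \<tau> (label (a w))"
      using val by (simp add: T_level_def)
    ultimately show "v \<in> ?R"
      using val \<tau>(1) by blast
  next
    fix v assume "v \<in> ?R"
    then obtain \<tau> where \<tau>: "\<tau> \<in> Aut_over K" "\<And>w. w \<in> T_vertices \<Longrightarrow> label (v w) = \<tau> (label (a w))"
      and v: "v \<in> extensional T_vertices" "\<And>n w. w \<in> T_level n \<Longrightarrow> v w \<in> T_level n"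
      by blast
    have "v = compose T_vertices (?rep \<tau>) a"
    proof (rule extensionalityI[OF v(1)])
      fix w assume w: "w \<in> T_vertices"
      hence wl: "w \<in> T_level (length w)"
        by (simp add: T_level_def)
      have "label (v w) = label (?rep \<tau> (a w))"
        using \<tau>(2)[OF w] rep_level(2)[OF \<tau>(1) Aut_T_level[OF a wl]] by simp
      hence "v w = ?rep \<tau> (a w)"
        by (rule tree_labelling_inj[OF labelling v(2)[OF wl] rep_level(1)[OF \<tau>(1) Aut_T_level[OF a wl]]])
      thus "v w = compose T_vertices (?rep \<tau>) a w"
        using w by (simp add: compose_def)
    qed (simp add: compose_def)
    thus "v \<in> ?L"
      using L \<tau>(1) by blast
  qed
qed

lemma in_r_coset_self:
  assumes "a \<in> carrier Aut_T"
  shows "a \<in> (arboreal_rep f \<beta> h ` Aut_over K) #>\<^bsub>Aut_T\<^esub> a"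
  unfolding r_coset_rep[OF assms] using assms Aut_T_level[OF assms] Aut_over_id[of K]
  by (auto simp: carrier_Aut_T Bij_def)

lemma r_coset_eqI:
  assumes a: "a \<in> carrier Aut_T" "b \<in> carrier Aut_T" and \<tau>: "\<tau> \<in> Aut_over K"
    and eq: "\<And>w. w \<in> T_vertices \<Longrightarrow> label (a w) = \<tau> (label (b w))"
  shows "(arboreal_rep f \<beta> h ` Aut_over K) #>\<^bsub>Aut_T\<^esub> a = (arboreal_rep f \<beta> h ` Aut_over K) #>\<^bsub>Aut_T\<^esub> b"
proof -
  have inv: "inv_into UNIV \<tau> \<in> Aut_over K" "\<And>z. inv_into UNIV \<tau> (\<tau> z) = z"
    using Aut_over_inv[OF \<tau>] Aut_overD(1)[OF \<tau>] by (simp_all add: bij_def)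
  have "(\<exists>\<rho>\<in>Aut_over K. \<forall>w\<in>T_vertices. label (v w) = \<rho> (label (a w))) \<longleftrightarrow>
        (\<exists>\<rho>\<in>Aut_over K. \<forall>w\<in>T_vertices. label (v w) = \<rho> (label (b w)))" for v
  proof
    assume "\<exists>\<rho>\<in>Aut_over K. \<forall>w\<in>T_vertices. label (v w) = \<rho> (label (a w))"
    then obtain \<rho> where \<rho>: "\<rho> \<in> Aut_over K" "\<forall>w\<in>T_vertices. label (v w) = \<rho> (label (a w))"
      by blast
    thus "\<exists>\<rho>\<in>Aut_over K. \<forall>w\<in>T_vertices. label (v w) = \<rho> (label (b w))"
      by (intro bexI[OF _ Aut_over_comp[OF \<rho>(1) \<tau>]]) (simp add: eq)
  next
    assume "\<exists>\<rho>\<in>Aut_over K. \<forall>w\<in>T_vertices. label (v w) = \<rho> (label (b w))"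
    then obtain \<rho> where \<rho>: "\<rho> \<in> Aut_over K" "\<forall>w\<in>T_vertices. label (v w) = \<rho> (label (b w))"
      by blast
    thus "\<exists>\<rho>\<in>Aut_over K. \<forall>w\<in>T_vertices. label (v w) = \<rho> (label (a w))"
      by (intro bexI[OF _ Aut_over_comp[OF \<rho>(1) inv(1)]]) (simp add: eq inv(2))
  qed
  thus ?thesis
    unfolding r_coset_rep[OF a(1)] r_coset_rep[OF a(2)] by simp
qed

end

section \<open>Level signs and infinite index\<close>

text \<open>One independent sign per level: the children 0 and 1 of all 3^m vertices on level m are
  exchanged together.\<close>

fun swap_at :: "nat \<Rightarrow> nat list \<Rightarrow> nat list" where
  "swap_at m [] = []"
| "swap_at m (a # w) = (if length w = m then (if a = 0 then 1 else if a = 1 then 0 else a) else a) # swap_at m w"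

definition swap_aut :: "nat \<Rightarrow> nat list \<Rightarrow> nat list" where
  "swap_aut m = restrict (swap_at m) T_vertices"

lemma length_swap_at [simp]: "length (swap_at m w) = length w"
  by (induction w) auto

lemma swap_at_T_level: "w \<in> T_level n \<Longrightarrow> swap_at m w \<in> T_level n"
proof (induction n arbitrary: w)
  case (Suc n)
  from Suc.prems obtain a v where "w = a # v" "a < 3" "v \<in> T_level n"
    by (rule T_level_SucE)
  thus ?case
    using Suc.IH[of v] by (auto simp: Cons_in_T_level)
qed (simp add: T_level_0)

lemma swap_at_swap_at [simp]: "swap_at m (swap_at m w) = w"
  by (induction w) auto

lemma swap_aut_level: "w \<in> T_level n \<Longrightarrow> swap_aut m w = swap_at m w"
  by (simp add: swap_aut_def T_level_def)

lemma bij_betw_swap_at: "bij_betw (swap_at m) (T_level n) (T_level n)"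
  by (rule bij_betw_byWitness[where f' = "swap_at m"]) (auto intro: swap_at_T_level)

lemma swap_aut_in_Aut_T: "swap_aut m \<in> carrier Aut_T"
proof (rule Aut_TI)
  show "swap_aut m \<in> extensional T_vertices"
    by (simp add: swap_aut_def)
  show "bij_betw (swap_aut m) (T_level n) (T_level n)" for n
    using bij_betw_swap_at[of m n] swap_aut_level[of _ n m] by (subst bij_betw_cong) auto
  show "\<exists>a'. swap_aut m (a # w) = a' # swap_aut m w" if "a # w \<in> T_vertices" for a w
    using that by (simp add: swap_aut_def T_vertices_def)
qed

lemma inj_swap_aut: "inj swap_aut"
proof -
  have *: "swap_aut m \<noteq> swap_aut n" if "m < n" for m n
  proof
    assume eq: "swap_aut m = swap_aut n"
    have w: "replicate (Suc m) 0 \<in> T_level (Suc m)"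
      by (auto simp: T_level_def T_vertices_def)
    have fixed: "swap_at n v = v" if "length v \<le> n" for v
      using that by (induction v) auto
    have "swap_at m (replicate (Suc m) 0) = swap_at n (replicate (Suc m) 0)"
      using swap_aut_level[OF w] eq by metis
    also have "\<dots> = replicate (Suc m) 0"
      by (rule fixed) (use that in simp)
    finally show False
      by simp
  qed
  show ?thesis
  proof (rule injI)
    fix m n assume "swap_aut m = swap_aut n"
    thus "m = n"
      using *[of m n] *[of n m] by (metis linorder_neqE_nat)
  qed
qed

lemma id_in_Aut_T: "(\<lambda>w\<in>T_vertices. w) \<in> carrier Aut_T"
proof (rule Aut_TI)
  show "bij_betw (\<lambda>w\<in>T_vertices. w) (T_level n) (T_level n)" for n
    by (rule bij_betw_imageI) (auto simp: inj_on_def T_level_def)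
  show "\<exists>a'. (\<lambda>w\<in>T_vertices. w) (a # w) = a' # (\<lambda>w\<in>T_vertices. w) w" if "a # w \<in> T_vertices" for a w
    using that by (simp add: T_vertices_def)
qed simp

section \<open>Discriminants of cubic fibres\<close>

lemma prod_linear_dvd:
  fixes p :: "'a::field poly"
  assumes "finite A" "\<And>y. y \<in> A \<Longrightarrow> poly p y = 0"
  shows "(\<Prod>y\<in>A. [:- y, 1:]) dvd p"
  using assms
proof (induction A rule: finite_induct)
  case (insert y A)
  then obtain q where q: "p = (\<Prod>y\<in>A. [:- y, 1:]) * q"
    by auto
  have "poly (\<Prod>y\<in>A. [:- y, 1:]) y \<noteq> 0"
    using insert.hyps by (auto simp: poly_prod)
  hence "poly q y = 0"
    using insert.prems[of y] q by simp
  then obtain r where "q = [:- y, 1:] * r"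
    by (auto simp: poly_eq_0_iff_dvd)
  hence "p = (\<Prod>y\<in>insert y A. [:- y, 1:]) * r"
    using insert.hyps by (simp add: q algebra_simps del: mult_pCons_left mult_pCons_right)
  thus ?case
    by simp
qed simp

lemma simple_fibre_factorization:
  fixes Q :: "'a::field poly"
  assumes "Polynomial.degree Q > 0" "card {x. poly Q x = b} = Polynomial.degree Q"
  shows "Q - [:b:] = Polynomial.smult (Polynomial.lead_coeff Q) (\<Prod>y | poly Q y = b. [:- y, 1:])"
proof -
  let ?A = "{x. poly Q x = b}" and ?P = "\<Prod>y | poly Q y = b. [:- y, 1:]"
  have nz: "Q - [:b:] \<noteq> 0"
    using assms(1) by (metis degree_pCons_0 eq_iff_diff_eq_0 less_irrefl)
  have fin: "finite ?A"
    using assms by (metis card_gt_0_iff)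
  have deg: "Polynomial.degree (Q - [:b:]) = Polynomial.degree Q"
    using assms(1) degree_add_eq_left[of "- [:b:]" Q] by (subst diff_conv_add_uminus) simp
  obtain q where q: "Q - [:b:] = ?P * q"
    using prod_linear_dvd[OF fin, of "Q - [:b:]"] by auto
  have P: "Polynomial.degree ?P = card ?A" "Polynomial.lead_coeff ?P = 1"
    by (simp add: degree_prod_eq_sum_degree) (subst Polynomial.lead_coeff_prod, simp)
  have "q \<noteq> 0" "?P \<noteq> 0"
    using nz q by auto
  hence "Polynomial.degree q = 0"
    using q deg assms(2) P(1) by (metis add_cancel_left_right degree_mult_eq)
  then obtain c where c: "q = [:c:]"
    using degree_eq_zeroE by blast
  have "Polynomial.lead_coeff (Q - [:b:]) = Polynomial.lead_coeff Q"
    unfolding deg using assms(1) by (simp add: coeff_pCons split: nat.split)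
  moreover have "Polynomial.lead_coeff (Q - [:b:]) = c"
    unfolding q using P(2) by (simp only: Polynomial.lead_coeff_mult) (simp add: c)
  ultimately show ?thesis
    using q c by (simp add: mult.commute)
qed

text \<open>With c the leading coefficient, (y_i - y_j)(y_i - y_k) = f'(y_i)/c = 3 (y_i -
  \<gamma>1)(y_i - \<gamma>2). Multiplying over the three roots regroups into the values of f - v at
  the critical points; 27 is 3^3, and the sign comes from reversing three differences.\<close>

lemma cubic_discriminant:
  fixes f :: "'a::field_char_0 poly"
  assumes f: "Polynomial.degree f = 3" "pderiv f = Polynomial.smult d ([:- \<gamma>1, 1:] * [:- \<gamma>2, 1:])"
    and y: "poly f y0 = v" "poly f y1 = v" "poly f y2 = v" "y0 \<noteq> y1" "y1 \<noteq> y2" "y0 \<noteq> y2"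
  shows "((y0 - y1) * (y1 - y2) * (y0 - y2)) ^ 2 =
    - 27 / Polynomial.lead_coeff f ^ 2 * ((v - poly f \<gamma>1) * (v - poly f \<gamma>2))"
proof -
  let ?A = "{x. poly f x = v}"
  define c where "c = Polynomial.lead_coeff f"
  have "f \<noteq> 0"
    using f(1) by auto
  hence c0: "c \<noteq> 0"
    by (simp add: c_def)
  have nz: "f - [:v:] \<noteq> 0"
    using f(1) by (metis degree_pCons_0 eq_iff_diff_eq_0 zero_neq_numeral)
  have deg: "Polynomial.degree (f - [:v:]) = 3"
    using f(1) degree_add_eq_left[of "- [:v:]" f] by (subst diff_conv_add_uminus) simp
  have fin: "finite ?A"
    using poly_roots_finite[OF nz] by simp
  have "card ?A \<le> 3"
    using card_poly_roots_bound[OF nz] deg by simp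
  hence A: "{y0, y1, y2} = ?A"
    by (intro card_seteq[OF fin]) (use y in auto)
  moreover have "card {y0, y1, y2} = 3"
    using y(4-6) by simp
  ultimately have "card ?A = Polynomial.degree f"
    using f(1) by simp
  hence "f - [:v:] = Polynomial.smult c (\<Prod>y\<in>{y0, y1, y2}. [:- y, 1:])"
    unfolding c_def A using f(1) by (intro simple_fibre_factorization) simp_all
  also have "(\<Prod>y\<in>{y0, y1, y2}. [:- y, 1:]) = [:- y0, 1:] * ([:- y1, 1:] * [:- y2, 1:])"
    using y(4-6) by simp
  finally have fac: "f - [:v:] = Polynomial.smult c ([:- y0, 1:] * ([:- y1, 1:] * [:- y2, 1:]))" .
  have val: "poly f s - v = c * ((s - y0) * (s - y1) * (s - y2))" for s
    using arg_cong[OF fac, of "\<lambda>p. poly p s"] by (simp add: algebra_simps)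
  have "pderiv f = pderiv (f - [:v:])"
    by (simp add: pderiv_diff pderiv_pCons)
  hence der: "poly (pderiv f) s = c * ((s - y1) * (s - y2) + (s - y0) * (s - y2) + (s - y0) * (s - y1))" for s
    by (simp add: fac pderiv_smult pderiv_mult pderiv_pCons algebra_simps)
  have "poly.coeff (pderiv f) 2 = 3 * c"
    using f(1) by (simp add: coeff_pderiv c_def numeral_3_eq_3 numeral_2_eq_2)
  moreover have "poly.coeff (pderiv f) 2 = d"
    unfolding f(2) by (simp add: numeral_2_eq_2)
  ultimately have d: "d = 3 * c"
    by simp
  have der': "poly (pderiv f) s = 3 * c * ((s - \<gamma>1) * (s - \<gamma>2))" for s
    unfolding f(2) d by (simp add: algebra_simps)
  have e: "(y0 - y1) * (y0 - y2) = 3 * ((y0 - \<gamma>1) * (y0 - \<gamma>2))"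
    "(y1 - y0) * (y1 - y2) = 3 * ((y1 - \<gamma>1) * (y1 - \<gamma>2))"
    "(y2 - y0) * (y2 - y1) = 3 * ((y2 - \<gamma>1) * (y2 - \<gamma>2))"
    using der[of y0] der'[of y0] der[of y1] der'[of y1] der[of y2] der'[of y2] c0 by simp_all
  have "((y0 - y1) * (y1 - y2) * (y0 - y2)) ^ 2 =
      - (((y0 - y1) * (y0 - y2)) * ((y1 - y0) * (y1 - y2)) * ((y2 - y0) * (y2 - y1)))"
    by (simp add: power2_eq_square algebra_simps)
  also have "\<dots> = - 27 * (((\<gamma>1 - y0) * (\<gamma>1 - y1) * (\<gamma>1 - y2)) * ((\<gamma>2 - y0) * (\<gamma>2 - y1) * (\<gamma>2 - y2)))"
    unfolding e by (simp add: algebra_simps)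
  also have "\<dots> = - 27 * (((poly f \<gamma>1 - v) / c) * ((poly f \<gamma>2 - v) / c))"
    unfolding val using c0 by simp
  also have "\<dots> = - 27 / c ^ 2 * ((v - poly f \<gamma>1) * (v - poly f \<gamma>2))"
    using c0 by (simp add: power2_eq_square divide_simps) (simp add: algebra_simps)
  finally show ?thesis
    unfolding c_def .
qed

section \<open>Square roots of the level discriminants\<close>

context simple_tree
begin

text \<open>A square root of the product, over level n, of the discriminants of the sibling triples;
  \<open>u\<close> fixes the order within each triple, so changing \<open>u\<close> by a tree
  automorphism can change only the sign. Comparing siblings alone makes the square computable from
  \<open>cubic_discriminant\<close>.\<close>

definition vandermonde :: "(nat list \<Rightarrow> nat list) \<Rightarrow> nat \<Rightarrow> 'a" where
  "vandermonde u n = (\<Prod>w\<in>T_level n. (label (u (0 # w)) - label (u (1 # w))) *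
     (label (u (1 # w)) - label (u (2 # w))) * (label (u (0 # w)) - label (u (2 # w))))"

abbreviation vandermonde0 :: "nat \<Rightarrow> 'a" where
  "vandermonde0 \<equiv> vandermonde (\<lambda>w\<in>T_vertices. w)"

lemma children_distinct:
  assumes u: "u \<in> carrier Aut_T" and w: "w \<in> T_level n"
  shows "label (u (0 # w)) \<noteq> label (u (1 # w))" "label (u (1 # w)) \<noteq> label (u (2 # w))" "label (u (0 # w)) \<noteq> label (u (2 # w))"
proof -
  have c: "a # w \<in> T_level (Suc n)" if "a < 3" for a
    using that w by (simp add: Cons_in_T_level)
  have "label (u (a # w)) \<noteq> label (u (a' # w))" if "a < 3" "a' < 3" "a \<noteq> a'" for a a'
  proof
    assume "label (u (a # w)) = label (u (a' # w))"
    hence "u (a # w) = u (a' # w)"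
      by (rule tree_labelling_inj[OF labelling Aut_T_level[OF u c[OF that(1)]] Aut_T_level[OF u c[OF that(2)]]])
    hence "a # w = a' # w"
      using bij_betw_Aut_T_level[OF u, of "Suc n"] c that by (meson bij_betw_def inj_onD)
    thus False
      using that(3) by simp
  qed
  thus "label (u (0 # w)) \<noteq> label (u (1 # w))" "label (u (1 # w)) \<noteq> label (u (2 # w))" "label (u (0 # w)) \<noteq> label (u (2 # w))"
    by simp_all
qed

lemma vandermonde_nonzero: "vandermonde0 n \<noteq> 0"
  unfolding vandermonde_def prod_zero_iff[OF finite_T_level] using children_distinct[OF id_in_Aut_T]
  by (metis (no_types, lifting) mult_eq_0_iff right_minus_eq)

lemma vandermonde_equivariant:
  assumes "\<tau> \<in> Aut_over K" "\<And>w. w \<in> T_vertices \<Longrightarrow> label (v w) = \<tau> (label (a w))"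
  shows "vandermonde v n = \<tau> (vandermonde a n)"
proof -
  have c: "i # w \<in> T_vertices" if "i < 3" "w \<in> T_level n" for i w
    using that by (simp add: T_level_def T_vertices_def)
  show ?thesis
    unfolding vandermonde_def Aut_over_prod[OF assms(1)]
    by (rule prod.cong[OF refl]) (simp add: Aut_overD[OF assms(1)] assms(2) c)
qed

text \<open>For m = n each of the 3^n factors changes sign, and this number is odd; otherwise the
  swap merely permutes the factors.\<close>

lemma vandermonde_swap:
  "vandermonde (swap_aut m) n = (if m = n then - vandermonde0 n else vandermonde0 n)"
proof -
  define D where "D w = (label (0 # w) - label (1 # w)) * (label (1 # w) - label (2 # w)) * (label (0 # w) - label (2 # w))" for w
  have c: "i # w \<in> T_level (Suc n)" if "i < 3" "w \<in> T_level n" for i w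
    using that by (simp add: Cons_in_T_level)
  have c': "i # w \<in> T_vertices" if "i < 3" "w \<in> T_level n" for i w
    using that by (simp add: T_level_def T_vertices_def)
  have V0: "vandermonde0 n = (\<Prod>w\<in>T_level n. D w)"
    unfolding vandermonde_def D_def by (rule prod.cong[OF refl]) (simp add: c')
  have "vandermonde (swap_aut m) n = (\<Prod>w\<in>T_level n. (if m = n then - 1 else 1) * D (swap_at m w))"
    unfolding vandermonde_def
  proof (rule prod.cong[OF refl])
    fix w assume w: "w \<in> T_level n"
    have len: "length w = n"
      using w by (simp add: T_level_def)
    show "(label (swap_aut m (0 # w)) - label (swap_aut m (1 # w))) *
      (label (swap_aut m (1 # w)) - label (swap_aut m (2 # w))) * (label (swap_aut m (0 # w)) - label (swap_aut m (2 # w))) =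
      (if m = n then - 1 else 1) * D (swap_at m w)"
      using swap_aut_level[OF c[OF _ w], of 0 m] swap_aut_level[OF c[OF _ w], of 1 m]
        swap_aut_level[OF c[OF _ w], of 2 m] len
      by (auto simp: D_def algebra_simps)
  qed
  also have "\<dots> = (if m = n then - 1 else 1) ^ 3 ^ n * (\<Prod>w\<in>T_level n. D (swap_at m w))"
    by (simp add: prod.distrib card_T_level)
  also have "(\<Prod>w\<in>T_level n. D (swap_at m w)) = vandermonde0 n"
    unfolding V0 by (rule prod.reindex_bij_betw[OF bij_betw_swap_at])
  finally show ?thesis
    by simp
qed

lemma card_R_f: "card {z. poly (iterate_poly f n) z = \<beta>} = Polynomial.degree (iterate_poly f n)"
  by (rule card_simple_fibre) (use simple degree_iterate_poly[OF degree_f, of n] in simp_all)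

lemma prod_fibre_diff:
  "(\<Prod>z | poly (iterate_poly f n) z = \<beta>. z - s) =
    (\<beta> - poly (iterate_poly f n) s) / Polynomial.lead_coeff (iterate_poly f n)"
proof -
  let ?Q = "iterate_poly f n" and ?A = "{z. poly (iterate_poly f n) z = \<beta>}"
  have deg: "Polynomial.degree ?Q = 3 ^ n"
    by (rule degree_iterate_poly[OF degree_f])
  have lc: "Polynomial.lead_coeff ?Q \<noteq> 0"
    using deg by (metis degree_0 leading_coeff_0_iff power_not_zero zero_neq_numeral)
  have "?Q - [:\<beta>:] = Polynomial.smult (Polynomial.lead_coeff ?Q) (\<Prod>y\<in>?A. [:- y, 1:])"
    by (rule simple_fibre_factorization[OF _ card_R_f]) (simp add: deg)
  from arg_cong[OF this, of "\<lambda>p. poly p s"]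
  have "poly ?Q s - \<beta> = Polynomial.lead_coeff ?Q * (\<Prod>y\<in>?A. s - y)"
    by (simp add: poly_prod)
  also have "(\<Prod>y\<in>?A. s - y) = (\<Prod>y\<in>?A. - 1 * (y - s))"
    by (rule prod.cong) simp_all
  also have "\<dots> = (- 1) ^ card ?A * (\<Prod>y\<in>?A. y - s)"
    by (simp only: prod.distrib prod_constant)
  also have "(- 1 :: 'a) ^ card ?A = - 1"
    by (simp add: card_R_f deg)
  finally show ?thesis
    using lc by (simp add: field_simps)
qed

text \<open>As \<open>u\<close> permutes the vertices of level n, it drops out of the product. The
  factors z - f(\<gamma>) over the fibre then multiply to the value in
  \<open>prod_fibre_diff\<close>, where f^n applied to f(\<gamma>) produces the iterate of index n +
  1.\<close>

lemma vandermonde_square: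
  assumes u: "u \<in> carrier Aut_T"
    and f': "pderiv f = Polynomial.smult d ([:- \<gamma>1, 1:] * [:- \<gamma>2, 1:])"
  shows "vandermonde u n ^ 2 = (- 27 / Polynomial.lead_coeff f ^ 2) ^ 3 ^ n *
    ((\<beta> - poly (iterate_poly f (Suc n)) \<gamma>1) * (\<beta> - poly (iterate_poly f (Suc n)) \<gamma>2)) /
    Polynomial.lead_coeff (iterate_poly f n) ^ 2"
proof -
  let ?A = "{z. poly (iterate_poly f n) z = \<beta>}"
  let ?\<kappa> = "- 27 / Polynomial.lead_coeff f ^ 2"
  have fx: "poly f (label (u (a # w))) = label (u w)" if "a < 3" "w \<in> T_level n" for a w
  proof -
    have aw: "a # w \<in> T_vertices"
      using that by (simp add: T_level_def T_vertices_def)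
    obtain a' where a': "u (a # w) = a' # u w"
      by (rule Aut_T_Cons[OF u aw])
    show ?thesis
      using labelling Aut_T_vertices[OF u aw] a' by (simp add: tree_labelling_def)
  qed
  have "vandermonde u n ^ 2 =
      (\<Prod>w\<in>T_level n. ?\<kappa> * ((label (u w) - poly f \<gamma>1) * (label (u w) - poly f \<gamma>2)))"
    unfolding vandermonde_def prod_power_distrib
    by (rule prod.cong[OF refl], rule cubic_discriminant[OF degree_f f'])
       (use fx children_distinct[OF u] in simp_all)
  also have "\<dots> = (\<Prod>w\<in>T_level n. ?\<kappa> * ((label w - poly f \<gamma>1) * (label w - poly f \<gamma>2)))"
    by (rule prod.reindex_bij_betw[OF bij_betw_Aut_T_level[OF u]])
  also have "\<dots> = (\<Prod>z\<in>?A. ?\<kappa> * ((z - poly f \<gamma>1) * (z - poly f \<gamma>2)))"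
    by (rule prod.reindex_bij_betw) (use labelling in \<open>simp add: tree_labelling_def\<close>)
  also have "\<dots> = ?\<kappa> ^ 3 ^ n * ((\<Prod>z\<in>?A. z - poly f \<gamma>1) * (\<Prod>z\<in>?A. z - poly f \<gamma>2))"
    by (simp only: prod.distrib prod_constant card_R_f degree_iterate_poly[OF degree_f])
  also have "\<dots> = ?\<kappa> ^ 3 ^ n *
    ((\<beta> - poly (iterate_poly f (Suc n)) \<gamma>1) * (\<beta> - poly (iterate_poly f (Suc n)) \<gamma>2)) /
    Polynomial.lead_coeff (iterate_poly f n) ^ 2"
    unfolding prod_fibre_diff by (simp add: iterate_poly_Suc poly_pcompose power2_eq_square)
  finally show ?thesis .
qed

text \<open>Two pigeonholes: infinitely many swaps lie in one coset, and infinitely many of the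
  corresponding field automorphisms agree on \<open>S\<close>. Two of them, for different levels m
  and m', treat the square root of level m alike, whereas the swaps give it opposite signs.\<close>

lemma infinite_index_of_finite_signs:
  assumes f': "pderiv f = Polynomial.smult d ([:- \<gamma>1, 1:] * [:- \<gamma>2, 1:])"
    and S: "finite S" "\<And>n. vandermonde0 n \<in> generate_field Kbar (K \<union> S)"
  shows "infinite (rcosets\<^bsub>Aut_T\<^esub> (arboreal_rep f \<beta> h ` Aut_over K))"
proof
  let ?H = "arboreal_rep f \<beta> h ` Aut_over K"
  assume fin: "finite (rcosets\<^bsub>Aut_T\<^esub> ?H)"
  have "(\<lambda>m. ?H #>\<^bsub>Aut_T\<^esub> swap_aut m) ` UNIV \<subseteq> rcosets\<^bsub>Aut_T\<^esub> ?H"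
    using swap_aut_in_Aut_T by (auto simp: RCOSETS_def)
  hence "finite ((\<lambda>m. ?H #>\<^bsub>Aut_T\<^esub> swap_aut m) ` UNIV)"
    using fin finite_subset by blast
  then obtain m0 where m0: "infinite {m. ?H #>\<^bsub>Aut_T\<^esub> swap_aut m = ?H #>\<^bsub>Aut_T\<^esub> swap_aut m0}"
    using pigeonhole_infinite[of UNIV "\<lambda>m. ?H #>\<^bsub>Aut_T\<^esub> swap_aut m"] by auto
  define M where "M = {m. ?H #>\<^bsub>Aut_T\<^esub> swap_aut m = ?H #>\<^bsub>Aut_T\<^esub> swap_aut m0}"
  define a where "a = swap_aut m0"
  have a: "a \<in> carrier Aut_T"
    unfolding a_def by (rule swap_aut_in_Aut_T)
  have "\<exists>\<tau>\<in>Aut_over K. \<forall>w\<in>T_vertices. label (swap_aut m w) = \<tau> (label (a w))" if "m \<in> M" for m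
  proof -
    have "swap_aut m \<in> ?H #>\<^bsub>Aut_T\<^esub> a"
      using in_r_coset_self[OF swap_aut_in_Aut_T[of m]] that by (simp add: M_def a_def)
    thus ?thesis
      unfolding r_coset_rep[OF a] by blast
  qed
  then obtain \<tau> where \<tau>: "\<And>m. m \<in> M \<Longrightarrow> \<tau> m \<in> Aut_over K"
    "\<And>m w. m \<in> M \<Longrightarrow> w \<in> T_vertices \<Longrightarrow> label (swap_aut m w) = \<tau> m (label (a w))"
    by metis
  have "finite ((\<lambda>m. restrict (\<tau> m) S) ` M)"
    by (rule finite_subset[OF _ finite_restrict_Aut_over[OF S(1) alg]]) (use \<tau>(1) in blast)
  then obtain m where m: "m \<in> M" "infinite {m' \<in> M. restrict (\<tau> m') S = restrict (\<tau> m) S}"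
    using pigeonhole_infinite[of M "\<lambda>m. restrict (\<tau> m) S"] m0 unfolding M_def[symmetric] by auto
  have "\<not> {m' \<in> M. restrict (\<tau> m') S = restrict (\<tau> m) S} \<subseteq> {m}"
    using m(2) finite_subset by blast
  then obtain m' where m': "m' \<in> M" "restrict (\<tau> m') S = restrict (\<tau> m) S" "m' \<noteq> m"
    by blast
  \<comment> \<open>The right-hand side of \<open>vandermonde_square\<close> does not mention the
    tree automorphism, so the two square roots agree up to sign and both lie in K(S).\<close>
  have "vandermonde a m ^ 2 = vandermonde0 m ^ 2"
    unfolding vandermonde_square[OF a f'] vandermonde_square[OF id_in_Aut_T f'] ..
  hence "vandermonde a m \<in> generate_field Kbar (K \<union> S)"
    using S(2)[of m] subfield_closed(8)[OF subfield_generate_field] by (auto simp: power2_eq_iff)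
  moreover have "\<tau> m z = \<tau> m' z" if "z \<in> K \<union> S" for z
    using that Aut_overD(4)[OF \<tau>(1)[OF m(1)]] Aut_overD(4)[OF \<tau>(1)[OF m'(1)]] fun_cong[OF m'(2), of z] by auto
  ultimately have "\<tau> m (vandermonde a m) = \<tau> m' (vandermonde a m)"
    using Aut_over_agree[OF \<tau>(1)[OF m(1)] \<tau>(1)[OF m'(1)], of "K \<union> S"] by blast
  hence "vandermonde (swap_aut m) m = vandermonde (swap_aut m') m"
    using vandermonde_equivariant[OF \<tau>(1)[OF m(1)] \<tau>(2)[OF m(1)], where n = m]
      vandermonde_equivariant[OF \<tau>(1)[OF m'(1)] \<tau>(2)[OF m'(1)], where n = m] by simp
  thus False
    using m'(3) vandermonde_nonzero[of m] by (simp add: vandermonde_swap)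
qed

lemma infinite_index:
  assumes f': "pderiv f = Polynomial.smult d ([:- \<gamma>1, 1:] * [:- \<gamma>2, 1:])"
    and "PCF f \<or> (\<exists>n\<ge>1. poly (iterate_poly f n) \<gamma>1 = poly (iterate_poly f n) \<gamma>2)"
  shows "infinite (rcosets\<^bsub>Aut_T\<^esub> (arboreal_rep f \<beta> h ` Aut_over K))"
proof -
  \<comment> \<open>-27 is the constant of \<open>cubic_discriminant\<close>. With its square root
    \<omega> in \<open>S\<close>, the factor \<delta> n lies in K(S), and only a square root of the
    expression in the critical values remains to be found.\<close>
  obtain \<omega> :: 'a where \<omega>: "\<omega> ^ 2 = - 27"
  proof -
    obtain \<omega> :: 'a where "poly [:27, 0, 1:] \<omega> = 0"
      using alg_closed_imp_poly_has_root[of "[:27, 0, 1 :: 'a:]"] by auto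
    hence "27 + \<omega> ^ 2 = 0"
      by (simp add: power2_eq_square)
    thus thesis
      using that by (metis add.commute eq_neg_iff_add_eq_0)
  qed
  define c where "c = Polynomial.lead_coeff f"
  define l where "l n = Polynomial.lead_coeff (iterate_poly f n)" for n
  define \<delta> where "\<delta> n = (\<omega> / c) ^ 3 ^ n / l n" for n
  define p where "p n \<gamma> = poly (iterate_poly f n) \<gamma>" for n \<gamma>
  have sq: "vandermonde0 n ^ 2 = \<delta> n ^ 2 * ((\<beta> - p (Suc n) \<gamma>1) * (\<beta> - p (Suc n) \<gamma>2))" for n
  proof -
    have "\<delta> n ^ 2 = (- 27 / c ^ 2) ^ 3 ^ n / l n ^ 2"
      unfolding \<delta>_def \<omega>[symmetric] power_divide[symmetric] by (simp add: power_divide power_mult_distrib power_mult[symmetric] mult.commute)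
    thus ?thesis
      unfolding vandermonde_square[OF id_in_Aut_T f'] p_def c_def l_def by simp
  qed
  have \<delta>_mem: "\<delta> n \<in> generate_field Kbar (K \<union> S)" if "\<omega> \<in> S" for n S
  proof -
    let ?E = "generate_field Kbar (K \<union> S)"
    note E = subfield_closed[OF subfield_generate_field[of "K \<union> S"]]
    have mem: "c \<in> ?E" "l n \<in> ?E" "\<omega> \<in> ?E"
      using generate_field_incl[of "K \<union> S"] that coeff_f coeff_iterate_poly[OF subfield_K coeff_f]
      by (auto simp: c_def l_def)
    have "(\<omega> / c) ^ i \<in> ?E" for i
      by (induction i) (use E mem in auto)
    thus ?thesis
      unfolding \<delta>_def using E(6) mem(2) by blast
  qed
  have root_mem: "vandermonde0 n \<in> generate_field Kbar (K \<union> S)"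
    if "\<omega> \<in> S" "r \<in> generate_field Kbar (K \<union> S)" "r ^ 2 = (\<beta> - p (Suc n) \<gamma>1) * (\<beta> - p (Suc n) \<gamma>2)" for n S r
  proof -
    note E = subfield_closed[OF subfield_generate_field[of "K \<union> S"]]
    have "vandermonde0 n ^ 2 = (\<delta> n * r) ^ 2"
      unfolding sq that(3)[symmetric] by (simp add: power_mult_distrib)
    hence "vandermonde0 n = \<delta> n * r \<or> vandermonde0 n = - (\<delta> n * r)"
      by (simp add: power2_eq_iff)
    moreover have "\<delta> n * r \<in> generate_field Kbar (K \<union> S)"
      by (rule E(5)[OF \<delta>_mem[OF that(1)] that(2)])
    ultimately show ?thesis
      using E(8) by auto
  qed
  have crit: "poly (pderiv f) \<gamma>1 = 0" "poly (pderiv f) \<gamma>2 = 0"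
    unfolding f' by (simp_all add: algebra_simps)
  show ?thesis
    using assms(2)
  proof
    assume "PCF f"
    define PO where "PO = {poly (iterate_poly f n) \<gamma> | n \<gamma>. n \<ge> 1 \<and> poly (pderiv f) \<gamma> = 0}"
    have "finite PO"
      using \<open>PCF f\<close> by (simp add: PCF_def PO_def)
    have "\<exists>r. r ^ 2 = (\<beta> - y) * (\<beta> - z)" for y z
      using alg_closed_imp_poly_has_root[of "[:- ((\<beta> - y) * (\<beta> - z)), 0, 1:]"]
      by (auto simp: power2_eq_square)
    then obtain r where r: "\<And>y z. r y z ^ 2 = (\<beta> - y) * (\<beta> - z)"
      by metis
    \<comment> \<open>The critical values at every level come from the finite postcritical set, so
      finitely many square roots, one for each pair, serve all levels.\<close>
    define S where "S = insert \<omega> ((\<lambda>(y, z). r y z) ` (PO \<times> PO))"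
    have "finite S"
      using \<open>finite PO\<close> by (simp add: S_def)
    moreover have "vandermonde0 n \<in> generate_field Kbar (K \<union> S)" for n
    proof (rule root_mem[OF _ _ r])
      show "\<omega> \<in> S"
        by (simp add: S_def)
      have "p (Suc n) \<gamma> \<in> PO" if "poly (pderiv f) \<gamma> = 0" for \<gamma>
        unfolding PO_def p_def using that by (intro CollectI exI[of _ "Suc n"] exI[of _ \<gamma>]) simp
      hence "r (p (Suc n) \<gamma>1) (p (Suc n) \<gamma>2) \<in> S"
        unfolding S_def using crit by blast
      thus "r (p (Suc n) \<gamma>1) (p (Suc n) \<gamma>2) \<in> generate_field Kbar (K \<union> S)"
        using generate_field_incl[of "K \<union> S"] by blast
    qed
    ultimately show ?thesis
      by (rule infinite_index_of_finite_signs[OF f'])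
  next
    assume "\<exists>n\<ge>1. poly (iterate_poly f n) \<gamma>1 = poly (iterate_poly f n) \<gamma>2"
    then obtain m where m: "p m \<gamma>1 = p m \<gamma>2"
      by (auto simp: p_def)
    have coll: "p n \<gamma>1 = p n \<gamma>2" if "m \<le> n" for n
    proof -
      have "(poly f ^^ n) y = (poly f ^^ (n - m)) ((poly f ^^ m) y)" for y
        using that by (simp flip: comp_apply[of "poly f ^^ (n - m)"] funpow_add)
      thus ?thesis
        using m by (simp add: p_def poly_iterate_poly)
    qed
    \<comment> \<open>From level m on the two factors under the root coincide, so the product is a
      square in K(\<gamma>1). The finitely many earlier levels are put into \<open>S\<close>
      outright.\<close>
    define S where "S = {\<omega>, \<gamma>1} \<union> vandermonde0 ` {..<m}"
    have "vandermonde0 n \<in> generate_field Kbar (K \<union> S)" for n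
    proof (cases "n < m")
      case True
      thus ?thesis
        using generate_field_incl[of "K \<union> S"] by (auto simp: S_def)
    next
      case False
      note E = subfield_closed[OF subfield_generate_field[of "K \<union> S"]]
      have KS: "K \<union> S \<subseteq> generate_field Kbar (K \<union> S)"
        by (rule generate_field_incl)
      have "p (Suc n) \<gamma>1 \<in> generate_field Kbar (K \<union> S)"
        unfolding p_def
        by (rule poly_in_subfield[OF subfield_generate_field])
           (use KS coeff_iterate_poly[OF subfield_K coeff_f] in \<open>auto simp: S_def\<close>)
      hence mem: "\<beta> - p (Suc n) \<gamma>1 \<in> generate_field Kbar (K \<union> S)"
        using E(4) \<beta> KS by blast
      show ?thesis
        by (rule root_mem[OF _ mem]) (use coll[of "Suc n"] False in \<open>simp_all add: S_def power2_eq_square\<close>)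
    qed
    thus ?thesis
      by (intro infinite_index_of_finite_signs[OF f', of S]) (simp_all add: S_def)
  qed
qed

end

section \<open>Conjugation to constant coefficients\<close>

lemma finite_image_factor:
  assumes "finite (u ` A)" "\<And>a b. a \<in> A \<Longrightarrow> b \<in> A \<Longrightarrow> u a = u b \<Longrightarrow> v a = v b"
  shows "finite (v ` A)"
proof (rule finite_subset)
  show "v ` A \<subseteq> (\<lambda>y. v (inv_into A u y)) ` u ` A"
  proof (rule image_subsetI)
    fix a assume a: "a \<in> A"
    have "v a = v (inv_into A u (u a))"
      by (rule assms(2)[OF a inv_into_into]) (use a in \<open>simp_all add: f_inv_into_f\<close>)
    thus "v a \<in> (\<lambda>y. v (inv_into A u y)) ` u ` A"
      using a by blast
  qed
qed (use assms(1) in simp)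

text \<open>An image that is finite as a set has finite cosets, and finitely many of these cannot
  contain the infinitely many swaps. Multiplicities are allowed, since a base point with
  \<sigma>(\<beta>) in k may be postcritical.\<close>

lemma infinite_index_constant:
  assumes alg: "\<And>x. alg_over K x" and bij: "bij_betw h (preimage_vertices f \<beta>) T_vertices"
    and S: "finite S" "\<And>i z. poly (iterate_poly f i) z = \<beta> \<Longrightarrow> z \<in> generate_field Kbar (K \<union> S)"
  shows "infinite (rcosets\<^bsub>Aut_T\<^esub> (arboreal_rep f \<beta> h ` Aut_over K))"
proof
  let ?H = "arboreal_rep f \<beta> h ` Aut_over K"
  assume fin: "finite (rcosets\<^bsub>Aut_T\<^esub> ?H)"
  have "finite ?H"
  proof (rule finite_image_factor[OF finite_restrict_Aut_over[OF S(1) alg]])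
    fix \<tau> \<tau>' assume \<tau>: "\<tau> \<in> Aut_over K" "\<tau>' \<in> Aut_over K" "restrict \<tau> S = restrict \<tau>' S"
    have agree: "\<tau> z = \<tau>' z" if "z \<in> K \<union> S" for z
      using that Aut_overD(4)[OF \<tau>(1), of z] Aut_overD(4)[OF \<tau>(2), of z] fun_cong[OF \<tau>(3), of z] by auto
    show "arboreal_rep f \<beta> h \<tau> = arboreal_rep f \<beta> h \<tau>'"
      by (rule arboreal_rep_cong[OF bij]) (rule Aut_over_agree[OF \<tau>(1,2) agree S(2)])
  qed
  hence "finite (?H #>\<^bsub>Aut_T\<^esub> a)" for a
    unfolding r_coset_def by (rule finite_UN_I) simp
  hence "finite (\<Union>(rcosets\<^bsub>Aut_T\<^esub> ?H))"
    using fin by (auto simp: RCOSETS_def)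
  moreover have "range swap_aut \<subseteq> \<Union>(rcosets\<^bsub>Aut_T\<^esub> ?H)"
  proof (rule image_subsetI)
    fix m
    have a: "swap_aut m \<in> carrier Aut_T"
      by (rule swap_aut_in_Aut_T)
    have "arboreal_rep f \<beta> h (\<lambda>x. x) = (\<lambda>w\<in>T_vertices. w)"
      unfolding arboreal_rep_def using bij
      by (intro restrict_ext) (auto simp: bij_betw_def f_inv_into_f split: prod.split)
    hence "(\<lambda>w\<in>T_vertices. w) \<in> ?H"
      using Aut_over_id by (metis image_eqI)
    moreover have "(\<lambda>w\<in>T_vertices. w) \<otimes>\<^bsub>Aut_T\<^esub> swap_aut m = swap_aut m"
      using a id_in_Aut_T by (simp add: mult_Aut_T carrier_Aut_T Id_compose Bij_imp_funcset Bij_imp_extensional)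
    ultimately have "swap_aut m \<in> ?H #>\<^bsub>Aut_T\<^esub> swap_aut m"
      unfolding r_coset_def by force
    thus "swap_aut m \<in> \<Union>(rcosets\<^bsub>Aut_T\<^esub> ?H)"
      using a by (auto simp: RCOSETS_def)
  qed
  ultimately have "finite (range swap_aut)"
    using finite_subset by blast
  thus False
    using range_inj_infinite[OF inj_swap_aut] by blast
qed

lemma poly_semiconjugate:
  fixes \<sigma> :: "'a::field_char_0 poly"
  assumes "Polynomial.degree \<sigma> = 1" "pcompose g \<sigma> = pcompose \<sigma> f"
  shows "poly g (poly \<sigma> z) = poly \<sigma> (poly f z)" "poly (pderiv g) (poly \<sigma> z) = poly (pderiv f) z"
proof -
  show "poly g (poly \<sigma> z) = poly \<sigma> (poly f z)"
    using arg_cong[OF assms(2), of "\<lambda>p. poly p z"] by (simp add: poly_pcompose)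
  obtain s0 s1 where s: "\<sigma> = [:s0, s1:]"
    using degree1_coeffs assms(1) by (metis One_nat_def)
  have "s1 \<noteq> 0"
    using assms(1) s by auto
  moreover have "pcompose (pderiv g) \<sigma> * [:s1:] = [:s1:] * pderiv f"
    using arg_cong[OF assms(2), of pderiv] by (simp add: pderiv_pcompose s pderiv_pCons)
  from arg_cong[OF this, of "\<lambda>p. poly p z"] have "poly (pderiv g) (poly \<sigma> z) * s1 = s1 * poly (pderiv f) z"
    by (simp add: poly_pcompose)
  ultimately show "poly (pderiv g) (poly \<sigma> z) = poly (pderiv f) z"
    by simp
qed

lemma iterate_poly_semiconjugate:
  fixes \<sigma> :: "'a::field_char_0 poly"
  assumes "pcompose g \<sigma> = pcompose \<sigma> f"
  shows "pcompose (iterate_poly g n) \<sigma> = pcompose \<sigma> (iterate_poly f n)"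
proof (induction n)
  case 0
  show ?case
    by (simp add: iterate_poly_0 pcompose_pCons pcompose_idR)
next
  case (Suc n)
  have "pcompose (iterate_poly g (Suc n)) \<sigma> = pcompose (iterate_poly g n) (pcompose \<sigma> f)"
    by (simp add: iterate_poly_Suc flip: pcompose_assoc assms)
  also have "\<dots> = pcompose (pcompose \<sigma> (iterate_poly f n)) f"
    by (simp add: pcompose_assoc Suc)
  also have "\<dots> = pcompose \<sigma> (iterate_poly f (Suc n))"
    by (simp add: iterate_poly_Suc pcompose_assoc)
  finally show ?case .
qed

text \<open>By \<open>alg_over_exchange\<close>, b can serve as a transcendence basis in place of t,
  so K and then its closure are algebraic over k(b).\<close>

lemma alg_over_function_field:
  fixes k K :: "'a::field_char_0 set"
  assumes "function_field_trdeg_1 k K" and alg: "\<And>x. alg_over K x"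
    and b: "\<not> alg_over k b"
  shows "alg_over (generate_field Kbar (insert b k)) x"
proof -
  obtain t where k: "subfield k (Kbar :: 'a ring)" and t: "t \<in> K"
    "\<And>x. x \<in> K \<Longrightarrow> (ring.algebraic Kbar over generate_field Kbar (insert t k)) x"
    using assms(1) unfolding function_field_trdeg_1_def by blast
  let ?E = "generate_field Kbar (insert t k)" and ?F = "generate_field Kbar (insert b k)"
  have E: "subfield ?E Kbar" and F: "subfield ?F Kbar"
    by (rule subfield_generate_field)+
  have "alg_over ?E y" for y
    by (rule alg_over_trans[OF E _ alg]) (use t(2) algebraic_iff_alg_over[OF E] in blast)
  moreover have "alg_over ?F z" if "z \<in> ?E" for z
  proof (rule alg_over_generate_field[OF F _ that])
    fix y assume "y \<in> insert t k"
    thus "alg_over ?F y"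
      using alg_over_exchange[OF k b \<open>alg_over ?E b\<close>] alg_over_self[OF F, of y] generate_field_incl[of "insert b k"]
      by blast
  qed
  ultimately show ?thesis
    using alg_over_trans[OF F, of ?E x] by blast
qed

theorem theorem12p4:
  fixes k K :: "'a::{alg_closed_field, field_char_0} set"
    and f \<sigma> :: "'a poly" and \<beta> :: 'a
    and h :: "nat \<times> 'a \<times> nat \<Rightarrow> nat list"
  assumes "function_field_trdeg_1 k K"
    and "algebraically_closed (Kbar\<lparr>carrier := k\<rparr>)"
    and "algebraic_closure Kbar K"
    and "set (Polynomial.coeffs f) \<subseteq> K" and "Polynomial.degree f = 3"
    and "\<beta> \<in> K"
    and "Polynomial.degree \<sigma> = 1"
    and "set (Polynomial.coeffs (pcompose \<sigma> (pcompose f (linear_inverse \<sigma>)))) \<subseteq> k"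
    and "tree_iso (preimage_vertices f \<beta>) (preimage_edges f \<beta>) T_vertices T_edges h"
  shows "(poly \<sigma> \<beta> \<notin> k \<and> \<not> PCF f \<and>
           (\<exists>\<gamma>1 \<gamma>2. \<gamma>1 \<noteq> \<gamma>2 \<and> poly (pderiv f) \<gamma>1 = 0 \<and> poly (pderiv f) \<gamma>2 = 0 \<and>
              (\<forall>n\<ge>1. poly (iterate_poly f n) \<gamma>1 \<noteq> poly (iterate_poly f n) \<gamma>2)))
         \<longleftrightarrow> finite (rcosets\<^bsub>Aut_T\<^esub> (arboreal_rep f \<beta> h ` carrier (G_infinity K f \<beta>)))"
    (is "?L \<longleftrightarrow> finite (rcosets\<^bsub>Aut_T\<^esub> ?H)")
proof -
  obtain S where k: "subfield k (Kbar :: 'a ring)" and K: "subfield K (Kbar :: 'a ring)" "k \<subseteq> K"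
    and S: "finite S" "K = generate_field Kbar (k \<union> S)"
    using assms(1) unfolding function_field_trdeg_1_def by blast
  have alg: "alg_over K z" for z
    using algebraic_closure.algebraic_extension[OF assms(3), of z] algebraic_iff_alg_over[OF K(1)] by simp
  have f: "\<forall>i. poly.coeff f i \<in> K"
    using assms(4) coeffs_subset_iff[OF subfield_closed(1)[OF K(1)]] by blast
  have bij: "bij_betw h (preimage_vertices f \<beta>) T_vertices"
    using assms(9) by (simp add: tree_iso_def)
  have H: "?H = arboreal_rep f \<beta> h ` Aut_over K"
    by (rule image_arboreal_rep[OF K(1) f assms(5,6) alg bij])
  obtain s0 s1 where \<sigma>: "\<sigma> = [:s0, s1:]"
    using degree1_coeffs assms(7) by (metis One_nat_def)
  have s1: "s1 \<noteq> 0"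
    using assms(7) \<sigma> by auto
  have inj\<sigma>: "poly \<sigma> y = poly \<sigma> z \<longleftrightarrow> y = z" for y z
    using s1 by (simp add: \<sigma>)
  define g where "g = pcompose \<sigma> (pcompose f (linear_inverse \<sigma>))"
  define b where "b = poly \<sigma> \<beta>"
  have gk: "\<forall>i. poly.coeff g i \<in> k"
    using assms(8) coeffs_subset_iff[OF subfield_closed(1)[OF k]] by (simp add: g_def)
  have degg: "Polynomial.degree g = 3"
    using assms(5,7) s1 by (simp add: g_def degree_pcompose linear_inverse_def \<sigma>)
  have conj: "pcompose g \<sigma> = pcompose \<sigma> f"
    unfolding g_def by (simp add: linear_inverse(2)[OF assms(7)] pcompose_idR flip: pcompose_assoc)
  note iter = poly_semiconjugate[OF assms(7) iterate_poly_semiconjugate[OF conj]]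
  have fibre: "poly (iterate_poly g n) (poly \<sigma> z) = b \<longleftrightarrow> poly (iterate_poly f n) z = \<beta>" for n z
    by (simp add: iter(1) b_def inj\<sigma>)
  have crit: "poly (pderiv g) (poly \<sigma> z) = 0 \<longleftrightarrow> poly (pderiv f) z = 0" for z
    using poly_semiconjugate(2)[OF assms(7) conj] by simp
  have surj\<sigma>: "\<exists>z. poly \<sigma> z = y" for y
    using s1 by (intro exI[of _ "(y - s0) / s1"]) (simp add: \<sigma>)
  show ?thesis
  proof (cases "b \<in> k")
    case True
    \<comment> \<open>Over b in \<open>k\<close> all points of the fibres of g are algebraic over
      \<open>k\<close>, hence in \<open>k\<close>; undoing \<sigma> costs only its two
      coefficients.\<close>
    have "z \<in> generate_field Kbar (K \<union> {s0, s1})" if z: "poly (iterate_poly f i) z = \<beta>" for i z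
    proof -
      let ?E = "generate_field Kbar (K \<union> {s0, s1})"
      note E = subfield_closed[OF subfield_generate_field[of "K \<union> {s0, s1}"]]
      have KE: "K \<union> {s0, s1} \<subseteq> ?E"
        by (rule generate_field_incl)
      define p where "p = iterate_poly g i - [:b:]"
      have "\<forall>j. poly.coeff p j \<in> k"
        using coeff_iterate_poly[OF k gk, of i] True subfield_closed(1,4)[OF k]
        by (simp add: p_def coeff_pCons split: nat.split)
      moreover have "p \<noteq> 0"
        unfolding p_def by (rule iterate_poly_diff_nonzero[OF degg])
      moreover have "poly p (poly \<sigma> z) = 0"
        using z fibre by (simp add: p_def)
      ultimately have "poly \<sigma> z \<in> k"
        by (intro alg_closed_subfield_mem[OF k assms(2)]) (auto simp: alg_over_def)
      hence "(poly \<sigma> z - s0) / s1 \<in> ?E"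
        using E(4,6) K(2) KE by blast
      moreover have "(poly \<sigma> z - s0) / s1 = z"
        using s1 by (simp add: \<sigma>)
      ultimately show ?thesis
        by simp
    qed
    hence "infinite (rcosets\<^bsub>Aut_T\<^esub> ?H)"
      unfolding H by (intro infinite_index_constant[OF alg bij, of "{s0, s1}"]) simp_all
    thus ?thesis
      using True by (simp add: b_def)
  next
    case False
    have "\<not> alg_over k b"
      using False alg_closed_subfield_mem[OF k assms(2)] by blast
    hence alg': "alg_over (generate_field Kbar (insert b k)) z" for z
      by (rule alg_over_function_field[OF assms(1) alg])
    interpret G: constant_cubic k g b
      by (rule constant_cubic.intro[OF k assms(2) gk degg False alg'])
    interpret simple_tree K f \<beta> h
    proof (rule simple_tree.intro[OF K(1) f assms(5,6) alg assms(9)])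
      fix n z assume "poly (iterate_poly f n) z = \<beta>"
      hence "poly (pderiv (iterate_poly g n)) (poly \<sigma> z) \<noteq> 0"
        using G.fibre_simple[of "poly \<sigma> z" n] fibre by simp
      thus "poly (pderiv (iterate_poly f n)) z \<noteq> 0"
        by (simp add: iter(2))
    qed
    have deg2: "Polynomial.degree (pderiv f) = 2" "Polynomial.degree (pderiv g) = 2"
      using assms(5) degg by (simp_all add: degree_pderiv)
    show ?thesis
    proof
      assume L: ?L
      then obtain \<gamma>1 \<gamma>2 where \<gamma>: "\<gamma>1 \<noteq> \<gamma>2" "poly (pderiv f) \<gamma>1 = 0" "poly (pderiv f) \<gamma>2 = 0"
        "\<And>n. n \<ge> 1 \<Longrightarrow> poly (iterate_poly f n) \<gamma>1 \<noteq> poly (iterate_poly f n) \<gamma>2"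
        by blast
      obtain c \<delta>1 \<delta>2 where c: "c \<noteq> 0" "pderiv g = Polynomial.smult c ([:- \<delta>1, 1:] * [:- \<delta>2, 1:])"
        by (rule quadratic_factorization[OF deg2(2)])
      have "poly (pderiv g) y = 0 \<longleftrightarrow> y = \<delta>1 \<or> y = \<delta>2" for y
        unfolding c(2) poly_smult poly_mult using c(1) by auto
      hence roots: "{y. poly (pderiv g) y = 0} = {\<delta>1, \<delta>2}"
        by blast
      have "poly \<sigma> \<gamma>1 \<in> {\<delta>1, \<delta>2}" "poly \<sigma> \<gamma>2 \<in> {\<delta>1, \<delta>2}"
        using \<gamma>(2,3) crit by (simp_all flip: roots)
      moreover have "poly \<sigma> \<gamma>1 \<noteq> poly \<sigma> \<gamma>2"
        using \<gamma>(1) inj\<sigma> by simp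
      ultimately have \<delta>: "\<delta>1 \<noteq> \<delta>2" "{y. poly (pderiv g) y = 0} = {poly \<sigma> \<gamma>1, poly \<sigma> \<gamma>2}"
        unfolding roots by auto
      have "\<not> PCF g"
      proof
        assume "PCF g"
        have "poly \<sigma> ` {poly (iterate_poly f n) \<gamma> | n \<gamma>. n \<ge> 1 \<and> poly (pderiv f) \<gamma> = 0} \<subseteq>
            {poly (iterate_poly g n) \<gamma> | n \<gamma>. n \<ge> 1 \<and> poly (pderiv g) \<gamma> = 0}"
        proof (rule image_subsetI)
          fix y assume "y \<in> {poly (iterate_poly f n) \<gamma> | n \<gamma>. n \<ge> 1 \<and> poly (pderiv f) \<gamma> = 0}"
          then obtain n \<gamma> where n: "y = poly (iterate_poly f n) \<gamma>" "n \<ge> 1" "poly (pderiv f) \<gamma> = 0"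
            by blast
          have "poly \<sigma> y = poly (iterate_poly g n) (poly \<sigma> \<gamma>)" "poly (pderiv g) (poly \<sigma> \<gamma>) = 0"
            using n crit by (simp_all add: iter(1))
          thus "poly \<sigma> y \<in> {poly (iterate_poly g n) \<gamma> | n \<gamma>. n \<ge> 1 \<and> poly (pderiv g) \<gamma> = 0}"
            using n(2) by blast
        qed
        hence "finite (poly \<sigma> ` {poly (iterate_poly f n) \<gamma> | n \<gamma>. n \<ge> 1 \<and> poly (pderiv f) \<gamma> = 0})"
          using \<open>PCF g\<close> finite_subset unfolding PCF_def by blast
        hence "PCF f"
          unfolding PCF_def by (rule finite_imageD) (simp add: inj_on_def inj\<sigma>)
        with L show False
          by blast
      qed
      have ne: "(poly g ^^ n) (poly \<sigma> \<gamma>1) \<noteq> (poly g ^^ n) (poly \<sigma> \<gamma>2)" if "n \<ge> 1" for n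
        using \<gamma>(4)[OF that] iter(1)[of n \<gamma>1] iter(1)[of n \<gamma>2] inj\<sigma>
        by (simp flip: poly_iterate_poly)
      obtain \<gamma> where w: "poly (pderiv g) \<gamma> = 0"
        "\<forall>n i \<delta>. 1 \<le> i \<longrightarrow> i \<le> n \<longrightarrow> poly (pderiv g) \<delta> = 0 \<longrightarrow>
            (poly g ^^ i) \<delta> = (poly g ^^ n) \<gamma> \<longrightarrow> i = n \<and> \<delta> = \<gamma>"
        using wandering_critical_point[OF \<delta>(2) \<open>\<not> PCF g\<close> ne] by metis
      obtain \<gamma>' where \<gamma>': "pderiv g = Polynomial.smult c ([:- \<gamma>, 1:] * [:- \<gamma>', 1:])" "\<gamma> \<noteq> \<gamma>'"
      proof -
        have "\<gamma> = \<delta>1 \<or> \<gamma> = \<delta>2"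
          using w(1) roots by blast
        thus thesis
          using that[of \<delta>1] that[of \<delta>2] c(2) \<delta>(1) by (metis mult.commute)
      qed
      interpret wandering_cubic k g b \<gamma> \<gamma>' c
        by (rule wandering_cubic.intro[OF G.constant_cubic_axioms], rule wandering_cubic_axioms.intro)
           (use c(1) \<gamma>' w(2) in blast)+
      \<comment> \<open>The labels are transported by \<sigma> to the tree of \<open>g\<close>,
        where every tree automorphism is induced by a field automorphism over k(b).\<close>
      define label' where "label' v = poly \<sigma> (label v)" for v
      have label': "tree_labelling g b label'"
        unfolding tree_labelling_def
      proof (intro conjI allI impI)
        fix n
        have "bij_betw (poly \<sigma>) {z. poly (iterate_poly f n) z = \<beta>} {z. poly (iterate_poly g n) z = b}"
        proof (rule bij_betw_imageI)
          show "inj_on (poly \<sigma>) {z. poly (iterate_poly f n) z = \<beta>}"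
            by (simp add: inj_on_def inj\<sigma>)
          show "poly \<sigma> ` {z. poly (iterate_poly f n) z = \<beta>} = {z. poly (iterate_poly g n) z = b}"
            using fibre[of n] surj\<sigma> by (auto simp: image_iff) metis
        qed
        moreover have "bij_betw label (T_level n) {z. poly (iterate_poly f n) z = \<beta>}"
          using labelling by (simp add: tree_labelling_def)
        moreover have "label' = poly \<sigma> \<circ> label"
          by (auto simp: label'_def)
        ultimately show "bij_betw label' (T_level n) {z. poly (iterate_poly g n) z = b}"
          using bij_betw_trans by metis
      next
        fix a v assume "a # v \<in> T_vertices"
        thus "poly g (label' (a # v)) = label' v"
          using labelling poly_semiconjugate(1)[OF assms(7) conj]
          by (simp add: label'_def tree_labelling_def)
      qed
      obtain \<tau> where \<tau>: "\<And>a. a \<in> carrier Aut_T \<Longrightarrow> \<tau> a \<in> Aut_over G.F"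
        "\<And>a v. a \<in> carrier Aut_T \<Longrightarrow> v \<in> T_vertices \<Longrightarrow> \<tau> a (label' v) = label' (a v)"
        using tree_automorphism_realised[OF label'] by metis
      \<comment> \<open>Generators of \<open>K\<close> over \<open>k\<close> and the coefficients of
        \<sigma>: an automorphism over k(b) that fixes this finite set fixes \<open>K\<close> and
        commutes with \<sigma>.\<close>
      define S' where "S' = S \<union> {s0, s1}"
      define \<tau>' where "\<tau>' a = inv_into UNIV (\<tau> a)" for a
      have \<tau>': "\<tau>' a \<in> Aut_over G.F" "\<tau>' a (\<tau> a z) = z" "\<tau> a (\<tau>' a z) = z" if "a \<in> carrier Aut_T" for a z
        unfolding \<tau>'_def using Aut_over_inv[OF \<tau>(1)[OF that]] Aut_overD(1)[OF \<tau>(1)[OF that]]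
        by (simp_all add: bij_def surj_f_inv_f)
      have "finite ((\<lambda>\<tau>. restrict \<tau> S') ` Aut_over G.F)"
        by (rule finite_restrict_Aut_over) (use S(1) alg' in \<open>simp_all add: S'_def\<close>)
      moreover have "(\<lambda>a. restrict (\<tau>' a) S') ` carrier Aut_T \<subseteq> (\<lambda>\<tau>. restrict \<tau> S') ` Aut_over G.F"
        using \<tau>'(1) by blast
      ultimately have "finite ((\<lambda>a. restrict (\<tau>' a) S') ` carrier Aut_T)"
        by (rule rev_finite_subset)
      \<comment> \<open>The inverse of \<tau> a, restricted to \<open>S'\<close>, determines the
        coset of a: if the inverses for a and a' agree on \<open>S'\<close>, then \<tau> a after the
        inverse of \<tau> a' fixes \<open>S'\<close> pointwise and carries the labels of a' to those
        of a.\<close>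
      hence "finite ((\<lambda>a. (arboreal_rep f \<beta> h ` Aut_over K) #>\<^bsub>Aut_T\<^esub> a) ` carrier Aut_T)"
      proof (rule finite_image_factor)
        fix a a' assume a: "a \<in> carrier Aut_T" "a' \<in> carrier Aut_T" and eq: "restrict (\<tau>' a) S' = restrict (\<tau>' a') S'"
        define \<rho> where "\<rho> = \<tau> a \<circ> \<tau>' a'"
        have \<rho>F: "\<rho> \<in> Aut_over G.F"
          unfolding \<rho>_def by (rule Aut_over_comp[OF \<tau>(1)[OF a(1)] \<tau>'(1)[OF a(2)]])
        have \<rho>S: "\<rho> s = s" if "s \<in> S'" for s
          using fun_cong[OF eq, of s] that \<tau>'(3)[OF a(1), of s] by (simp add: \<rho>_def)
        have "\<rho> s = s" if "s \<in> k \<union> S" for s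
          using that \<rho>S[of s] Aut_overD(4)[OF \<rho>F, of s] generate_field_incl[of "insert b k"] by (auto simp: S'_def)
        hence "\<rho> \<in> Aut_over (k \<union> S)"
          using \<rho>F by (simp add: Aut_over_def)
        hence \<rho>K: "\<rho> \<in> Aut_over K"
          unfolding S(2) by (rule Aut_over_generate_field)
        show "(arboreal_rep f \<beta> h ` Aut_over K) #>\<^bsub>Aut_T\<^esub> a = (arboreal_rep f \<beta> h ` Aut_over K) #>\<^bsub>Aut_T\<^esub> a'"
        proof (rule r_coset_eqI[OF a \<rho>K])
          fix v assume v: "v \<in> T_vertices"
          have "\<rho> (label' (a' v)) = label' (a v)"
            using \<tau>(2)[OF a(1) v] \<tau>(2)[OF a(2) v] \<tau>'(2)[OF a(2), of "label' v"] by (simp add: \<rho>_def)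
          moreover have "\<rho> (label' (a' v)) = poly \<sigma> (\<rho> (label (a' v)))"
            using \<rho>S[of s0] \<rho>S[of s1] by (simp add: label'_def \<sigma> Aut_overD(2,3)[OF \<rho>F] S'_def)
          ultimately show "label (a v) = \<rho> (label (a' v))"
            using inj\<sigma> by (simp add: label'_def)
        qed
      qed
      thus "finite (rcosets\<^bsub>Aut_T\<^esub> ?H)"
        unfolding H RCOSETS_def by (simp add: UNION_singleton_eq_range)
    next
      assume fin: "finite (rcosets\<^bsub>Aut_T\<^esub> ?H)"
      obtain d \<gamma>1 \<gamma>2 where d: "d \<noteq> 0" "pderiv f = Polynomial.smult d ([:- \<gamma>1, 1:] * [:- \<gamma>2, 1:])"
        by (rule quadratic_factorization[OF deg2(1)])
      have *: "\<not> PCF f" "\<forall>n\<ge>1. poly (iterate_poly f n) \<gamma>1 \<noteq> poly (iterate_poly f n) \<gamma>2"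
        using infinite_index[OF d(2)] fin unfolding H by blast+
      have "\<gamma>1 \<noteq> \<gamma>2"
        using *(2) by (metis le_refl)
      moreover have "poly (pderiv f) \<gamma>1 = 0" "poly (pderiv f) \<gamma>2 = 0"
        unfolding d(2) poly_smult poly_mult by simp_all
      ultimately show ?L
        using False * by (auto simp: b_def)
    qed
  qed
qed

end
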